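(* Let $G=(V,E)$ be a locally finite graph and $s\colon E\to\{-1,1\}$ a sign function. If the random walk $(X(t)\colon t\ge0)$ on $G$ (from any starting site) traverses, with probability $1$, infinitely many unsatisfied cycles, then the signed voter model on $(G,s)$ is ergodic.
   Context: All graphs are simple, with countable vertex set and with every vertex $x$ of finite degree $d(x)\ge1$. Given $G=(V,E)$ and $s\colon E\to\{-1,1\}$ (write $s(x,y)=s(\{x,y\})$), the signed voter model $(\eta_t)_{t\ge0}$ is the spin system on $\{-1,1\}^V$ with generator $$\Omega f(\eta)=\sum_{x\in V}\big(f(\eta^x)-f(\eta)\big)\frac1{d(x)}\sum_{y\colon\{x,y\}\in E}1\{\eta(x)\eta(y)\ne s(x,y)\},$$ where $\eta^x$ is $\eta$ with the spin at $x$ flipped. An equilibrium is an invariant probability measure. The process is ergodic if there is a unique equilibrium $\mu$ and, for every initial configuration $\eta_0$, $\eta_t$ converges in distribution to $\mu$ as $t\to\infty$. The random walk on $G$ is the continuous-time walk which jumps from $x$ to each neighbour of $x$ at rate $1/d(x)$. A nearest neighbour path $(\gamma(u)\colon a\le u\le b)$ with finitely many jumps, at times $t_1,\dots,t_n$, is odd (negative) if the number of $i$ with $s(\gamma(t_i^-),\gamma(t_i))=-1$ is odd, and even (positive) otherwise. For a path $\gamma=(\gamma(u))_{u\ge0}$ and $0\le a\le b$, $\gamma^{a,b}$ is the path $(\gamma(u)\colon a\le u\le b)$. The path $\gamma$ traverses infinitely many unsatisfied cycles if there are sequences $(s_i)_{i\ge1},(t_i)_{i\ge1}$ tending to infinity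 with $s_i<t_i$, $\gamma(s_i)=\gamma(t_i)$ and $\gamma^{s_i,t_i}$ odd for every $i$ (the path $\gamma^{s_i,t_i}$ is not required to be self-avoiding). *)

theory Defs
  imports "HOL-Probability.Probability"
begin

section \<open>Graphs\<close>

definition nbrs :: "'v set set \<Rightarrow> 'v \<Rightarrow> 'v set" where
  "nbrs E x = {y. {x, y} \<in> E}"

definition deg :: "'v set set \<Rightarrow> 'v \<Rightarrow> nat" where
  "deg E x = card (nbrs E x)"

definition lf_graph :: "'v set \<Rightarrow> 'v set set \<Rightarrow> bool" where
  "lf_graph V E \<longleftrightarrow>
     countable V \<and>
     (\<forall>e\<in>E. e \<subseteq> V \<and> card e = 2) \<and>
     (\<forall>x\<in>V. finite (nbrs E x) \<and> deg E x \<ge> 1)"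

definition sign_function :: "'v set set \<Rightarrow> ('v set \<Rightarrow> int) \<Rightarrow> bool" where
  "sign_function E s \<longleftrightarrow> (\<forall>e\<in>E. s e \<in> {-1, 1})"


section \<open>Configurations\<close>

text \<open>
  Configurations are the extensional functions from \<open>V\<close> to \<open>{-1, 1}\<close>.  As \<open>V\<close> is countable,
  \<open>config_space V\<close> is the Borel \<open>\<sigma>\<close>-algebra of \<open>config_topology V\<close>.
\<close>

definition config_space :: "'v set \<Rightarrow> ('v \<Rightarrow> int) measure" where
  "config_space V = PiM V (\<lambda>_. count_space {-1, 1})"

definition config_topology :: "'v set \<Rightarrow> ('v \<Rightarrow> int) topology" where
  "config_topology V = product_topology (\<lambda>_. discrete_topology {-1, 1}) V"

definition continuous_observable :: "'v set \<Rightarrow> (('v \<Rightarrow> int) \<Rightarrow> real) \<Rightarrow> bool" where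
  "continuous_observable V f \<longleftrightarrow> continuous_map (config_topology V) euclideanreal f"

definition cylinder :: "'v set \<Rightarrow> (('v \<Rightarrow> int) \<Rightarrow> real) \<Rightarrow> bool" where
  "cylinder V f \<longleftrightarrow>
     (\<exists>A. finite A \<and> A \<subseteq> V \<and>
        (\<forall>\<eta>\<in>space (config_space V). \<forall>\<zeta>\<in>space (config_space V).
           (\<forall>x\<in>A. \<eta> x = \<zeta> x) \<longrightarrow> f \<eta> = f \<zeta>))"


section \<open>The signed voter model\<close>

definition flip :: "('v \<Rightarrow> int) \<Rightarrow> 'v \<Rightarrow> ('v \<Rightarrow> int)" where
  "flip \<eta> x = \<eta>(x := - \<eta> x)"

definition flip_rate :: "'v set set \<Rightarrow> ('v set \<Rightarrow> int) \<Rightarrow> ('v \<Rightarrow> int) \<Rightarrow> 'v \<Rightarrow> real" where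
  "flip_rate E s \<eta> x =
     1 / real (deg E x) * (\<Sum>y\<in>nbrs E x. of_bool (\<eta> x * \<eta> y \<noteq> s {x, y}))"

definition voter_generator ::
  "'v set \<Rightarrow> 'v set set \<Rightarrow> ('v set \<Rightarrow> int) \<Rightarrow> (('v \<Rightarrow> int) \<Rightarrow> real) \<Rightarrow> ('v \<Rightarrow> int) \<Rightarrow> real" where
  "voter_generator V E s f \<eta> =
     (\<Sum>\<^sub>\<infinity>x\<in>V. (f (flip \<eta> x) - f \<eta>) * flip_rate E s \<eta> x)"

definition semigroup_op ::
  "(real \<Rightarrow> ('v \<Rightarrow> int) \<Rightarrow> ('v \<Rightarrow> int) measure) \<Rightarrow> real
     \<Rightarrow> (('v \<Rightarrow> int) \<Rightarrow> real) \<Rightarrow> ('v \<Rightarrow> int) \<Rightarrow> real" where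
  "semigroup_op P t f \<eta> = (\<integral>\<zeta>. f \<zeta> \<partial>P t \<eta>)"

text \<open>\<open>P t \<eta>\<close> is the distribution at time \<open>t\<close> of the process started from \<open>\<eta>\<close>.\<close>

definition feller_process ::
  "'v set \<Rightarrow> (real \<Rightarrow> ('v \<Rightarrow> int) \<Rightarrow> ('v \<Rightarrow> int) measure) \<Rightarrow> bool" where
  "feller_process V P \<longleftrightarrow>
     (\<forall>t\<ge>0. P t \<in> config_space V \<rightarrow>\<^sub>M prob_algebra (config_space V)) \<and>
     (\<forall>\<eta>\<in>space (config_space V). P 0 \<eta> = return (config_space V) \<eta>) \<and>
     (\<forall>r\<ge>0. \<forall>t\<ge>0. \<forall>\<eta>\<in>space (config_space V). P (r + t) \<eta> = P r \<eta> \<bind> P t) \<and>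
     (\<forall>f. continuous_observable V f \<longrightarrow>
        (\<forall>t\<ge>0. continuous_observable V (semigroup_op P t f)) \<and>
        uniform_limit (space (config_space V)) (\<lambda>t. semigroup_op P t f) f (at_right 0))"

text \<open>
  The infinitesimal generator of the semigroup is required to extend \<open>voter_generator\<close> on the
  cylinder functions.  For these the sum over \<open>V\<close> has finitely many nonzero terms, and by
  Liggett's theory of interacting particle systems they form a core: the flip rates are bounded
  by 1, and changing one spin at each site \<open>y \<noteq> x\<close> in turn changes the flip rate at \<open>x\<close> by at
  most 1 in total.  Hence exactly one Feller process satisfies this definition, and its
  generator is the closure of \<open>voter_generator\<close>.
\<close>

definition signed_voter_model ::
  "'v set \<Rightarrow> 'v set set \<Rightarrow> ('v set \<Rightarrow> int)
     \<Rightarrow> (real \<Rightarrow> ('v \<Rightarrow> int) \<Rightarrow> ('v \<Rightarrow> int) measure) \<Rightarrow> bool" where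
  "signed_voter_model V E s P \<longleftrightarrow>
     feller_process V P \<and>
     (\<forall>f. cylinder V f \<longrightarrow>
        uniform_limit (space (config_space V))
          (\<lambda>t \<eta>. (semigroup_op P t f \<eta> - f \<eta>) / t) (voter_generator V E s f) (at_right 0))"

definition equilibrium ::
  "'v set \<Rightarrow> (real \<Rightarrow> ('v \<Rightarrow> int) \<Rightarrow> ('v \<Rightarrow> int) measure) \<Rightarrow> ('v \<Rightarrow> int) measure \<Rightarrow> bool" where
  "equilibrium V P \<mu> \<longleftrightarrow>
     \<mu> \<in> space (prob_algebra (config_space V)) \<and> (\<forall>t\<ge>0. \<mu> \<bind> P t = \<mu>)"

text \<open>Continuous observables are automatically bounded, since \<open>config_topology V\<close> is compact.\<close>

definition converges_in_distribution ::
  "'v set \<Rightarrow> (real \<Rightarrow> ('v \<Rightarrow> int) measure) \<Rightarrow> ('v \<Rightarrow> int) measure \<Rightarrow> bool" where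
  "converges_in_distribution V N \<mu> \<longleftrightarrow>
     (\<forall>f. continuous_observable V f \<longrightarrow>
        ((\<lambda>t. \<integral>\<eta>. f \<eta> \<partial>N t) \<longlongrightarrow> (\<integral>\<eta>. f \<eta> \<partial>\<mu>)) at_top)"

definition ergodic ::
  "'v set \<Rightarrow> (real \<Rightarrow> ('v \<Rightarrow> int) \<Rightarrow> ('v \<Rightarrow> int) measure) \<Rightarrow> bool" where
  "ergodic V P \<longleftrightarrow>
     (\<exists>\<mu>. equilibrium V P \<mu> \<and>
        (\<forall>\<nu>. equilibrium V P \<nu> \<longrightarrow> \<nu> = \<mu>) \<and>
        (\<forall>\<eta>\<in>space (config_space V). converges_in_distribution V (\<lambda>t. P t \<eta>) \<mu>))"


section \<open>Random walk\<close>

definition walk_rate :: "'v set set \<Rightarrow> 'v \<Rightarrow> 'v \<Rightarrow> real" where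
  "walk_rate E x y = (if {x, y} \<in> E then 1 / real (deg E x) else 0)"

definition total_rate :: "'v set set \<Rightarrow> 'v \<Rightarrow> real" where
  "total_rate E x = (\<Sum>y\<in>nbrs E x. walk_rate E x y)"

text \<open>
  The continuous-time Markov chain with jump rates \<open>walk_rate\<close>, given by its jump chain \<open>Y\<close> and
  holding times \<open>\<tau>\<close>: at a site \<open>y\<close> the walk waits an exponential time of parameter
  \<open>total_rate E y\<close>, then jumps to \<open>z\<close> with probability \<open>walk_rate E y z / total_rate E y\<close>,
  independently of the waiting time and of the past.  The displayed probabilities determine the
  joint law of \<open>Y\<close> and \<open>\<tau>\<close>.  Since \<open>total_rate\<close> is 1 on every vertex, the jump times tend to
  infinity almost surely, so that \<open>X\<close> is determined at all times \<open>t \<ge> 0\<close>.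
\<close>

definition random_walk ::
  "'v set \<Rightarrow> 'v set set \<Rightarrow> 'w measure \<Rightarrow> (real \<Rightarrow> 'w \<Rightarrow> 'v) \<Rightarrow> 'v \<Rightarrow> bool" where
  "random_walk V E M X x \<longleftrightarrow>
     prob_space M \<and>
     (\<forall>t\<ge>0. X t \<in> M \<rightarrow>\<^sub>M count_space V) \<and>
     (\<exists>(Y :: nat \<Rightarrow> 'w \<Rightarrow> 'v) (\<tau> :: nat \<Rightarrow> 'w \<Rightarrow> real).
        (\<forall>n. Y n \<in> M \<rightarrow>\<^sub>M count_space V) \<and>
        (\<forall>n. \<tau> n \<in> borel_measurable M) \<and>
        (\<forall>n (y :: nat \<Rightarrow> 'v) (u :: nat \<Rightarrow> real). (\<forall>i<n. 0 \<le> u i) \<longrightarrow>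
           measure M {\<omega>\<in>space M. (\<forall>i\<le>n. Y i \<omega> = y i) \<and> (\<forall>i<n. \<tau> i \<omega> > u i)} =
             of_bool (y 0 = x) *
             (\<Prod>i<n. exp (- total_rate E (y i) * u i) *
                     (walk_rate E (y i) (y (Suc i)) / total_rate E (y i)))) \<and>
        (AE \<omega> in M. \<forall>n t. (\<Sum>i<n. \<tau> i \<omega>) \<le> t \<and> t < (\<Sum>i<Suc n. \<tau> i \<omega>) \<longrightarrow> X t \<omega> = Y n \<omega>))"


section \<open>Paths and unsatisfied cycles\<close>

text \<open>\<open>left_value \<gamma> t\<close> is \<open>\<gamma>(t-)\<close> for the discrete topology on vertices.\<close>

definition left_value :: "(real \<Rightarrow> 'v) \<Rightarrow> real \<Rightarrow> 'v" where
  "left_value \<gamma> t = (THE y. eventually (\<lambda>u. \<gamma> u = y) (at_left t))"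

definition jump_times :: "(real \<Rightarrow> 'v) \<Rightarrow> real \<Rightarrow> real \<Rightarrow> real set" where
  "jump_times \<gamma> a b = {t\<in>{a<..b}. left_value \<gamma> t \<noteq> \<gamma> t}"

definition nn_path :: "'v set \<Rightarrow> 'v set set \<Rightarrow> (real \<Rightarrow> 'v) \<Rightarrow> real \<Rightarrow> real \<Rightarrow> bool" where
  "nn_path V E \<gamma> a b \<longleftrightarrow>
     a \<le> b \<and>
     (\<forall>t\<in>{a..b}. \<gamma> t \<in> V) \<and>
     (\<forall>t\<in>{a..<b}. eventually (\<lambda>u. \<gamma> u = \<gamma> t) (at_right t)) \<and>
     (\<forall>t\<in>{a<..b}. \<exists>y. eventually (\<lambda>u. \<gamma> u = y) (at_left t)) \<and>
     finite (jump_times \<gamma> a b) \<and>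
     (\<forall>t\<in>jump_times \<gamma> a b. {left_value \<gamma> t, \<gamma> t} \<in> E)"

definition odd_path ::
  "'v set \<Rightarrow> 'v set set \<Rightarrow> ('v set \<Rightarrow> int) \<Rightarrow> (real \<Rightarrow> 'v) \<Rightarrow> real \<Rightarrow> real \<Rightarrow> bool" where
  "odd_path V E s \<gamma> a b \<longleftrightarrow>
     nn_path V E \<gamma> a b \<and>
     odd (card {t\<in>jump_times \<gamma> a b. s {left_value \<gamma> t, \<gamma> t} = -1})"

definition traverses_infinitely_many_unsatisfied_cycles ::
  "'v set \<Rightarrow> 'v set set \<Rightarrow> ('v set \<Rightarrow> int) \<Rightarrow> (real \<Rightarrow> 'v) \<Rightarrow> bool" where
  "traverses_infinitely_many_unsatisfied_cycles V E s \<gamma> \<longleftrightarrow>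
     (\<exists>a b :: nat \<Rightarrow> real.
        filterlim a at_top sequentially \<and> filterlim b at_top sequentially \<and>
        (\<forall>i. 0 \<le> a i \<and> a i < b i \<and> \<gamma> (a i) = \<gamma> (b i) \<and> odd_path V E s \<gamma> (a i) (b i)))"

end

theory Submission
  imports Defs
begin

text \<open>
  For a finite set \<open>A\<close> of sites let \<open>spin_product A \<eta>\<close> be the product of the spins \<open>\<eta> x\<close>,
  \<open>x \<in> A\<close>.  The indicator of \<open>\<eta> x * \<eta> y \<noteq> s {x, y}\<close> equals \<open>(1 - s {x, y} * \<eta> x * \<eta> y) / 2\<close>, so
  the generator of the voter model sends \<open>spin_product A\<close> to the sum over \<open>x \<in> A\<close> of the average,
  over the neighbours \<open>y\<close> of \<open>x\<close>, of \<open>s {x, y} * spin_product (sym_diff A {x, y}) - spin_product A\<close>.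
  This is the generator \<open>dual_gen\<close> of a system of random walks that annihilate each other in pairs
  when they meet and that collect the signs of the edges which they cross.  Hence, for each
  starting configuration, the expectations \<open>u t A\<close> of \<open>spin_product A\<close> at time \<open>t\<close> solve the linear
  equation \<open>u' = dual_gen u\<close> (lemma \<open>duality\<close>).

  The number of walks never grows, so the equation has bounded rates on the sets with at most \<open>n\<close>
  elements, and a bounded solution of such an equation becomes stationary: \<open>dual_gen (u t)\<close> tends
  to 0 (\<open>dual_flow_stationary\<close>).  Subtract the solutions that belong to two starting
  configurations, at two times that tend to infinity.  Every cluster point of the difference is a
  bounded function of finite sets which is annihilated by \<open>dual_gen\<close> and vanishes at the empty set.
  If 0 is the only such function (\<open>dual_harmonic_eq_zero\<close>), then the expectations of spin products
  converge to limits that do not depend on the starting configuration.  Spin products span a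
  dense space of continuous observables, and compactness of the configuration space turns the
  limits into the expectations under a law (\<open>limit_law_exists\<close>), which is the unique equilibrium.

  The hypothesis on cycles enters in the case of one walk (\<open>liouville_if_odd_cycles\<close>).  Let \<open>h\<close> be
  bounded and equal to its signed average, and let \<open>Y\<close> be the jump chain of the walk from \<open>x\<close>.  The
  value \<open>h (Y n)\<close>, multiplied by the signs of the first \<open>n\<close> edges, is a martingale.  Its absolute
  value is at most \<open>C\<close>, so if \<open>h x > 0\<close>, then it stays positive forever with probability at
  least \<open>h x / C\<close>.  But an odd cycle leads back to the same site with the opposite sign.

  For several independent walks, a bounded function which is harmonic for the whole system is
  harmonic in each coordinate, because the moves of different walks commute (\<open>Choquet_Deny\<close>); so
  it is 0 by the case of one walk.  Finally, a function which is harmonic only up to the first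
  collision is dominated, by comparison with independent walks, by the probability of a collision,
  and this probability, taken after a long time without collision, tends to 0
  (\<open>killed_harmonic_eq_zero\<close>).
\<close>


section \<open>Cluster points of bounded families\<close>

text \<open>
  Tychonoff's theorem replaces the extraction of subsequences: the functions with values in
  \<open>[-C, C]\<close> form a compact set, so any filter on which \<open>D k a0\<close> stays away from 0 can be refined to
  one along which \<open>D k\<close> converges pointwise.
\<close>

lemma tendsto_zero_if_cluster_points_vanish:
  fixes D :: "'k \<Rightarrow> 'a \<Rightarrow> real"
  assumes bd: "\<And>k a. \<bar>D k a\<bar> \<le> C"
    and cluster: "\<And>G h. G \<noteq> bot \<Longrightarrow> G \<le> F \<Longrightarrow> (\<And>a. ((\<lambda>k. D k a) \<longlongrightarrow> h a) G) \<Longrightarrow> h a0 = 0"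
  shows "((\<lambda>k. D k a0) \<longlongrightarrow> 0) F"
proof (rule ccontr)
  assume "\<not> ?thesis"
  then obtain e where e: "e > 0" and ne: "\<not> eventually (\<lambda>k. \<bar>D k a0\<bar> < e) F"
    by (auto simp: tendsto_iff)
  \<comment> \<open>On this part of the filter the values at the given point stay away from 0.\<close>
  define F' where "F' = inf F (principal {k. \<bar>D k a0\<bar> \<ge> e})"
  have F': "F' \<noteq> bot"
    using ne by (auto simp: F'_def trivial_limit_def eventually_inf_principal not_le)
  define K :: "('a \<Rightarrow> real) set" where "K = PiE UNIV (\<lambda>_. {-C..C})"
  have "compactin (product_topology (\<lambda>_. euclidean) UNIV) K"
    unfolding K_def compactin_PiE by auto
  then have "compact K" by (simp add: euclidean_product_topology)
  moreover have "filtermap D F' \<noteq> bot" using F' by (simp add: filtermap_bot_iff)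
  moreover have "eventually (\<lambda>f. f \<in> K) (filtermap D F')"
    using bd by (auto simp: K_def eventually_filtermap abs_le_iff minus_le_iff intro!: always_eventually)
  ultimately obtain h where h: "inf (nhds h) (filtermap D F') \<noteq> bot"
    unfolding compact_filter by blast
  define G where "G = inf F' (filtercomap D (nhds h))"
  have G: "G \<noteq> bot"
  proof
    assume "G = bot"
    then have "eventually (\<lambda>_. False) (inf F' (filtercomap D (nhds h)))" by (simp add: G_def)
    then obtain P Q where P: "eventually P F'" and Q: "eventually Q (filtercomap D (nhds h))"
      and PQ: "\<And>k. P k \<Longrightarrow> Q k \<Longrightarrow> False" by (auto simp: eventually_inf)
    from Q obtain R where R: "eventually R (nhds h)" "\<And>k. R (D k) \<Longrightarrow> Q k"
      by (auto simp: eventually_filtercomap)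
    have "eventually (\<lambda>f. \<not> R f) (filtermap D F')"
      unfolding eventually_filtermap using P by (rule eventually_mono) (use PQ R in blast)
    with R(1) have "eventually (\<lambda>_. False) (inf (nhds h) (filtermap D F'))"
      unfolding eventually_inf by blast
    with h show False by (simp add: trivial_limit_def)
  qed
  have "filterlim D (nhds h) G"
    by (auto simp: G_def filterlim_iff_le_filtercomap)
  moreover have "continuous_on UNIV (\<lambda>f::'a \<Rightarrow> real. f a)" for a
    by (rule continuous_on_product_coordinates)
  then have "((\<lambda>f::'a \<Rightarrow> real. f a) \<longlongrightarrow> h a) (nhds h)" for a
    by (meson continuous_on_def UNIV_I continuous_at_imp_continuous_on continuous_on_eq_continuous_at open_UNIV tendsto_compose filterlim_ident isCont_def continuous_at tendsto_at_iff_tendsto_nhds)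
  ultimately have lim: "((\<lambda>k. D k a) \<longlongrightarrow> h a) G" for a
    using filterlim_compose by fastforce
  have "G \<le> F" by (simp add: G_def F'_def le_infI1)
  then have "h a0 = 0" using cluster[OF G _ lim] by simp
  moreover have "eventually (\<lambda>k. \<bar>D k a0\<bar> \<ge> e) F'"
    by (simp add: F'_def eventually_inf_principal)
  then have "eventually (\<lambda>k. \<bar>D k a0\<bar> \<ge> e) G"
    by (rule filter_leD[rotated]) (simp add: G_def)
  from tendsto_lowerbound[OF tendsto_rabs[OF lim] this G] have "\<bar>h a0\<bar> \<ge> e" .
  ultimately show False using e by simp
qed

section \<open>Averages over neighbours\<close>

locale signed_graph =
  fixes V :: "'v set" and E :: "'v set set" and s :: "'v set \<Rightarrow> int"
  assumes graph: "lf_graph V E" and sign: "sign_function E s"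
begin

lemma nbrsD:
  assumes "y \<in> nbrs E x"
  shows "x \<in> V" "y \<in> V" "x \<noteq> y" "s {x, y} = 1 \<or> s {x, y} = -1"
proof -
  have e: "{x, y} \<in> E" using assms by (simp add: nbrs_def)
  then have "{x, y} \<subseteq> V" "card {x, y} = 2" using graph by (auto simp: lf_graph_def)
  then show "x \<in> V" "y \<in> V" "x \<noteq> y" by auto
  show "s {x, y} = 1 \<or> s {x, y} = -1" using sign e by (auto simp: sign_function_def)
qed

lemma abs_sign: "y \<in> nbrs E x \<Longrightarrow> \<bar>real_of_int (s {x, y})\<bar> = 1"
  using nbrsD(4) by fastforce

lemma finite_nbrs: "x \<in> V \<Longrightarrow> finite (nbrs E x)"
  and deg_pos: "x \<in> V \<Longrightarrow> real (deg E x) > 0"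
  using graph by (auto simp: lf_graph_def)

definition avg :: "('v \<Rightarrow> real) \<Rightarrow> 'v \<Rightarrow> real" where
  "avg f x = (\<Sum>y\<in>nbrs E x. f y) / real (deg E x)"

definition signed_avg :: "('v \<Rightarrow> real) \<Rightarrow> 'v \<Rightarrow> real" where
  "signed_avg f x = avg (\<lambda>y. real_of_int (s {x, y}) * f y) x"

lemma avg_mono: "(\<And>y. y \<in> nbrs E x \<Longrightarrow> f y \<le> g y) \<Longrightarrow> avg f x \<le> avg g x"
  unfolding avg_def by (intro divide_right_mono sum_mono) auto

lemma avg_const: "x \<in> V \<Longrightarrow> avg (\<lambda>_. c) x = c"
  using deg_pos[of x] by (simp add: avg_def deg_def)

lemma avg_diff: "avg (\<lambda>y. f y - g y) x = avg f x - avg g x"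
  by (simp add: avg_def sum_subtractf diff_divide_distrib)

lemma avg_cmult: "avg (\<lambda>y. c * f y) x = c * avg f x"
  by (simp add: avg_def sum_distrib_left)

lemma tendsto_avg:
  "(\<And>y. y \<in> nbrs E x \<Longrightarrow> ((\<lambda>k. f k y) \<longlongrightarrow> g y) G) \<Longrightarrow> ((\<lambda>k. avg (f k) x) \<longlongrightarrow> avg g x) G"
  unfolding avg_def divide_inverse by (intro tendsto_intros) auto

lemma signed_avg_cong: "(\<And>y. y \<in> nbrs E x \<Longrightarrow> f y = g y) \<Longrightarrow> signed_avg f x = signed_avg g x"
  by (simp add: signed_avg_def avg_def)

lemma signed_avg_diff: "signed_avg (\<lambda>y. f y - g y) x = signed_avg f x - signed_avg g x"
  by (simp add: signed_avg_def avg_def sum_subtractf right_diff_distrib diff_divide_distrib)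

lemma signed_avg_sum: "signed_avg (\<lambda>y. \<Sum>i\<in>I. f i y) x = (\<Sum>i\<in>I. signed_avg (f i) x)"
  unfolding signed_avg_def avg_def sum_divide_distrib sum_distrib_left
  by (rule sum.swap)

lemma signed_avg_cmult: "signed_avg (\<lambda>y. c * f y) x = c * signed_avg f x"
  by (simp add: signed_avg_def avg_def sum_distrib_left mult.left_commute)

lemma signed_avg_commute:
  "signed_avg (\<lambda>y. signed_avg (\<lambda>z. f y z) b) a = signed_avg (\<lambda>z. signed_avg (\<lambda>y. f y z) a) b"
  unfolding signed_avg_def avg_def sum_divide_distrib sum_distrib_left
  by (subst sum.swap) (simp add: ac_simps)

lemma abs_signed_avg_le: "\<bar>signed_avg f x\<bar> \<le> avg (\<lambda>y. \<bar>f y\<bar>) x"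
proof -
  have "\<bar>\<Sum>y\<in>nbrs E x. real_of_int (s {x, y}) * f y\<bar> \<le> (\<Sum>y\<in>nbrs E x. \<bar>real_of_int (s {x, y}) * f y\<bar>)"
    by (rule sum_abs)
  also have "\<dots> = (\<Sum>y\<in>nbrs E x. \<bar>f y\<bar>)"
    by (intro sum.cong refl) (simp add: abs_mult abs_sign)
  finally show ?thesis by (simp add: signed_avg_def avg_def divide_right_mono)
qed

lemma signed_avg_bound:
  assumes "x \<in> V" "\<And>y. y \<in> nbrs E x \<Longrightarrow> \<bar>f y\<bar> \<le> c"
  shows "\<bar>signed_avg f x\<bar> \<le> c"
  using abs_signed_avg_le[of f x] avg_mono[of x "\<lambda>y. \<bar>f y\<bar>" "\<lambda>_. c"] avg_const[of x c] assms by auto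

lemma tendsto_signed_avg:
  "(\<And>y. y \<in> nbrs E x \<Longrightarrow> ((\<lambda>k. f k y) \<longlongrightarrow> g y) G)
    \<Longrightarrow> ((\<lambda>k. signed_avg (f k) x) \<longlongrightarrow> signed_avg g x) G"
  unfolding signed_avg_def by (intro tendsto_avg tendsto_intros) auto

text \<open>
  The Liouville property of the signed walk: its only bounded harmonic function is 0.
\<close>

definition liouville :: bool where
  "liouville \<longleftrightarrow> (\<forall>h C. (\<forall>x\<in>V. \<bar>h x\<bar> \<le> C) \<longrightarrow> (\<forall>x\<in>V. signed_avg h x = h x) \<longrightarrow> (\<forall>x\<in>V. h x = 0))"

lemma liouvilleD:
  "liouville \<Longrightarrow> \<forall>x\<in>V. \<bar>h x\<bar> \<le> C \<Longrightarrow> \<forall>x\<in>V. signed_avg h x = h x \<Longrightarrow> x \<in> V \<Longrightarrow> h x = 0"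
  unfolding liouville_def by metis

end

section \<open>One walk: odd cycles leave no bounded signed-harmonic function\<close>

text \<open>
  The path visits \<open>Y 0\<close>, \<open>Y 1\<close>, ... and changes its site at every jump, so the jumps in \<open>{a<..b}\<close> are
  the steps of \<open>Y\<close> from some index \<open>k\<close> to some index \<open>l\<close>, and the parity of the number of negative
  edges among them is the sign of a quotient of two products.  Infinitely many holding times above
  1 keep the jump times from accumulating.
\<close>

lemma odd_cycle_of_jump_chain:
  fixes Y :: "nat \<Rightarrow> 'v" and \<tau> :: "nat \<Rightarrow> real"
  assumes sg: "signed_graph V E s"
    and pos: "\<And>i. \<tau> i > 0" and inf: "infinite {i. \<tau> i > 1}"
    and nn: "\<And>i. Y (Suc i) \<in> nbrs E (Y i)"
    and \<gamma>: "\<And>n t. (\<Sum>i<n. \<tau> i) \<le> t \<Longrightarrow> t < (\<Sum>i<Suc n. \<tau> i) \<Longrightarrow> \<gamma> t = Y n"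
    and ab: "0 \<le> a" "a < b" "\<gamma> a = \<gamma> b" and odd: "odd_path V E s \<gamma> a b"
  shows "\<exists>k l. Y k = Y l \<and> (\<Prod>i<l. s {Y i, Y (Suc i)}) = - (\<Prod>i<k. s {Y i, Y (Suc i)})"
proof -
  interpret signed_graph V E s by fact
  define S where "S n = (\<Sum>i<n. \<tau> i)" for n
  have S0: "S 0 = 0" and S_Suc: "S (Suc n) = S n + \<tau> n" for n by (simp_all add: S_def)
  have mono: "strict_mono S" by (rule strict_monoI_Suc) (simp add: S_Suc pos)
  have \<gamma>S: "\<gamma> t = Y n" if "S n \<le> t" "t < S (Suc n)" for n t
    using \<gamma> that unfolding S_def by blast
  have unbounded: "\<exists>n. S n > t" for t
  proof -
    have count: "real (card {i. i < n \<and> \<tau> i > 1}) \<le> S n" for n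
    proof -
      have "real (card {i. i < n \<and> \<tau> i > 1}) = (\<Sum>i | i < n \<and> \<tau> i > 1. 1)" by simp
      also have "\<dots> \<le> (\<Sum>i | i < n \<and> \<tau> i > 1. \<tau> i)" by (intro sum_mono) auto
      also have "\<dots> \<le> (\<Sum>i<n. \<tau> i)" by (intro sum_mono2) (auto intro: less_imp_le pos)
      finally show ?thesis by (simp add: S_def)
    qed
    obtain T where T: "T \<subseteq> {i. \<tau> i > 1}" "finite T" "card T = nat \<lceil>t\<rceil> + 1"
      using infinite_arbitrarily_large[OF inf] by blast
    obtain n where "\<forall>i\<in>T. i < n" using T(2) finite_nat_set_iff_bounded by blast
    then have "card T \<le> card {i. i < n \<and> \<tau> i > 1}" using T(1) by (intro card_mono) auto
    then have "t < real (card {i. i < n \<and> \<tau> i > 1})" using T(3) by linarith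
    then show ?thesis using count[of n] by (intro exI[of _ n]) linarith
  qed
  have index: "\<exists>n. S n \<le> t \<and> t < S (Suc n)" if t0: "0 \<le> t" for t
  proof -
    define m where "m = (LEAST n. t < S n)"
    have m: "t < S m" unfolding m_def using unbounded by (rule LeastI_ex)
    then obtain n where n: "m = Suc n" using t0 S0 by (cases m) auto
    then have "n < (LEAST n. t < S n)" by (simp add: m_def)
    then have "\<not> t < S n" by (rule not_less_Least)
    then show ?thesis using m n by (intro exI[of _ n]) auto
  qed
  obtain k where k: "S k \<le> a" "a < S (Suc k)" using index ab by blast
  obtain l where l: "S l \<le> b" "b < S (Suc l)" using index ab by (meson less_imp_le order_trans)
  have left: "left_value \<gamma> t = Y n" if t: "S n < t" "t \<le> S (Suc n)" for n t
    unfolding left_value_def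
  proof (rule the_equality)
    show ev: "\<forall>\<^sub>F u in at_left t. \<gamma> u = Y n"
      using eventually_at_left_real[OF t(1)] by eventually_elim (rule \<gamma>S, use t in auto)
    show "y = Y n" if "\<forall>\<^sub>F u in at_left t. \<gamma> u = y" for y
    proof -
      have "\<forall>\<^sub>F u in at_left t. y = Y n" using ev that by eventually_elim auto
      then show ?thesis by simp
    qed
  qed
  have jumps: "jump_times \<gamma> a b = (S \<circ> Suc) ` {k..<l}"
  proof (intro set_eqI iffI)
    fix t assume "t \<in> jump_times \<gamma> a b"
    then have t: "a < t" "t \<le> b" "left_value \<gamma> t \<noteq> \<gamma> t" by (auto simp: jump_times_def)
    obtain n where n: "S n \<le> t" "t < S (Suc n)" using index[of t] t ab by auto
    have "\<not> S n < t" using left[of n t] \<gamma>S[OF n] n t by (metis less_imp_le)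
    then have "t = S n" using n by simp
    have "S n > S k" using k t \<open>t = S n\<close> by simp
    then have "n > k" using mono by (simp add: strict_mono_less)
    moreover have "S n < S (Suc l)" using l t \<open>t = S n\<close> by simp
    then have "n < Suc l" using mono by (simp add: strict_mono_less)
    ultimately show "t \<in> (S \<circ> Suc) ` {k..<l}"
      using \<open>t = S n\<close> by (intro image_eqI[of _ _ "n - 1"]) auto
  next
    fix t assume "t \<in> (S \<circ> Suc) ` {k..<l}"
    then obtain i where i: "t = S (Suc i)" "k \<le> i" "i < l" by auto
    have "S (Suc k) \<le> t" "t \<le> S l" using i mono by (auto simp: strict_mono_less_eq)
    moreover have "left_value \<gamma> t = Y i" using i pos[of i] by (intro left) (auto simp: S_Suc)
    moreover have "\<gamma> t = Y (Suc i)" using i pos[of "Suc i"] by (intro \<gamma>S) (auto simp: S_Suc)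
    moreover have "Y i \<noteq> Y (Suc i)" using nbrsD(3)[OF nn] by auto
    ultimately show "t \<in> jump_times \<gamma> a b" using k l by (auto simp: jump_times_def)
  qed
  let ?N = "{i\<in>{k..<l}. s {Y i, Y (Suc i)} = -1}"
  have jumps_neg: "{t\<in>jump_times \<gamma> a b. s {left_value \<gamma> t, \<gamma> t} = -1} = (S \<circ> Suc) ` ?N"
  proof -
    have "left_value \<gamma> (S (Suc i)) = Y i" for i using pos[of i] by (intro left) (auto simp: S_Suc)
    moreover have "\<gamma> (S (Suc i)) = Y (Suc i)" for i
      using pos[of "Suc i"] by (intro \<gamma>S) (auto simp: S_Suc)
    ultimately show ?thesis unfolding jumps by auto
  qed
  have inj: "inj_on (S \<circ> Suc) ?N" using mono by (auto intro!: inj_onI simp: strict_mono_eq)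
  have odd_card: "odd (card ?N)"
    using odd unfolding odd_path_def jumps_neg card_image[OF inj] by (rule conjunct2)
  have "(\<Prod>i\<in>{k..<l}. s {Y i, Y (Suc i)}) = (\<Prod>i\<in>{k..<l}. if s {Y i, Y (Suc i)} = -1 then -1 else 1)"
    using nbrsD(4)[OF nn] by (intro prod.cong) auto
  also have "\<dots> = (-1) ^ card ?N" by (simp add: prod.If_cases Int_def)
  finally have minus: "(\<Prod>i\<in>{k..<l}. s {Y i, Y (Suc i)}) = -1" using odd_card by simp
  have "k \<le> l" using odd_card by (cases "k \<le> l") auto
  then have "{..<l} = {..<k} \<union> {k..<l}" by auto
  then have "(\<Prod>i<l. s {Y i, Y (Suc i)}) = (\<Prod>i<k. s {Y i, Y (Suc i)}) * (\<Prod>i\<in>{k..<l}. s {Y i, Y (Suc i)})"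
    by (simp add: prod.union_disjoint ivl_disj_int)
  moreover have "Y k = Y l" using \<gamma>S[OF k] \<gamma>S[OF l] ab by simp
  ultimately show ?thesis using minus by auto
qed

context signed_graph
begin

text \<open>
  Paths with \<open>n\<close> steps from \<open>x\<close> along which a condition \<open>p\<close> holds at each visited site \<open>y\<close> and for the
  sign \<open>\<rho>\<close> collected so far, which is \<open>\<sigma>\<close> at the start.  The recursion splits off the first step
  because harmonicity relates the value of a function at a site to its values one step later.
\<close>

fun paths :: "('v \<Rightarrow> int \<Rightarrow> bool) \<Rightarrow> nat \<Rightarrow> 'v \<Rightarrow> int \<Rightarrow> 'v list set" where
  "paths p 0 x \<sigma> = (if p x \<sigma> then {[x]} else {})"
| "paths p (Suc n) x \<sigma> = (if p x \<sigma> then \<Union>z\<in>nbrs E x. (#) x ` paths p n z (\<sigma> * s {x, z}) else {})"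

definition weight :: "'v list \<Rightarrow> real" where
  "weight ys = (\<Prod>i<length ys - 1. 1 / real (deg E (ys ! i)))"

lemma pathsD:
  assumes "ys \<in> paths p n x \<sigma>" "x \<in> V"
  shows "length ys = Suc n \<and> ys ! 0 = x \<and> (\<forall>i<n. ys ! Suc i \<in> nbrs E (ys ! i)) \<and>
    (\<forall>k\<le>n. p (ys ! k) (\<sigma> * (\<Prod>i<k. s {ys ! i, ys ! Suc i})))"
  using assms
proof (induction n arbitrary: ys x \<sigma>)
  case 0 then show ?case by (auto split: if_splits)
next
  case (Suc n)
  from Suc.prems obtain z zs where z: "z \<in> nbrs E x" and zs: "zs \<in> paths p n z (\<sigma> * s {x, z})"
    and ys: "ys = x # zs" and p: "p x \<sigma>" by (auto split: if_splits)
  from Suc.IH[OF zs nbrsD(2)[OF z]] have IH: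
    "length zs = Suc n" "zs ! 0 = z" "\<And>i. i < n \<Longrightarrow> zs ! Suc i \<in> nbrs E (zs ! i)"
    "\<And>k. k \<le> n \<Longrightarrow> p (zs ! k) (\<sigma> * s {x, z} * (\<Prod>i<k. s {zs ! i, zs ! Suc i}))" by auto
  have "ys ! Suc i \<in> nbrs E (ys ! i)" if "i < Suc n" for i
    using that z IH(2,3) by (cases i) (auto simp: ys)
  moreover have "p (ys ! k) (\<sigma> * (\<Prod>i<k. s {ys ! i, ys ! Suc i}))" if "k \<le> Suc n" for k
  proof (cases k)
    case 0 then show ?thesis using p by (simp add: ys)
  next
    case (Suc j)
    then show ?thesis using IH(4)[of j] that IH(2)
      by (simp add: ys prod.lessThan_Suc_shift mult.assoc del: prod.lessThan_Suc)
  qed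
  ultimately show ?case using IH(1) by (simp add: ys)
qed

lemma butlast_paths: "ys \<in> paths p (Suc n) x \<sigma> \<Longrightarrow> x \<in> V \<Longrightarrow> butlast ys \<in> paths p n x \<sigma>"
proof (induction n arbitrary: ys x \<sigma>)
  case (Suc n)
  from Suc.prems obtain z zs where z: "z \<in> nbrs E x" and zs: "zs \<in> paths p (Suc n) z (\<sigma> * s {x, z})"
    and ys: "ys = x # zs" and p: "p x \<sigma>"
    by (subst (asm) paths.simps(2)) (auto simp del: paths.simps split: if_splits)
  have "zs \<noteq> []" using pathsD[OF zs nbrsD(2)[OF z]] by auto
  then show ?case using Suc.IH[OF zs nbrsD(2)[OF z]] z p by (auto simp: ys)
qed (auto split: if_splits)

lemma finite_paths: "x \<in> V \<Longrightarrow> finite (paths p n x \<sigma>)"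
proof (induction n arbitrary: x \<sigma>)
  case (Suc n)
  have "finite (\<Union>z\<in>nbrs E x. (#) x ` paths p n z (\<sigma> * s {x, z}))"
    using Suc nbrsD(2) by (intro finite_UN_I finite_nbrs finite_imageI) auto
  then show ?case by simp
qed simp

lemma sum_weight_paths:
  assumes "x \<in> V"
  shows "sum weight (paths p 0 x \<sigma>) = of_bool (p x \<sigma>)"
    and "sum weight (paths p (Suc n) x \<sigma>) =
      (if p x \<sigma> then avg (\<lambda>z. sum weight (paths p n z (\<sigma> * s {x, z}))) x else 0)"
proof -
  have *: "weight (x # ys) = 1 / real (deg E x) * weight ys" if "ys \<in> paths p n z \<rho>" "z \<in> V" for ys z \<rho>
  proof -
    have l: "length ys = Suc n" using pathsD[OF that] by simp
    then show ?thesis unfolding weight_def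
      by (simp add: prod.lessThan_Suc_shift del: prod.lessThan_Suc)
  qed
  have "sum weight (\<Union>z\<in>nbrs E x. (#) x ` paths p n z (\<sigma> * s {x, z}))
      = (\<Sum>z\<in>nbrs E x. sum weight ((#) x ` paths p n z (\<sigma> * s {x, z})))"
  proof (rule sum.UNION_disjoint)
    show "\<forall>z\<in>nbrs E x. \<forall>z'\<in>nbrs E x. z \<noteq> z' \<longrightarrow>
        (#) x ` paths p n z (\<sigma> * s {x, z}) \<inter> (#) x ` paths p n z' (\<sigma> * s {x, z'}) = {}"
    proof (intro ballI impI)
      fix z z' assume z: "z \<in> nbrs E x" "z' \<in> nbrs E x" "z \<noteq> z'"
      have "ys ! 0 = z" if "ys \<in> paths p n z \<rho>" for ys \<rho> using pathsD[OF that nbrsD(2)[OF z(1)]] by simp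
      moreover have "ys ! 0 = z'" if "ys \<in> paths p n z' \<rho>" for ys \<rho>
        using pathsD[OF that nbrsD(2)[OF z(2)]] by simp
      ultimately show "(#) x ` paths p n z (\<sigma> * s {x, z}) \<inter> (#) x ` paths p n z' (\<sigma> * s {x, z'}) = {}"
        using z(3) by fastforce
    qed
  qed (use assms finite_nbrs finite_paths nbrsD(2) in auto)
  also have "\<dots> = (\<Sum>z\<in>nbrs E x. 1 / real (deg E x) * sum weight (paths p n z (\<sigma> * s {x, z})))"
  proof (rule sum.cong[OF refl])
    fix z assume z: "z \<in> nbrs E x"
    let ?P = "paths p n z (\<sigma> * s {x, z})"
    have "sum weight ((#) x ` ?P) = (\<Sum>ys\<in>?P. weight (x # ys))" by (simp add: sum.reindex)
    also have "\<dots> = (\<Sum>ys\<in>?P. 1 / real (deg E x) * weight ys)"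
      by (rule sum.cong[OF refl], rule *) (use nbrsD(2)[OF z] in auto)
    finally show "sum weight ((#) x ` ?P) = 1 / real (deg E x) * sum weight ?P"
      by (simp add: sum_distrib_left)
  qed
  finally show "sum weight (paths p (Suc n) x \<sigma>) =
      (if p x \<sigma> then avg (\<lambda>z. sum weight (paths p n z (\<sigma> * s {x, z}))) x else 0)"
    by (simp add: avg_def sum_divide_distrib)
qed (simp add: weight_def)

lemma sum_weight_all_paths: "x \<in> V \<Longrightarrow> sum weight (paths (\<lambda>_ _. True) n x \<sigma>) = 1"
proof (induction n arbitrary: x \<sigma>)
  case (Suc n)
  have "avg (\<lambda>z. sum weight (paths (\<lambda>_ _. True) n z (\<sigma> * s {x, z}))) x = avg (\<lambda>_. 1) x"
    unfolding avg_def using Suc.IH nbrsD(2) by (simp cong: sum.cong)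
  then show ?case using Suc.prems by (simp add: sum_weight_paths avg_const del: paths.simps)
qed (simp add: sum_weight_paths del: paths.simps)

text \<open>
  Doob's maximal inequality for the nonnegative martingale \<open>C - \<rho> * h y\<close>, where \<open>y\<close> is the position
  of the walk and \<open>\<rho>\<close> the sign that it has collected: the martingale starts at \<open>C - \<sigma> * h x\<close>, so
  it ever reaches the level \<open>C\<close> with probability at most \<open>1 - \<sigma> * h x / C\<close>.
\<close>

lemma maximal_inequality:
  assumes C: "\<And>x. x \<in> V \<Longrightarrow> \<bar>h x\<bar> \<le> C"
    and harm: "\<And>x. x \<in> V \<Longrightarrow> signed_avg h x = h x"
    and "x \<in> V" "\<sigma> = 1 \<or> \<sigma> = -1"
  shows "real_of_int \<sigma> * h x \<le> C * sum weight (paths (\<lambda>y \<rho>. real_of_int \<rho> * h y > 0) n x \<sigma>)"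
  using assms(3,4)
proof (induction n arbitrary: x \<sigma>)
  case 0
  then show ?case using C[of x] by (auto simp: sum_weight_paths simp del: paths.simps)
next
  case (Suc n)
  let ?W = "\<lambda>n x \<sigma>. sum weight (paths (\<lambda>y \<rho>. real_of_int \<rho> * h y > 0) n x \<sigma>)"
  show ?case
  proof (cases "real_of_int \<sigma> * h x > 0")
    case True
    have "real_of_int \<sigma> * h x = real_of_int \<sigma> * signed_avg h x" using harm Suc.prems by simp
    also have "\<dots> = avg (\<lambda>z. real_of_int (\<sigma> * s {x, z}) * h z) x"
      by (simp add: signed_avg_def avg_cmult[symmetric] mult.assoc)
    also have "\<dots> \<le> avg (\<lambda>z. C * ?W n z (\<sigma> * s {x, z})) x"
    proof (rule avg_mono)
      fix z assume z: "z \<in> nbrs E x"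
      then show "real_of_int (\<sigma> * s {x, z}) * h z \<le> C * ?W n z (\<sigma> * s {x, z})"
        using Suc.prems nbrsD(2,4)[OF z] by (intro Suc.IH) auto
    qed
    finally show ?thesis using True Suc.prems by (simp add: sum_weight_paths avg_cmult del: paths.simps)
  next
    case False
    then show ?thesis using Suc.prems by (simp add: sum_weight_paths del: paths.simps)
  qed
qed

text \<open>
  By the maximal inequality the signed values of a harmonic \<open>h\<close> with \<open>h x > 0\<close> stay positive along
  the whole jump chain with positive probability, although almost surely an odd cycle turns one of
  them into its negative.  A cycle of the path in continuous time is a cycle of the jump chain only
  if the jump times tend to infinity.  This holds because infinitely many of the independent
  holding times exceed 1.
\<close>

lemma liouville_if_odd_cycles:
  fixes M :: "'v \<Rightarrow> 'w measure" and X :: "'v \<Rightarrow> real \<Rightarrow> 'w \<Rightarrow> 'v"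
  assumes walk: "\<And>x. x \<in> V \<Longrightarrow> random_walk V E (M x) (X x) x"
    and cycles: "\<And>x. x \<in> V \<Longrightarrow>
           AE \<omega> in M x. traverses_infinitely_many_unsatisfied_cycles V E s (\<lambda>t. X x t \<omega>)"
  shows liouville
  unfolding liouville_def
proof (intro allI impI)
  fix h :: "'v \<Rightarrow> real" and C
  assume C: "\<forall>x\<in>V. \<bar>h x\<bar> \<le> C" and harm: "\<forall>x\<in>V. signed_avg h x = h x"
  have pos: "h x \<le> 0" if h: "\<forall>x\<in>V. \<bar>h x\<bar> \<le> C" "\<forall>x\<in>V. signed_avg h x = h x" and x: "x \<in> V" for h x
  proof (rule ccontr)
    assume hx: "\<not> h x \<le> 0"
    then have C0: "C > 0" using h(1) x by force
    interpret prob_space "M x" using walk[OF x] by (simp add: random_walk_def)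
    from walk[OF x] obtain Y :: "nat \<Rightarrow> 'w \<Rightarrow> 'v" and \<tau> :: "nat \<Rightarrow> 'w \<Rightarrow> real" where
      Y: "\<And>n. Y n \<in> M x \<rightarrow>\<^sub>M count_space V" and \<tau>: "\<And>n. \<tau> n \<in> borel_measurable (M x)"
      and law: "\<And>n y u. (\<forall>i<n. 0 \<le> u i) \<Longrightarrow>
           prob {\<omega>\<in>space (M x). (\<forall>i\<le>n. Y i \<omega> = y i) \<and> (\<forall>i<n. \<tau> i \<omega> > u i)} =
             of_bool (y 0 = x) *
             (\<Prod>i<n. exp (- total_rate E (y i) * u i) *
                     (walk_rate E (y i) (y (Suc i)) / total_rate E (y i)))"
      and X: "AE \<omega> in M x. \<forall>n t. (\<Sum>i<n. \<tau> i \<omega>) \<le> t \<and> t < (\<Sum>i<Suc n. \<tau> i \<omega>) \<longrightarrow> X x t \<omega> = Y n \<omega>"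
      unfolding random_walk_def by blast
    note [measurable] = Y \<tau>
    have rate: "total_rate E y = 1" if "y \<in> V" for y
      using avg_const[OF that, of 1] by (simp add: total_rate_def walk_rate_def nbrs_def avg_def)
    \<comment> \<open>The events whose probabilities are prescribed by the definition of the walk.\<close>
    define B where "B n ys u = {\<omega>\<in>space (M x). (\<forall>i\<le>n. Y i \<omega> = ys ! i) \<and> (\<forall>i<n. \<tau> i \<omega> > u i)}"
      for n ys and u :: "nat \<Rightarrow> real"
    have B_event: "B n ys u \<in> events" for n ys u
    proof -
      have "{\<omega>\<in>space (M x). Y i \<omega> = y} \<in> events" for i y
      proof (cases "y \<in> V")
        case True
        then have "Y i -` {y} \<inter> space (M x) \<in> events" by (intro measurable_sets[OF Y]) auto
        also have "Y i -` {y} \<inter> space (M x) = {\<omega>\<in>space (M x). Y i \<omega> = y}" by auto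
        finally show ?thesis .
      next
        case False
        then have "{\<omega>\<in>space (M x). Y i \<omega> = y} = {}" using measurable_space[OF Y] by auto
        then show ?thesis by (metis sets.empty_sets)
      qed
      then show ?thesis unfolding B_def by measurable
    qed
    have B_prob: "prob (B n ys u) = exp (- (\<Sum>i<n. u i)) * weight ys"
      if ys: "ys \<in> paths p n x 1" and u: "\<forall>i<n. 0 \<le> u i" for p n ys u
    proof -
      from pathsD[OF ys x] have l: "length ys = Suc n" "ys ! 0 = x"
        and nb: "\<And>i. i < n \<Longrightarrow> ys ! Suc i \<in> nbrs E (ys ! i)" by auto
      have "(\<Prod>i<n. exp (- total_rate E (ys ! i) * u i) *
                     (walk_rate E (ys ! i) (ys ! (Suc i)) / total_rate E (ys ! i)))
          = (\<Prod>i<n. exp (- u i) * (1 / real (deg E (ys ! i))))"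
      proof (rule prod.cong[OF refl])
        fix i assume "i \<in> {..<n}"
        then have i: "ys ! Suc i \<in> nbrs E (ys ! i)" using nb by simp
        then show "exp (- total_rate E (ys ! i) * u i) *
                     (walk_rate E (ys ! i) (ys ! (Suc i)) / total_rate E (ys ! i))
          = exp (- u i) * (1 / real (deg E (ys ! i)))"
          using rate[OF nbrsD(1)[OF i]] by (simp add: walk_rate_def nbrs_def)
      qed
      also have "\<dots> = exp (- (\<Sum>i<n. u i)) * weight ys"
        unfolding prod.distrib by (simp add: exp_sum weight_def l sum_negf[symmetric] del: sum_negf)
      finally show ?thesis using law[OF u, of "(!) ys"] l by (simp add: B_def)
    qed
    define A where "A p n u = (\<Union>ys\<in>paths p n x 1. B n ys u)" for p n u
    have A_event: "A p n u \<in> events" for p n u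
      unfolding A_def using finite_paths[OF x] B_event by (intro sets.finite_UN) auto
    have A_prob: "prob (A p n u) = exp (- (\<Sum>i<n. u i)) * sum weight (paths p n x 1)"
      if u: "\<forall>i<n. 0 \<le> u i" for p n u
    proof -
      have "disjoint_family_on (\<lambda>ys. B n ys u) (paths p n x 1)"
        unfolding disjoint_family_on_def
      proof (intro ballI impI)
        fix ys zs assume yz: "ys \<in> paths p n x 1" "zs \<in> paths p n x 1" "ys \<noteq> zs"
        then obtain i where "i \<le> n" "ys ! i \<noteq> zs ! i"
          using pathsD[OF yz(1) x] pathsD[OF yz(2) x] nth_equalityI[of ys zs] by (auto simp: less_Suc_eq_le)
        then show "B n ys u \<inter> B n zs u = {}" by (auto simp: B_def)
      qed
      then have "prob (A p n u) = (\<Sum>ys\<in>paths p n x 1. prob (B n ys u))"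
        unfolding A_def using finite_paths[OF x] B_event by (intro finite_measure_finite_Union) auto
      then show ?thesis using B_prob[OF _ u] by (simp add: sum_distrib_left)
    qed
    have all: "AE \<omega> in M x. \<forall>n. \<omega> \<in> A (\<lambda>_ _. True) n (\<lambda>_. 0)"
      unfolding AE_all_countable
    proof
      fix n
      have "prob (A (\<lambda>_ _. True) n (\<lambda>_. 0)) = 1"
        using A_prob[of n "\<lambda>_. 0" "\<lambda>_ _. True"] by (simp add: sum_weight_all_paths[OF x])
      then show "AE \<omega> in M x. \<omega> \<in> A (\<lambda>_ _. True) n (\<lambda>_. 0)"
        using A_event by (simp add: prob_eq_1)
    qed
    have A_D: "(\<forall>i<n. \<tau> i \<omega> > u i) \<and> (\<forall>i<n. Y (Suc i) \<omega> \<in> nbrs E (Y i \<omega>)) \<and>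
        (\<forall>k\<le>n. p (Y k \<omega>) (\<Prod>i<k. s {Y i \<omega>, Y (Suc i) \<omega>}))" if \<omega>: "\<omega> \<in> A p n u" for p n u \<omega>
    proof -
      from \<omega> obtain ys where ys: "ys \<in> paths p n x 1" and B: "\<omega> \<in> B n ys u" by (auto simp: A_def)
      then have Y: "\<And>i. i \<le> n \<Longrightarrow> ys ! i = Y i \<omega>" and "\<forall>i<n. \<tau> i \<omega> > u i" by (auto simp: B_def)
      moreover have "\<forall>i<n. Y (Suc i) \<omega> \<in> nbrs E (Y i \<omega>)" using pathsD[OF ys x] by (simp add: Y)
      moreover have "p (Y k \<omega>) (\<Prod>i<k. s {Y i \<omega>, Y (Suc i) \<omega>})" if "k \<le> n" for k
      proof -
        have "(\<Prod>i<k. s {ys ! i, ys ! Suc i}) = (\<Prod>i<k. s {Y i \<omega>, Y (Suc i) \<omega>})"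
          using that by (intro prod.cong) (auto simp: Y)
        moreover have "p (ys ! k) (\<Prod>i<k. s {ys ! i, ys ! Suc i})" using pathsD[OF ys x] that by simp
        ultimately show ?thesis using that by (simp add: Y)
      qed
      ultimately show ?thesis by blast
    qed

    have \<tau>_law: "prob {\<omega>\<in>space (M x). \<forall>i<n. \<tau> i \<omega> > u i} = exp (- (\<Sum>i<n. u i))"
      if u: "\<forall>i<n. 0 \<le> u i" for n u
    proof -
      have "prob {\<omega>\<in>space (M x). \<forall>i<n. \<tau> i \<omega> > u i} = prob (A (\<lambda>_ _. True) n u)"
      proof (rule measure_eq_AE)
        show "AE \<omega> in M x. (\<omega> \<in> {\<omega>\<in>space (M x). \<forall>i<n. \<tau> i \<omega> > u i}) = (\<omega> \<in> A (\<lambda>_ _. True) n u)"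
          using all by eventually_elim (fastforce simp: A_def B_def)
        show "{\<omega>\<in>space (M x). \<forall>i<n. \<tau> i \<omega> > u i} \<in> events" by measurable
      qed (rule A_event)
      then show ?thesis using A_prob[OF u, of "\<lambda>_ _. True"] by (simp add: sum_weight_all_paths[OF x])
    qed
    have \<tau>_pos: "AE \<omega> in M x. \<forall>i. \<tau> i \<omega> > 0"
      using all by eventually_elim (use A_D lessI in blast)
    \<comment> \<open>Holding times outside \<open>J\<close> are only required to be positive, which holds almost surely.\<close>
    have joint: "prob (\<Inter>j\<in>J. {\<omega>\<in>space (M x). \<tau> j \<omega> > 1}) = exp (- real (card J))"
      if J: "finite J" "J \<noteq> {}" for J
    proof -
      obtain n where n: "\<forall>j\<in>J. j < n" using J(1) finite_nat_set_iff_bounded by blast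
      let ?u = "\<lambda>i. of_bool (i \<in> J) :: real"
      have "prob (\<Inter>j\<in>J. {\<omega>\<in>space (M x). \<tau> j \<omega> > 1}) = prob {\<omega>\<in>space (M x). \<forall>i<n. \<tau> i \<omega> > ?u i}"
      proof (rule measure_eq_AE)
        show "AE \<omega> in M x. (\<omega> \<in> (\<Inter>j\<in>J. {\<omega>\<in>space (M x). \<tau> j \<omega> > 1})) =
            (\<omega> \<in> {\<omega>\<in>space (M x). \<forall>i<n. \<tau> i \<omega> > ?u i})"
          using \<tau>_pos by eventually_elim (use J n in \<open>auto simp: of_bool_def\<close>)
        show "(\<Inter>j\<in>J. {\<omega>\<in>space (M x). \<tau> j \<omega> > 1}) \<in> events"
          using J by (intro sets.finite_INT) measurable
      qed measurable
      also have "\<dots> = exp (- (\<Sum>i<n. ?u i))" by (rule \<tau>_law) simp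
      also have "(\<Sum>i<n. ?u i) = real (card J)"
      proof -
        have "{i. i < n \<and> i \<in> J} = J" using n by auto
        then show ?thesis by (simp add: Int_def)
      qed
      finally show ?thesis .
    qed
    have indep: "indep_events (\<lambda>i. {\<omega>\<in>space (M x). \<tau> i \<omega> > 1}) UNIV"
      unfolding indep_events_def
    proof (intro conjI allI impI)
      show "(\<lambda>i. {\<omega>\<in>space (M x). \<tau> i \<omega> > 1}) ` UNIV \<subseteq> events" by auto
      fix J :: "nat set" assume J: "J \<subseteq> UNIV" "J \<noteq> {}" "finite J"
      have "prob {\<omega>\<in>space (M x). \<tau> j \<omega> > 1} = exp (-1)" for j using joint[of "{j}"] by simp
      then show "prob (\<Inter>j\<in>J. {\<omega>\<in>space (M x). \<tau> j \<omega> > 1}) = (\<Prod>j\<in>J. prob {\<omega>\<in>space (M x). \<tau> j \<omega> > 1})"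
        using joint[OF J(3,2)] by (simp add: exp_of_nat_mult[symmetric])
    qed
    have long: "AE \<omega> in M x. infinite {i. \<tau> i \<omega> > 1}"
      using borel_0_1_law_AE[OF indep]
    proof
      assume fin: "AE \<omega> in M x. finite {i. \<tau> i \<omega> > 1}"
      let ?U = "\<lambda>n. \<Union>m\<in>{n..}. {\<omega>\<in>space (M x). \<tau> m \<omega> > 1}"
      have lim: "(\<lambda>n. prob (?U n)) \<longlonglongrightarrow> prob (\<Inter>n. ?U n)"
        by (intro finite_Lim_measure_decseq) (force simp: decseq_def intro!: sets.countable_UN')+
      have "prob (\<Inter>n. ?U n) = 0"
      proof -
        have "AE \<omega> in M x. \<omega> \<notin> (\<Inter>n. ?U n)"
          using fin
        proof eventually_elim
          case (elim \<omega>)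
          then obtain k where "\<forall>i. \<tau> i \<omega> > 1 \<longrightarrow> i < k" by (auto simp: finite_nat_set_iff_bounded)
          then have "\<omega> \<notin> ?U k" by (auto simp: not_less[symmetric])
          then show ?case by blast
        qed
        then show ?thesis by (subst prob_eq_0) (auto intro!: sets.countable_INT'' sets.countable_UN')
      qed
      moreover have "exp (-1) \<le> prob (?U n)" for n
      proof -
        have "prob {\<omega>\<in>space (M x). \<tau> n \<omega> > 1} \<le> prob (?U n)"
          by (intro finite_measure_mono) (auto intro!: sets.countable_UN')
        then show ?thesis using joint[of "{n}"] by simp
      qed
      then have "exp (-1) \<le> prob (\<Inter>n. ?U n)" by (intro LIMSEQ_le_const[OF lim]) blast
      ultimately have "exp (-1) \<le> (0::real)" by simp
      then show ?thesis using exp_gt_zero[of "-1::real"] by linarith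
    qed

    \<comment> \<open>The event \<open>G n\<close> says that the martingale has been positive up to step \<open>n\<close>.\<close>
    define p where "p y \<rho> \<longleftrightarrow> real_of_int \<rho> * h y > 0" for y \<rho>
    define G where "G n = A p n (\<lambda>_. 0)" for n
    have G_event: "G n \<in> events" for n by (simp add: G_def A_event)
    have G_prob: "h x / C \<le> prob (G n)" for n
      using maximal_inequality[of h C x 1 n] h x C0 A_prob[of n "\<lambda>_. 0" p]
      by (simp add: G_def p_def[abs_def] pos_divide_le_eq mult.commute)
    have "decseq G"
    proof (rule decseq_SucI, rule subsetI)
      fix n \<omega> assume "\<omega> \<in> G (Suc n)"
      then obtain ys where ys: "ys \<in> paths p (Suc n) x 1" and B: "\<omega> \<in> B (Suc n) ys (\<lambda>_. 0)"
        by (auto simp: G_def A_def)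
      have "\<omega> \<in> B n (butlast ys) (\<lambda>_. 0)"
        using B pathsD[OF ys x] by (auto simp: B_def nth_butlast)
      then show "\<omega> \<in> G n" using butlast_paths[OF ys x] by (auto simp: G_def A_def)
    qed
    then have lim: "(\<lambda>n. prob (G n)) \<longlonglongrightarrow> prob (\<Inter>n. G n)"
      using G_event by (intro finite_Lim_measure_decseq) auto
    have "h x / C \<le> prob (\<Inter>n. G n)" by (rule LIMSEQ_le_const[OF lim]) (use G_prob in blast)
    moreover have "0 < h x / C" using hx C0 by simp
    moreover have "AE \<omega> in M x. \<omega> \<notin> (\<Inter>n. G n)"
      using long X cycles[OF x]
    proof eventually_elim
      case (elim \<omega>)
      show ?case
      proof
        assume "\<omega> \<in> (\<Inter>n. G n)"
        then have "\<omega> \<in> A p n (\<lambda>_. 0)" for n by (simp add: G_def)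
        from A_D[OF this] have G: "\<And>i. \<tau> i \<omega> > 0" "\<And>i. Y (Suc i) \<omega> \<in> nbrs E (Y i \<omega>)"
          "\<And>k. p (Y k \<omega>) (\<Prod>i<k. s {Y i \<omega>, Y (Suc i) \<omega>})" by blast+
        from elim(3) obtain a b where ab: "0 \<le> a" "a < b" "X x a \<omega> = X x b \<omega>"
          "odd_path V E s (\<lambda>t. X x t \<omega>) a b"
          unfolding traverses_infinitely_many_unsatisfied_cycles_def by blast
        have "\<exists>k l. Y k \<omega> = Y l \<omega> \<and>
            (\<Prod>i<l. s {Y i \<omega>, Y (Suc i) \<omega>}) = - (\<Prod>i<k. s {Y i \<omega>, Y (Suc i) \<omega>})"
          by (rule odd_cycle_of_jump_chain[where \<gamma> = "\<lambda>t. X x t \<omega>" and \<tau> = "\<lambda>i. \<tau> i \<omega>"])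
            (use signed_graph_axioms G(1,2) elim(1,2) ab in auto)
        then obtain k l where "Y k \<omega> = Y l \<omega>"
          "(\<Prod>i<l. s {Y i \<omega>, Y (Suc i) \<omega>}) = - (\<Prod>i<k. s {Y i \<omega>, Y (Suc i) \<omega>})" by blast
        then show False using G(3)[of k] G(3)[of l] by (simp add: p_def)
      qed
    qed
    then have "prob (\<Inter>n. G n) = 0"
      using G_event by (subst prob_eq_0) (auto intro!: sets.countable_INT'')
    ultimately show False by simp
  qed
  show "\<forall>x\<in>V. h x = 0"
  proof
    fix x assume x: "x \<in> V"
    have "\<forall>x\<in>V. signed_avg (\<lambda>x. - h x) x = - h x"
      using harm signed_avg_cmult[of "-1" h] by simp
    then have "- h x \<le> 0" using C x by (intro pos) auto
    moreover have "h x \<le> 0" using C harm x by (rule pos)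
    ultimately show "h x = 0" by simp
  qed
qed

section \<open>Several walks and annihilation\<close>

definition states :: "'i set \<Rightarrow> ('i \<Rightarrow> 'v) set" where
  "states I = {x. \<forall>i\<in>I. x i \<in> V}"

text \<open>
  The signed averaging step of the walk with label \<open>i\<close> in a system of independent walks; \<open>x i\<close> is
  the position of that walk.
\<close>

definition move :: "'i \<Rightarrow> (('i \<Rightarrow> 'v) \<Rightarrow> real) \<Rightarrow> ('i \<Rightarrow> 'v) \<Rightarrow> real" where
  "move i f x = signed_avg (\<lambda>y. f (x(i := y))) (x i)"

lemma states_upd: "x \<in> states I \<Longrightarrow> y \<in> nbrs E (x i) \<Longrightarrow> x(i := y) \<in> states I"
  using nbrsD(2) by (auto simp: states_def)

lemma move_diff: "move i (\<lambda>x. f x - g x) x = move i f x - move i g x"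
  by (simp add: move_def signed_avg_diff)

lemma move_cong:
  "(\<And>x. x \<in> states I \<Longrightarrow> f x = g x) \<Longrightarrow> x \<in> states I \<Longrightarrow> move i f x = move i g x"
  unfolding move_def by (intro signed_avg_cong) (auto intro: states_upd)

lemma move_bound:
  "(\<And>x. x \<in> states I \<Longrightarrow> \<bar>f x\<bar> \<le> c) \<Longrightarrow> i \<in> I \<Longrightarrow> x \<in> states I \<Longrightarrow> \<bar>move i f x\<bar> \<le> c"
  unfolding move_def by (rule signed_avg_bound) (auto simp: states_def dest: nbrsD(2))

lemma move_commute: "move i (move j f) x = move j (move i f) x"
proof (cases "i = j")
  case False
  then show ?thesis
    by (simp add: move_def fun_upd_twist[OF False] signed_avg_commute[of "\<lambda>y z. f (x(j := z, i := y))"])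
qed simp

lemma funpow_move_bound:
  "(\<And>x. x \<in> states I \<Longrightarrow> \<bar>f x\<bar> \<le> c) \<Longrightarrow> i \<in> I \<Longrightarrow> x \<in> states I \<Longrightarrow> \<bar>(move i ^^ k) f x\<bar> \<le> c"
  by (induction k arbitrary: x) (auto intro: move_bound)

text \<open>
  The argument of Choquet and Deny.  The defect \<open>u = f - move j f\<close> is again harmonic for the system,
  because the moves commute.  Where a harmonic function, or its negative, nearly attains the supremum
  of its absolute value, so does its average over the move of each single walk.  Hence, up to a
  common sign, \<open>u\<close>, \<open>move j u\<close>, \<open>move j (move j u)\<close>, ... are all nearly maximal at one state.  Their
  sum telescopes to a difference of two bounded functions, which forces the supremum to be 0.
\<close>

lemma Choquet_Deny:
  assumes fin: "finite I" and j: "j \<in> I"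
    and bd: "\<And>x. x \<in> states I \<Longrightarrow> \<bar>f x\<bar> \<le> C"
    and harm: "\<And>x. x \<in> states I \<Longrightarrow> (\<Sum>i\<in>I. move i f x) = real (card I) * f x"
    and x: "x \<in> states I"
  shows "move j f x = f x"
proof (rule ccontr)
  assume neq: "move j f x \<noteq> f x"
  define n where "n = real (card I)"
  have n1: "n \<ge> 1" using fin j by (auto simp: n_def Suc_le_eq card_gt_0_iff)
  define u where "u x = f x - move j f x" for x
  define c where "c = (SUP x\<in>states I. \<bar>u x\<bar>)"
  have u2: "\<bar>u y\<bar> \<le> 2 * C" if "y \<in> states I" for y
    using bd[OF that] move_bound[of I f C, OF bd j that] by (simp add: u_def)
  have bdd: "bdd_above ((\<lambda>x. \<bar>u x\<bar>) ` states I)" using u2 by (intro bdd_aboveI2) auto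
  have uc: "\<bar>u y\<bar> \<le> c" if "y \<in> states I" for y
    unfolding c_def by (rule cSUP_upper[OF that bdd])
  have c0: "c > 0" using uc[OF x] neq by (simp add: u_def)
  have C0: "C \<ge> 0" using bd[OF x] by linarith
  define av where "av v \<longleftrightarrow> (\<forall>x\<in>states I. (\<Sum>i\<in>I. move i v x) = n * v x)" for v
  have av_move: "av (move j v)" if "av v" for v
    unfolding av_def
  proof
    fix y assume y: "y \<in> states I"
    have "(\<Sum>i\<in>I. move i (move j v) y) = move j (\<lambda>x. \<Sum>i\<in>I. move i v x) y"
      by (simp add: move_commute[of _ j] signed_avg_sum move_def[of j])
    also have "\<dots> = move j (\<lambda>x. n * v x) y"
      by (rule move_cong[OF _ y]) (use that in \<open>simp add: av_def\<close>)
    also have "\<dots> = n * move j v y" by (simp add: move_def signed_avg_cmult)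
    finally show "(\<Sum>i\<in>I. move i (move j v) y) = n * move j v y" .
  qed
  have "av f" using harm by (simp add: av_def n_def)
  have "av u" using \<open>av f\<close> av_move[OF \<open>av f\<close>]
    by (simp add: av_def u_def[abs_def] move_diff sum_subtractf right_diff_distrib)
  have av_k: "av ((move j ^^ k) u)" for k
    by (induction k) (use \<open>av u\<close> av_move in auto)
  have bd_k: "\<bar>(move j ^^ k) u y\<bar> \<le> c" if "y \<in> states I" for k y
    using funpow_move_bound[OF uc j that] .
  \<comment> \<open>So many terms of size \<open>c / 2\<close> exceed \<open>2 * C\<close>.\<close>
  define L where "L = nat \<lceil>4 * C / c\<rceil> + 1"
  have L: "real L * c > 4 * C"
  proof -
    have "4 * C / c < real L" unfolding L_def by linarith
    then show ?thesis using c0 by (simp add: pos_divide_less_eq)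
  qed
  have "c - c / (2 * n ^ L) < c" using c0 n1 by simp
  then obtain y where y: "y \<in> states I" and uy: "\<bar>u y\<bar> > c - c / (2 * n ^ L)"
    using less_cSUP_iff[OF _ bdd] x unfolding c_def by blast
  define \<sigma> where "\<sigma> = (if u y \<ge> 0 then 1 else -1 :: real)"
  have \<sigma>: "\<sigma> * u y = \<bar>u y\<bar>" "\<bar>\<sigma>\<bar> = 1" by (auto simp: \<sigma>_def)
  have \<sigma>_le: "\<sigma> * r \<le> b" if "\<bar>r\<bar> \<le> b" for r b using that by (auto simp: \<sigma>_def)
  \<comment> \<open>The gap to the supremum grows at most by the factor \<open>n\<close> in each step.\<close>
  have step: "c - \<sigma> * (move j ^^ k) u y \<le> n ^ k * (c - \<bar>u y\<bar>)" for k
  proof (induction k)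
    case (Suc k)
    let ?v = "(move j ^^ k) u"
    have "n * (\<sigma> * ?v y) = \<sigma> * (\<Sum>i\<in>I. move i ?v y)"
      using av_k[of k] y by (simp add: av_def mult.left_commute)
    also have "\<dots> = \<sigma> * move j ?v y + (\<Sum>i\<in>I - {j}. \<sigma> * move i ?v y)"
      using fin j by (simp add: sum.remove distrib_left sum_distrib_left)
    also have "(\<Sum>i\<in>I - {j}. \<sigma> * move i ?v y) \<le> (\<Sum>i\<in>I - {j}. c)"
      by (intro sum_mono \<sigma>_le move_bound[of I]) (use bd_k y in auto)
    also have "(\<Sum>i\<in>I - {j}. c) = (n - 1) * c"
      using fin j n1 by (simp add: n_def of_nat_diff)
    finally have "c - \<sigma> * move j ?v y \<le> n * (c - \<sigma> * ?v y)" by (simp add: algebra_simps)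
    also have "\<dots> \<le> n * (n ^ k * (c - \<bar>u y\<bar>))" using Suc n1 by (intro mult_left_mono) auto
    finally show ?case by (simp add: mult.assoc)
  qed (simp add: \<sigma>)
  have half: "\<sigma> * (move j ^^ k) u y \<ge> c / 2" if "k < L" for k
  proof -
    have "n ^ k * (c - \<bar>u y\<bar>) \<le> n ^ L * (c - \<bar>u y\<bar>)"
      using that n1 uc[OF y] by (intro mult_right_mono power_increasing) auto
    also have "\<dots> \<le> n ^ L * (c / (2 * n ^ L))"
      using uy n1 by (intro mult_left_mono) auto
    also have "\<dots> = c / 2" using n1 by simp
    finally show ?thesis using step[of k] by linarith
  qed
  have pow_diff: "(move j ^^ k) u z = (move j ^^ k) f z - (move j ^^ Suc k) f z" for k z
  proof (induction k arbitrary: z)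
    case (Suc k)
    have "(move j ^^ k) u = (\<lambda>z. (move j ^^ k) f z - (move j ^^ Suc k) f z)"
      using Suc by blast
    then show ?case by (simp add: move_diff)
  qed (simp add: u_def)
  have "(\<Sum>k<L. (move j ^^ k) u y) = f y - (move j ^^ L) f y"
    unfolding pow_diff by (subst sum_lessThan_telescope') simp
  moreover have "\<bar>f y - (move j ^^ L) f y\<bar> \<le> 2 * C"
    using bd[OF y] funpow_move_bound[of I f C, OF bd j y, of L] by simp
  ultimately have "\<sigma> * (\<Sum>k<L. (move j ^^ k) u y) \<le> 2 * C" using \<sigma>_le by metis
  moreover have "(\<Sum>k<L. c / 2) \<le> \<sigma> * (\<Sum>k<L. (move j ^^ k) u y)"
    unfolding sum_distrib_left using half by (intro sum_mono) auto
  ultimately show False using L by simp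
qed



text \<open>
  The step of the system changes the Cesaro mean of the first \<open>m\<close> iterates by \<open>O(1 / m)\<close>, so the
  cluster points of the means are harmonic for the system.  They are harmonic in each coordinate by
  \<open>Choquet_Deny\<close> and therefore vanish.
\<close>

lemma Cesaro_tendsto_zero:
  fixes f :: "('i \<Rightarrow> 'v) \<Rightarrow> real"
  assumes liouville: liouville and fin: "finite I" and ne: "I \<noteq> {}"
    and bd: "\<And>x. x \<in> states I \<Longrightarrow> \<bar>f x\<bar> \<le> C"
    and T_def: "T = (\<lambda>f x. (\<Sum>i\<in>I. move i f x) / real (card I))"
    and x0: "x0 \<in> states I"
  shows "(\<lambda>m. (\<Sum>k<m. (T ^^ k) f x0) / real m) \<longlonglongrightarrow> 0"
proof -
  have n0: "real (card I) > 0" using fin ne by (simp add: card_gt_0_iff)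
  have T_bound: "\<bar>T g x\<bar> \<le> c" if g: "\<And>x. x \<in> states I \<Longrightarrow> \<bar>g x\<bar> \<le> c" and x: "x \<in> states I" for g x c
  proof -
    have "\<bar>\<Sum>i\<in>I. move i g x\<bar> \<le> (\<Sum>i\<in>I. \<bar>move i g x\<bar>)" by (rule sum_abs)
    also have "\<dots> \<le> (\<Sum>i\<in>I. c)" using move_bound[OF g _ x] by (intro sum_mono) auto
    finally show ?thesis using n0 by (simp add: T_def pos_divide_le_eq mult.commute)
  qed
  have pow_bound: "\<bar>(T ^^ k) f x\<bar> \<le> C" if "x \<in> states I" for k x
    using that by (induction k arbitrary: x) (auto intro: bd T_bound)
  have C0: "C \<ge> 0" using bd[OF x0] by linarith
  define A where "A m x = (\<Sum>k<m. (T ^^ k) f x) / real m" for m x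
  have A_bound: "\<bar>A m x\<bar> \<le> C" if "x \<in> states I" for m x
  proof -
    have "\<bar>\<Sum>k<m. (T ^^ k) f x\<bar> \<le> (\<Sum>k<m. \<bar>(T ^^ k) f x\<bar>)" by (rule sum_abs)
    also have "\<dots> \<le> (\<Sum>k<m. C)" by (intro sum_mono pow_bound that)
    finally show ?thesis using C0 by (cases "m = 0") (auto simp: A_def pos_divide_le_eq mult.commute)
  qed
  have move_lin: "move i (\<lambda>x. c * (\<Sum>k<m. g k x)) x = c * (\<Sum>k<m. move i (g k) x)"
    for i m c and g :: "nat \<Rightarrow> ('i \<Rightarrow> 'v) \<Rightarrow> real" and x
    by (simp add: move_def signed_avg_cmult signed_avg_sum)
  have T_A: "T (A m) x = (\<Sum>k<m. (T ^^ Suc k) f x) / real m" for m x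
  proof -
    have A: "A m = (\<lambda>x. inverse (real m) * (\<Sum>k<m. (T ^^ k) f x))"
      by (simp add: A_def[abs_def] divide_inverse mult.commute)
    have "T (A m) x = (\<Sum>i\<in>I. inverse (real m) * (\<Sum>k<m. move i ((T ^^ k) f) x)) / real (card I)"
      unfolding T_def A move_lin ..
    also have "\<dots> = inverse (real m) * (\<Sum>k<m. (\<Sum>i\<in>I. move i ((T ^^ k) f) x) / real (card I))"
      unfolding sum_distrib_left[symmetric] sum_divide_distrib[symmetric] by (subst sum.swap) simp
    also have "\<dots> = (\<Sum>k<m. (T ^^ Suc k) f x) / real m"
      by (simp add: T_def divide_inverse mult.commute)
    finally show ?thesis .
  qed
  have defect: "(\<lambda>m. T (A m) x - A m x) \<longlonglongrightarrow> 0" if x: "x \<in> states I" for x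
  proof (rule Lim_null_comparison)
    have "T (A m) x - A m x = ((T ^^ m) f x - f x) / real m" for m
      unfolding T_A A_def diff_divide_distrib[symmetric] sum_subtractf[symmetric]
      by (subst sum_lessThan_telescope) simp
    moreover have "\<bar>(T ^^ m) f x - f x\<bar> \<le> 2 * C" for m
      using pow_bound[OF x, of m] bd[OF x] by simp
    ultimately show "\<forall>\<^sub>F m in sequentially. norm (T (A m) x - A m x) \<le> 2 * C / real m"
      by (intro always_eventually) (auto simp: divide_right_mono)
    show "(\<lambda>m. 2 * C / real m) \<longlonglongrightarrow> 0" by real_asymp
  qed
  define D where "D m x = (if x \<in> states I then A m x else 0)" for m x
  have "(\<lambda>m. D m x0) \<longlonglongrightarrow> 0"
  proof (rule tendsto_zero_if_cluster_points_vanish[where D = D and C = C])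
    show "\<bar>D m x\<bar> \<le> C" for m x using A_bound C0 by (simp add: D_def)
    fix G :: "nat filter" and h
    assume G: "G \<noteq> bot" "G \<le> sequentially" and lim: "\<And>x. ((\<lambda>m. D m x) \<longlongrightarrow> h x) G"
    have lim_A: "((\<lambda>m. A m x) \<longlongrightarrow> h x) G" if "x \<in> states I" for x
      using lim[of x] that by (simp add: D_def)
    have h_bound: "\<bar>h x\<bar> \<le> C" if "x \<in> states I" for x
      using tendsto_upperbound[OF tendsto_rabs[OF lim_A[OF that]] _ G(1)] A_bound[OF that] by simp
    have "T h x = h x" if x: "x \<in> states I" for x
    proof -
      have "((\<lambda>m. T (A m) x - A m x) \<longlongrightarrow> T h x - h x) G"
        unfolding T_def divide_inverse move_def
        by (intro tendsto_intros tendsto_signed_avg lim_A x states_upd[OF x])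
      moreover have "((\<lambda>m. T (A m) x - A m x) \<longlongrightarrow> 0) G"
        using defect[OF x] G(2) by (rule tendsto_mono[rotated])
      ultimately show ?thesis using tendsto_unique[OF G(1)] by fastforce
    qed
    then have harm: "(\<Sum>i\<in>I. move i h x) = real (card I) * h x" if "x \<in> states I" for x
      using n0 that by (auto simp: T_def divide_eq_eq mult.commute)
    obtain j where j: "j \<in> I" using ne by blast
    let ?h = "\<lambda>y. h (x0(j := y))"
    have upd: "x0(j := y) \<in> states I" if "y \<in> V" for y using x0 that by (auto simp: states_def)
    have "\<forall>y\<in>V. \<bar>?h y\<bar> \<le> C" using h_bound upd by blast
    moreover have "\<forall>y\<in>V. signed_avg ?h y = ?h y"
    proof
      fix y assume "y \<in> V"
      from Choquet_Deny[OF fin j h_bound harm upd[OF this]]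
      show "signed_avg ?h y = ?h y" by (simp add: move_def)
    qed
    moreover have "x0 j \<in> V" using x0 j by (simp add: states_def)
    ultimately have "?h (x0 j) = 0" by (rule liouvilleD[OF liouville])
    then show "h x0 = 0" by simp
  qed
  then show ?thesis using x0 by (simp add: D_def A_def)
qed

text \<open>
  Think of \<open>D\<close> as the set of states without a collision.  Let \<open>q k x\<close> be the probability that the walks
  from \<open>x\<close> avoid collisions up to step \<open>k\<close>, and let \<open>g\<close> be its limit.  Until the first collision \<open>F\<close>
  evolves as under independent walks, so \<open>F\<close> and the iterates of the independent step differ by at
  most \<open>C * (1 - g)\<close>.  The Cesaro means of the iterates tend to 0, whence \<open>\<bar>F\<bar> \<le> C * (1 - g)\<close>.
  Applying the killed step \<open>k\<close> times to this bound replaces it by \<open>C * (q k - g)\<close>, and this tends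
  to 0.
\<close>

lemma killed_harmonic_eq_zero:
  fixes F :: "('i \<Rightarrow> 'v) \<Rightarrow> real"
  assumes liouville: liouville and fin: "finite I" and ne: "I \<noteq> {}"
    and bd: "\<And>x. x \<in> states I \<Longrightarrow> \<bar>F x\<bar> \<le> C"
    and off: "\<And>x. x \<notin> D \<Longrightarrow> F x = 0"
    and harm: "\<And>x. x \<in> states I \<Longrightarrow> x \<in> D \<Longrightarrow> (\<Sum>i\<in>I. move i F x) = real (card I) * F x"
    and x0: "x0 \<in> states I"
  shows "F x0 = 0"
proof -
  have n0: "real (card I) > 0" using fin ne by (simp add: card_gt_0_iff)
  define T :: "(('i \<Rightarrow> 'v) \<Rightarrow> real) \<Rightarrow> ('i \<Rightarrow> 'v) \<Rightarrow> real"
    where T_def: "T = (\<lambda>f x. (\<Sum>i\<in>I. move i f x) / real (card I))"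
  define Q :: "(('i \<Rightarrow> 'v) \<Rightarrow> real) \<Rightarrow> ('i \<Rightarrow> 'v) \<Rightarrow> real"
    where Q_def: "Q = (\<lambda>f x. (\<Sum>i\<in>I. avg (\<lambda>y. f (x(i := y))) (x i)) / real (card I))"
  have Q_mono: "Q f x \<le> Q g x" if "\<And>x. x \<in> states I \<Longrightarrow> f x \<le> g x" "x \<in> states I" for f g x
    unfolding Q_def
    by (intro divide_right_mono sum_mono avg_mono that(1) states_upd[OF that(2)]) auto
  have Q_const: "Q (\<lambda>_. c) x = c" if "x \<in> states I" for c x
    using that n0 by (simp add: Q_def states_def avg_const)
  have Q_diff: "Q (\<lambda>x. f x - g x) x = Q f x - Q g x" for f g x
    by (simp add: Q_def avg_diff sum_subtractf diff_divide_distrib)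
  have Q_cmult: "Q (\<lambda>x. c * f x) x = c * Q f x" for c f x
    by (simp add: Q_def avg_cmult sum_distrib_left[symmetric])
  have T_diff: "T (\<lambda>x. f x - g x) x = T f x - T g x" for f g x
    by (simp add: T_def move_diff sum_subtractf diff_divide_distrib)
  have T_le_Q: "\<bar>T f x\<bar> \<le> Q (\<lambda>x. \<bar>f x\<bar>) x" for f x
  proof -
    have "\<bar>\<Sum>i\<in>I. move i f x\<bar> \<le> (\<Sum>i\<in>I. \<bar>move i f x\<bar>)" by (rule sum_abs)
    also have "\<dots> \<le> (\<Sum>i\<in>I. avg (\<lambda>y. \<bar>f (x(i := y))\<bar>) (x i))"
      unfolding move_def by (intro sum_mono abs_signed_avg_le)
    finally show ?thesis by (simp add: T_def Q_def divide_right_mono)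
  qed
  have T_F: "T F x = F x" if "x \<in> states I" "x \<in> D" for x
    using harm[OF that] n0 by (simp add: T_def)
  have C0: "C \<ge> 0" using bd[OF x0] by linarith

  define q where "q = rec_nat (\<lambda>_. 1 :: real) (\<lambda>_ q x. if x \<in> D then Q q x else 0)"
  have q0: "q 0 x = 1" and qS: "q (Suc k) x = (if x \<in> D then Q (q k) x else 0)" for k x
    by (simp_all add: q_def)
  have q01: "0 \<le> q k x \<and> q k x \<le> 1" if "x \<in> states I" for k x
    using that
  proof (induction k arbitrary: x)
    case (Suc k)
    have "Q (\<lambda>_. 0) x \<le> Q (q k) x" "Q (q k) x \<le> Q (\<lambda>_. 1) x"
      using Suc by (auto intro!: Q_mono)
    then show ?case using Suc.prems by (simp add: qS Q_const)
  qed (simp add: q0)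
  have q_Suc: "q (Suc k) x \<le> q k x" if "x \<in> states I" for k x
    using that
  proof (induction k arbitrary: x)
    case 0 then show ?case using q01[of x "Suc 0"] by (simp add: q0)
  next
    case (Suc k) then show ?case by (auto simp: qS[of "Suc k"] qS[of k] intro!: Q_mono)
  qed
  define g where "g x = lim (\<lambda>k. q k x)" for x
  have q_lim: "(\<lambda>k. q k x) \<longlonglongrightarrow> g x" if "x \<in> states I" for x
  proof -
    have "convergent (\<lambda>k. q k x)"
      using q01[OF that] q_Suc[OF that]
      by (intro Bseq_monoseq_convergent BseqI'[of _ 1] decseq_imp_monoseq decseq_SucI) auto
    then show ?thesis by (simp add: g_def convergent_LIMSEQ_iff)
  qed
  have g_le: "g x \<le> q k x" if "x \<in> states I" for k x
    using q_Suc[OF that] q_lim[OF that] by (intro decseq_ge) (auto intro: decseq_SucI)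
  have g_off: "g x = 0" if "x \<in> states I" "x \<notin> D" for x
  proof -
    have "(\<lambda>k. q (Suc k) x) \<longlonglongrightarrow> 0" using that by (simp add: qS)
    then show ?thesis using q_lim[OF that(1), THEN LIMSEQ_Suc] LIMSEQ_unique by blast
  qed
  have g_on: "Q g x = g x" if "x \<in> states I" "x \<in> D" for x
  proof -
    have "(\<lambda>k. Q (q k) x) \<longlonglongrightarrow> Q g x"
      unfolding Q_def divide_inverse by (intro tendsto_intros tendsto_avg q_lim states_upd that)
    moreover have "(\<lambda>k. Q (q k) x) \<longlonglongrightarrow> g x"
      using q_lim[OF that(1), THEN LIMSEQ_Suc] that by (simp add: qS)
    ultimately show ?thesis using LIMSEQ_unique by blast
  qed

  have T_pow: "\<bar>F x - (T ^^ k) F x\<bar> \<le> C * (1 - q k x)" if "x \<in> states I" for k x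
    using that
  proof (induction k arbitrary: x)
    case (Suc k)
    have *: "\<bar>T (\<lambda>x. F x - (T ^^ k) F x) x\<bar> \<le> C * (1 - Q (q k) x)"
    proof -
      have "\<bar>T (\<lambda>x. F x - (T ^^ k) F x) x\<bar> \<le> Q (\<lambda>x. \<bar>F x - (T ^^ k) F x\<bar>) x" by (rule T_le_Q)
      also have "\<dots> \<le> Q (\<lambda>x. C * (1 - q k x)) x" using Suc by (intro Q_mono) auto
      finally show ?thesis using Suc.prems by (simp add: Q_cmult Q_diff Q_const)
    qed
    show ?case
    proof (cases "x \<in> D")
      case True
      then show ?thesis using * T_F[OF Suc.prems True] by (simp add: qS T_diff)
    next
      case False
      have "\<bar>(T ^^ Suc k) F y\<bar> \<le> C" if "y \<in> states I" for y
      proof -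
        have "\<bar>(T ^^ j) F y\<bar> \<le> C" if "y \<in> states I" for j y
          using that
        proof (induction j arbitrary: y)
          case (Suc j)
          have "\<bar>T ((T ^^ j) F) y\<bar> \<le> Q (\<lambda>x. \<bar>(T ^^ j) F x\<bar>) y" by (rule T_le_Q)
          also have "\<dots> \<le> Q (\<lambda>_. C) y" using Suc by (intro Q_mono) auto
          finally show ?case using Suc.prems by (simp add: Q_const)
        qed (simp add: bd)
        then show ?thesis using that by blast
      qed
      from this[OF Suc.prems] show ?thesis using False by (simp add: qS off)
    qed
  qed (simp add: q0)
  have F_le: "\<bar>F x\<bar> \<le> C * (1 - g x)" if x: "x \<in> states I" for x
  proof -
    let ?A = "\<lambda>m. (\<Sum>k<m. (T ^^ k) F x) / real m"
    have "?A \<longlonglongrightarrow> 0"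
      by (rule Cesaro_tendsto_zero[OF liouville fin ne bd T_def x])
    then have "(\<lambda>m. \<bar>F x - ?A m\<bar>) \<longlonglongrightarrow> \<bar>F x - 0\<bar>" by (intro tendsto_intros)
    moreover have "\<bar>F x - ?A m\<bar> \<le> C * (1 - g x)" if "m > 0" for m
    proof -
      have "F x - ?A m = (\<Sum>k<m. F x - (T ^^ k) F x) / real m"
        using that by (simp add: sum_subtractf diff_divide_distrib)
      moreover have "\<bar>\<Sum>k<m. F x - (T ^^ k) F x\<bar> \<le> (\<Sum>k<m. C * (1 - g x))"
      proof (rule order_trans[OF sum_abs sum_mono])
        fix k
        have "C * (1 - q k x) \<le> C * (1 - g x)" using g_le[OF x] C0 by (intro mult_left_mono) auto
        then show "\<bar>F x - (T ^^ k) F x\<bar> \<le> C * (1 - g x)" using T_pow[OF x, of k] by linarith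
      qed
      ultimately show ?thesis using that by (simp add: pos_divide_le_eq mult.commute)
    qed
    then have "\<forall>\<^sub>F m in sequentially. \<bar>F x - ?A m\<bar> \<le> C * (1 - g x)"
      using eventually_gt_at_top[of "0::nat"] by (rule eventually_mono[rotated])
    ultimately show ?thesis using tendsto_upperbound by fastforce
  qed
  have "\<bar>F x\<bar> \<le> C * (q k x - g x)" if "x \<in> states I" for k x
    using that
  proof (induction k arbitrary: x)
    case 0 then show ?case using F_le by (simp add: q0)
  next
    case (Suc k)
    show ?case
    proof (cases "x \<in> D")
      case True
      have "\<bar>F x\<bar> \<le> Q (\<lambda>x. \<bar>F x\<bar>) x" using T_le_Q[of F x] T_F[OF Suc.prems True] by simp
      also have "\<dots> \<le> Q (\<lambda>x. C * (q k x - g x)) x" using Suc by (intro Q_mono) auto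
      finally show ?thesis using True g_on[OF Suc.prems True] by (simp add: qS Q_cmult Q_diff)
    next
      case False then show ?thesis using g_off[OF Suc.prems False] by (simp add: qS off)
    qed
  qed
  from this[OF x0] have "\<bar>F x0\<bar> \<le> C * (q k x0 - g x0)" for k .
  moreover have "(\<lambda>k. C * (q k x0 - g x0)) \<longlonglongrightarrow> C * (g x0 - g x0)"
    by (intro tendsto_intros q_lim x0)
  ultimately have "\<bar>F x0\<bar> \<le> 0" using LIMSEQ_le_const by fastforce
  then show ?thesis by simp
qed

text \<open>
  The generator of annihilating signed walks that occupy the sites of \<open>A\<close>: passing to
  \<open>sym_diff A {x, y}\<close> moves the walk at \<open>x\<close> to \<open>y\<close>, and removes both walks if \<open>y\<close> is occupied.
\<close>

definition dual_gen :: "('v set \<Rightarrow> real) \<Rightarrow> 'v set \<Rightarrow> real" where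
  "dual_gen F A = (\<Sum>x\<in>A. signed_avg (\<lambda>y. F (sym_diff A {x, y})) x - F A)"

text \<open>
  By induction on the number of walks.  If \<open>h\<close> vanishes on the smaller sets, then it is killed when
  two of the walks meet, and \<open>killed_harmonic_eq_zero\<close> applies to the function \<open>h (x ` A)\<close> of the
  positions \<open>x\<close> of walks that are labelled by their starting points.
\<close>

lemma dual_harmonic_eq_zero:
  assumes liouville: liouville
    and bd: "\<And>A. finite A \<Longrightarrow> A \<subseteq> V \<Longrightarrow> \<bar>h A\<bar> \<le> C"
    and harm: "\<And>A. finite A \<Longrightarrow> A \<subseteq> V \<Longrightarrow> dual_gen h A = 0"
    and empty: "h {} = 0"
    and A: "finite A" "A \<subseteq> V"
  shows "h A = 0"
  using A
proof (induction "card A" arbitrary: A rule: less_induct)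
  case less
  note A = \<open>finite A\<close> \<open>A \<subseteq> V\<close>
  show ?case
  proof (cases "A = {}")
    case False
    define F :: "('v \<Rightarrow> 'v) \<Rightarrow> real" where "F x = (if inj_on x A then h (x ` A) else 0)" for x
    have sub: "finite (x ` A)" "x ` A \<subseteq> V" if "x \<in> states A" for x
      using that A by (auto simp: states_def)
    have C0: "C \<ge> 0" using bd[OF A] by linarith
    have "F id = 0"
    proof (rule killed_harmonic_eq_zero[OF liouville A(1) False, where F = F and C = C and D = "{x. inj_on x A}"])
      show "\<bar>F x\<bar> \<le> C" if "x \<in> states A" for x using bd[OF sub[OF that]] C0 by (simp add: F_def)
      show "F x = 0" if "x \<notin> {x. inj_on x A}" for x using that by (simp add: F_def)
      show "id \<in> states A" using A by (auto simp: states_def)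
      fix x assume x: "x \<in> states A" and "x \<in> {x. inj_on x A}"
      then have inj: "inj_on x A" by simp
      have step: "F (x(i := y)) = h (sym_diff (x ` A) {x i, y})" if i: "i \<in> A" and y: "y \<in> nbrs E (x i)" for i y
      proof (cases "y \<in> x ` A")
        case True
        have ne: "x i \<noteq> y" using nbrsD(3)[OF y] .
        obtain j where j: "j \<in> A" "y = x j" using True by blast
        then have "j \<noteq> i" using ne by auto
        then have "(x(i := y)) j = (x(i := y)) i" using j by simp
        then have "\<not> inj_on (x(i := y)) A" using i j(1) \<open>j \<noteq> i\<close> by (meson inj_onD)
        moreover have eq: "sym_diff (x ` A) {x i, y} = x ` A - {x i, y}" using i True by auto
        moreover have "card (x ` A - {x i, y}) < card (x ` A)"
          using i A by (intro psubset_card_mono) auto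
        then have "card (x ` A - {x i, y}) < card A" by (simp add: card_image inj)
        then have "h (x ` A - {x i, y}) = 0"
          using less.hyps sub[OF x] by (metis Diff_subset finite_Diff subset_trans)
        ultimately show ?thesis by (simp add: F_def)
      next
        case False
        have "x(i := y) ` A = insert y (x ` (A - {i}))" using i by auto
        also have "x ` (A - {i}) = x ` A - {x i}" using inj i by (auto simp: inj_on_def)
        also have "insert y \<dots> = sym_diff (x ` A) {x i, y}" using False i by auto
        finally have "x(i := y) ` A = sym_diff (x ` A) {x i, y}" .
        moreover have "inj_on (x(i := y)) A" using inj False by (auto simp: inj_on_def)
        ultimately show ?thesis by (simp add: F_def)
      qed
      have "0 = dual_gen h (x ` A)" using harm[OF sub[OF x]] by simp
      also have "\<dots> = (\<Sum>i\<in>A. signed_avg (\<lambda>y. h (sym_diff (x ` A) {x i, y})) (x i) - h (x ` A))"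
        unfolding dual_gen_def by (subst sum.reindex[OF inj]) simp
      also have "\<dots> = (\<Sum>i\<in>A. move i F x - F x)"
      proof (rule sum.cong[OF refl])
        fix i assume i: "i \<in> A"
        have "signed_avg (\<lambda>y. h (sym_diff (x ` A) {x i, y})) (x i) = move i F x"
          unfolding move_def by (rule signed_avg_cong, rule step[OF i, symmetric])
        then show "signed_avg (\<lambda>y. h (sym_diff (x ` A) {x i, y})) (x i) - h (x ` A) = move i F x - F x"
          using inj by (simp add: F_def)
      qed
      finally show "(\<Sum>i\<in>A. move i F x) = real (card A) * F x" by (simp add: sum_subtractf)
    qed
    then show ?thesis by (simp add: F_def)
  qed (simp add: empty)
qed

section \<open>Bounded solutions of the dual equation\<close>

lemma dual_step:
  assumes "finite B" "B \<subseteq> V" "x \<in> B" "y \<in> nbrs E x"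
  shows "finite (sym_diff B {x, y})" "sym_diff B {x, y} \<subseteq> V" "card (sym_diff B {x, y}) \<le> card B"
proof -
  show "finite (sym_diff B {x, y})" "sym_diff B {x, y} \<subseteq> V" using assms nbrsD(2) by auto
  have "card (sym_diff B {x, y}) \<le> card (insert y (B - {x}))"
    using assms by (intro card_mono) auto
  also have "\<dots> \<le> Suc (card (B - {x}))" by (rule card_insert_le_m1) auto
  also have "\<dots> = card B" using assms by (intro card_Suc_Diff1)
  finally show "card (sym_diff B {x, y}) \<le> card B" .
qed

lemma DERIV_signed_avg:
  assumes "\<And>y. y \<in> nbrs E x \<Longrightarrow> ((\<lambda>t. f t y) has_real_derivative f' y) (at t)"
  shows "((\<lambda>t. signed_avg (f t) x) has_real_derivative signed_avg f' x) (at t)"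
  unfolding signed_avg_def avg_def
  by (intro DERIV_cdivide DERIV_sum DERIV_cmult assms)

text \<open>
  The derivative \<open>w = dual_gen H\<close> solves the same equation.  Let \<open>b T\<close> be the supremum of its absolute
  value over the times from \<open>T\<close> on and the sets with at most \<open>card A\<close> elements, and let \<open>c\<close> be the
  infimum of \<open>b\<close>.  If \<open>w\<close> is close to \<open>c\<close> at some set and some late time, then it has been close to
  \<open>c\<close> at this set during a long time before, since its distance to the supremum shrinks at most at
  an exponential rate.  Over this time \<open>H\<close> grows by more than 2, which contradicts its bound if
  \<open>c > 0\<close>; a value close to \<open>- c\<close> is treated by the sign \<open>\<sigma>\<close>.
\<close>

lemma dual_flow_stationary:
  fixes H :: "real \<Rightarrow> 'v set \<Rightarrow> real"
  assumes bd: "\<And>t B. t > 0 \<Longrightarrow> finite B \<Longrightarrow> B \<subseteq> V \<Longrightarrow> \<bar>H t B\<bar> \<le> 1"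
    and deriv: "\<And>t B. t > 0 \<Longrightarrow> finite B \<Longrightarrow> B \<subseteq> V \<Longrightarrow>
      ((\<lambda>t. H t B) has_real_derivative dual_gen (H t) B) (at t)"
    and A: "finite A" "A \<subseteq> V"
  shows "((\<lambda>t. dual_gen (H t) A) \<longlongrightarrow> 0) at_top"
proof -
  define N where "N = real (card A)"
  define S where "S = {B. finite B \<and> B \<subseteq> V \<and> card B \<le> card A}"
  have S_step: "sym_diff B {x, y} \<in> S" if "B \<in> S" "x \<in> B" "y \<in> nbrs E x" for B x y
    using that dual_step[of B x y] by (auto simp: S_def)
  have AS: "A \<in> S" using A by (simp add: S_def)
  define w where "w t B = dual_gen (H t) B" for t B
  have H_deriv: "((\<lambda>t. H t B) has_real_derivative w t B) (at t)" if "t > 0" "B \<in> S" for t B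
    using deriv that by (simp add: w_def S_def)
  have H_bd: "\<bar>H t B\<bar> \<le> 1" if "t > 0" "B \<in> S" for t B using bd that by (simp add: S_def)
  have w_deriv: "((\<lambda>t. w t B) has_real_derivative dual_gen (w t) B) (at t)" if "t > 0" "B \<in> S" for t B
  proof -
    have "(\<lambda>t. w t B) = (\<lambda>t. \<Sum>x\<in>B. signed_avg (\<lambda>y. H t (sym_diff B {x, y})) x - H t B)"
      by (simp add: w_def dual_gen_def fun_eq_iff)
    then show ?thesis
      unfolding dual_gen_def[of "w t"]
      by (simp only:) (intro DERIV_sum DERIV_diff DERIV_signed_avg H_deriv that S_step)
  qed
  have w_bd: "\<bar>w t B\<bar> \<le> 2 * N" if t: "t > 0" and B: "B \<in> S" for t B
  proof -
    have "\<bar>w t B\<bar> \<le> (\<Sum>x\<in>B. \<bar>signed_avg (\<lambda>y. H t (sym_diff B {x, y})) x - H t B\<bar>)"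
      unfolding w_def dual_gen_def by (rule sum_abs)
    also have "\<dots> \<le> (\<Sum>x\<in>B. 2)"
    proof (rule sum_mono)
      fix x assume x: "x \<in> B"
      then have "x \<in> V" using B by (auto simp: S_def)
      then have "\<bar>signed_avg (\<lambda>y. H t (sym_diff B {x, y})) x\<bar> \<le> 1"
        by (rule signed_avg_bound) (rule H_bd[OF t S_step[OF B x]])
      then show "\<bar>signed_avg (\<lambda>y. H t (sym_diff B {x, y})) x - H t B\<bar> \<le> 2" using H_bd[OF t B] by linarith
    qed
    also have "\<dots> \<le> 2 * N" using B by (simp add: S_def N_def)
    finally show ?thesis .
  qed
  define b where "b T = (SUP p\<in>{T..} \<times> S. \<bar>w (fst p) (snd p)\<bar>)" for T :: real
  have bdd: "bdd_above ((\<lambda>p. \<bar>w (fst p) (snd p)\<bar>) ` ({T..} \<times> S))" if "T \<ge> 1" for T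
    using w_bd that by (intro bdd_aboveI2[of _ _ "2 * N"]) auto
  have w_le_b: "\<bar>w t B\<bar> \<le> b T" if "T \<ge> 1" "t \<ge> T" "B \<in> S" for t B T
    using cSUP_upper[OF _ bdd[OF that(1)], of "(t, B)"] that by (simp add: b_def)
  have b_ge0: "b T \<ge> 0" if "T \<ge> 1" for T using w_le_b[OF that order_refl AS] by linarith
  define c where "c = (INF T\<in>{1..}. b T)"
  have bdd_b: "bdd_below (b ` {1..})" using b_ge0 by (intro bdd_belowI2[of _ 0]) auto
  have c_le: "c \<le> b T" if "T \<ge> 1" for T unfolding c_def using that by (intro cINF_lower bdd_b) auto
  have ex_w: "\<exists>t\<ge>R. \<exists>B\<in>S. a < \<bar>w t B\<bar>" if R: "R \<ge> 1" and a: "a < b R" for a R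
  proof -
    have "{R..} \<times> S \<noteq> {}" using AS by auto
    from less_cSUP_iff[OF this bdd[OF R], of a] a
    obtain p where "p \<in> {R..} \<times> S" "a < \<bar>w (fst p) (snd p)\<bar>" unfolding b_def by blast
    then show ?thesis by (intro exI[of _ "fst p"] conjI bexI[of _ "snd p"]) auto
  qed
  have ex_T: "\<exists>T\<ge>1. b T < a" if "c < a" for a
    using that cINF_less_iff[OF _ bdd_b, of a] unfolding c_def by auto
  have c_le0: "c \<le> 0"
  proof (rule ccontr)
    assume "\<not> c \<le> 0"
    then have c: "c > 0" by simp
    \<comment> \<open>Over a time \<open>L\<close> a derivative of at least \<open>c / 2\<close> raises \<open>H\<close> by \<open>5 / 2 > 2\<close>.\<close>
    define L where "L = 5 / c"
    have L: "L > 0" using c by (simp add: L_def)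
    \<comment> \<open>Chosen so that a gap of \<open>2 * \<epsilon>\<close> is still at most \<open>c / 2\<close> a time \<open>L\<close> earlier.\<close>
    define \<epsilon> where "\<epsilon> = c / (4 * exp (N * L))"
    have \<epsilon>: "\<epsilon> > 0" using c by (simp add: \<epsilon>_def)
    have "c < c + \<epsilon>" using \<epsilon> by simp
    then obtain T where T: "T \<ge> 1" "b T < c + \<epsilon>" using ex_T by blast
    have "c - \<epsilon> < b (T + L)" using c_le[of "T + L"] T L \<epsilon> by simp
    then obtain t' B where t': "t' \<ge> T + L" and B: "B \<in> S" and wB: "c - \<epsilon> < \<bar>w t' B\<bar>"
      using ex_w[of "T + L"] T L by fastforce
    define \<sigma> where "\<sigma> = (if w t' B \<ge> 0 then 1 else -1 :: real)"
    have \<sigma>w: "\<sigma> * w t' B = \<bar>w t' B\<bar>" and \<sigma>_le: "\<And>r q. \<bar>r\<bar> \<le> q \<Longrightarrow> \<sigma> * r \<le> q" by (auto simp: \<sigma>_def)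
    define D where "D t = c + \<epsilon> - \<sigma> * w t B" for t
    have wT: "\<sigma> * w t B' \<le> c + \<epsilon>" if "t \<ge> T" "B' \<in> S" for t B'
      using w_le_b[OF T(1) that] T(2) by (intro \<sigma>_le) simp
    have half: "\<sigma> * w t B \<ge> c / 2" if t: "t' - L \<le> t" "t \<le> t'" for t
    proof -
      \<comment> \<open>The gap \<open>D\<close> satisfies \<open>D' \<ge> - N * D\<close>.\<close>
      have "exp (N * t) * D t \<le> exp (N * t') * D t'"
      proof (rule DERIV_nonneg_imp_nondecreasing[OF t(2)])
        fix r assume r: "t \<le> r" "r \<le> t'"
        then have rT: "r \<ge> T" using t t' by simp
        let ?d = "N * exp (N * r) * D r + exp (N * r) * (- (\<sigma> * dual_gen (w r) B))"
        have "((\<lambda>t. exp (N * t) * D t) has_real_derivative ?d) (at r)"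
          unfolding D_def using w_deriv[OF _ B, of r] rT T
          by (auto intro!: derivative_eq_intros)
        moreover have "\<sigma> * dual_gen (w r) B \<le> N * D r"
        proof -
          have "\<sigma> * dual_gen (w r) B = (\<Sum>x\<in>B. \<sigma> * (signed_avg (\<lambda>y. w r (sym_diff B {x, y})) x - w r B))"
            by (simp add: dual_gen_def sum_distrib_left)
          also have "\<dots> \<le> (\<Sum>x\<in>B. D r)"
          proof (rule sum_mono)
            fix x assume x: "x \<in> B"
            have "\<bar>signed_avg (\<lambda>y. w r (sym_diff B {x, y})) x\<bar> \<le> b T"
              using x B by (intro signed_avg_bound w_le_b T rT S_step) (auto simp: S_def)
            then have "\<sigma> * signed_avg (\<lambda>y. w r (sym_diff B {x, y})) x \<le> c + \<epsilon>"
              using T(2) by (intro \<sigma>_le) simp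
            then show "\<sigma> * (signed_avg (\<lambda>y. w r (sym_diff B {x, y})) x - w r B) \<le> D r"
              by (simp add: D_def right_diff_distrib)
          qed
          also have "\<dots> \<le> N * D r"
            using B wT[OF rT B] by (simp add: S_def N_def D_def mult_right_mono)
          finally show ?thesis .
        qed
        then have "0 \<le> exp (N * r) * (N * D r - \<sigma> * dual_gen (w r) B)" by simp
        then have "0 \<le> ?d" by (simp add: algebra_simps)
        ultimately show "\<exists>d. ((\<lambda>t. exp (N * t) * D t) has_real_derivative d) (at r) \<and> 0 \<le> d" by blast
      qed
      then have "D t \<le> exp (N * t') * D t' / exp (N * t)" by (simp add: pos_le_divide_eq mult.commute)
      also have "\<dots> = exp (N * (t' - t)) * D t'" by (simp add: exp_diff right_diff_distrib)
      also have "\<dots> \<le> exp (N * L) * (2 * \<epsilon>)"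
      proof (rule mult_mono)
        show "exp (N * (t' - t)) \<le> exp (N * L)" using t by (simp add: N_def mult_left_mono)
        show "D t' \<le> 2 * \<epsilon>" using wB \<sigma>w by (simp add: D_def)
        show "0 \<le> D t'" using wT[OF _ B, of t'] t' L by (simp add: D_def)
      qed simp
      also have "\<dots> = c / 2" by (simp add: \<epsilon>_def)
      finally show ?thesis using \<epsilon> by (simp add: D_def)
    qed
    have "\<exists>z. t' - L < z \<and> z < t' \<and> H t' B - H (t' - L) B = (t' - (t' - L)) * w z B"
      using L T t' B by (intro MVT2 H_deriv) auto
    then obtain z where z: "t' - L < z" "z < t'" "H t' B - H (t' - L) B = L * w z B" by auto
    have "\<sigma> * (H t' B - H (t' - L) B) = L * (\<sigma> * w z B)" by (simp add: z(3))
    also have "\<dots> \<ge> L * (c / 2)" using half[of z] z L by (intro mult_left_mono) auto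
    finally have "\<sigma> * (H t' B - H (t' - L) B) \<ge> 5 / 2" using c by (simp add: L_def)
    moreover have "\<sigma> * (H t' B - H (t' - L) B) \<le> 2"
    proof (rule \<sigma>_le)
      have "t' > 0" "t' - L > 0" using T t' L by simp_all
      from H_bd[OF this(1) B] H_bd[OF this(2) B] show "\<bar>H t' B - H (t' - L) B\<bar> \<le> 2" by linarith
    qed
    ultimately show False by simp
  qed
  show ?thesis
  proof (rule tendstoI)
    fix e :: real assume "e > 0"
    then have "c < e" using c_le0 by simp
    then obtain T where T: "T \<ge> 1" "b T < e" using ex_T by blast
    then have "\<bar>w t A\<bar> < e" if "t \<ge> T" for t using w_le_b[OF T(1) that AS] by simp
    then show "\<forall>\<^sub>F t in at_top. dist (dual_gen (H t) A) 0 < e"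
      unfolding eventually_at_top_linorder by (auto simp: w_def intro!: exI[of _ T])
  qed
qed

end

section \<open>Continuous observables of configurations\<close>

lemma space_config: "space (config_space V) = (\<Pi>\<^sub>E x\<in>V. {-1, 1})"
  by (simp add: config_space_def space_PiM)

lemma topspace_config: "topspace (config_topology V) = space (config_space V)"
  by (simp add: config_topology_def space_config)

lemma compact_config: "compact_space (config_topology V)"
  unfolding config_topology_def by (simp add: compact_space_product_topology compact_space_discrete_topology)

lemma config_nonempty: "space (config_space V) \<noteq> {}"
  by (simp add: space_config PiE_eq_empty_iff)

definition cyl :: "'v set \<Rightarrow> 'v set \<Rightarrow> ('v \<Rightarrow> int) \<Rightarrow> ('v \<Rightarrow> int) set" where
  "cyl V A \<xi> = {\<eta> \<in> space (config_space V). \<forall>x\<in>A. \<eta> x = \<xi> x}"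

lemma cyl_openin:
  assumes "finite A" "A \<subseteq> V"
  shows "openin (config_topology V) (cyl V A \<xi>)"
proof -
  have "openin (config_topology V) {\<eta> \<in> topspace (config_topology V). \<eta> x \<in> {\<xi> x} \<inter> {-1, 1}}" if "x \<in> A" for x
    unfolding config_topology_def
    using that assms(2)
    by (intro openin_continuous_map_preimage[where Y = "discrete_topology {-1, 1}"]
        continuous_map_product_coordinates) auto
  then have "openin (config_topology V)
      (topspace (config_topology V) \<inter> (\<Inter>x\<in>A. {\<eta> \<in> topspace (config_topology V). \<eta> x \<in> {\<xi> x} \<inter> {-1, 1}}))"
    using assms(1) by (cases "A = {}") (auto intro!: openin_Int openin_INT)
  also have "topspace (config_topology V) \<inter> (\<Inter>x\<in>A. {\<eta> \<in> topspace (config_topology V). \<eta> x \<in> {\<xi> x} \<inter> {-1, 1}}) = cyl V A \<xi>"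
    using assms by (fastforce simp: topspace_config cyl_def space_config PiE_iff)
  finally show ?thesis .
qed

definition spin_product :: "'v set \<Rightarrow> ('v \<Rightarrow> int) \<Rightarrow> real" where
  "spin_product A \<eta> = real_of_int (\<Prod>x\<in>A. \<eta> x)"

lemma continuous_spin_product:
  assumes "finite A" "A \<subseteq> V"
  shows "continuous_observable V (spin_product A)"
proof -
  have "continuous_map (config_topology V) euclideanreal (\<lambda>\<eta>. real_of_int (\<eta> x))" if "x \<in> V" for x
  proof -
    have "continuous_map (config_topology V) (discrete_topology {-1, 1}) (\<lambda>\<eta>. \<eta> x)"
      unfolding config_topology_def using that by (rule continuous_map_product_coordinates)
    moreover have "continuous_map (discrete_topology {-1, 1}) euclideanreal real_of_int" by simp
    ultimately show ?thesis by (rule continuous_map_compose[unfolded o_def])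
  qed
  then have "continuous_map (config_topology V) euclideanreal (\<lambda>\<eta>. \<Prod>x\<in>A. real_of_int (\<eta> x))"
    using assms by (intro continuous_map_prod) auto
  then show ?thesis by (simp add: continuous_observable_def spin_product_def[abs_def])
qed

lemma abs_spin_product:
  assumes "\<eta> \<in> space (config_space V)" "A \<subseteq> V"
  shows "\<bar>spin_product A \<eta>\<bar> = 1"
proof -
  have "\<bar>real_of_int (\<eta> x)\<bar> = 1" if "x \<in> A" for x
    using assms that by (fastforce simp: space_config PiE_iff)
  then have "(\<Prod>x\<in>A. \<bar>real_of_int (\<eta> x)\<bar>) = 1" by simp
  then show ?thesis unfolding spin_product_def by (simp add: abs_prod)
qed

text \<open>
  Uniform continuity on the compact configuration space: finitely many cylinders, on each of
  which \<open>f\<close> oscillates little, cover the space, and \<open>A\<close> collects their finitely many sites.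
\<close>

lemma finite_dependence:
  assumes f: "continuous_observable V f" and e: "e > 0"
  shows "\<exists>A. finite A \<and> A \<subseteq> V \<and> (\<forall>\<eta>\<in>space (config_space V). \<forall>\<zeta>\<in>space (config_space V).
           (\<forall>x\<in>A. \<eta> x = \<zeta> x) \<longrightarrow> \<bar>f \<eta> - f \<zeta>\<bar> < e)"
proof -
  let ?\<Omega> = "space (config_space V)"
  have "\<exists>B. finite B \<and> B \<subseteq> V \<and> (\<forall>\<zeta>\<in>cyl V B \<eta>. \<bar>f \<zeta> - f \<eta>\<bar> < e / 2)" if \<eta>: "\<eta> \<in> ?\<Omega>" for \<eta>
  proof -
    define S where "S = {\<zeta> \<in> topspace (config_topology V). f \<zeta> \<in> ball (f \<eta>) (e / 2)}"
    have "openin (config_topology V) S"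
      unfolding S_def using f by (intro openin_continuous_map_preimage[where Y = euclideanreal])
        (auto simp: continuous_observable_def)
    then have "openin (product_topology (\<lambda>_. discrete_topology {-1, 1}) V) S"
      by (simp add: config_topology_def)
    moreover have "\<eta> \<in> S" using \<eta> e by (simp add: S_def topspace_config)
    ultimately have "\<exists>U. finite {x \<in> V. U x \<noteq> topspace (discrete_topology {-1, 1 :: int})} \<and>
        (\<forall>x\<in>V. openin (discrete_topology {-1, 1}) (U x)) \<and> \<eta> \<in> PiE V U \<and> PiE V U \<subseteq> S"
      by (rule openin_product_topology_alt[THEN iffD1, rule_format])
    then obtain U where fin: "finite {x \<in> V. U x \<noteq> topspace (discrete_topology {-1, 1 :: int})}"
      and \<eta>U: "\<eta> \<in> PiE V U" and sub: "PiE V U \<subseteq> S"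
      by (elim exE conjE)
    let ?B = "{x \<in> V. U x \<noteq> topspace (discrete_topology {-1, 1 :: int})}"
    have "\<zeta> \<in> PiE V U" if "\<zeta> \<in> cyl V ?B \<eta>" for \<zeta>
    proof (rule PiE_I)
      fix x assume x: "x \<in> V"
      show "\<zeta> x \<in> U x"
      proof (cases "x \<in> ?B")
        case True then show ?thesis using that \<eta>U x by (auto simp: cyl_def PiE_iff)
      next
        case False then show ?thesis using that x by (auto simp: cyl_def space_config PiE_iff)
      qed
    next
      fix x assume "x \<notin> V"
      then show "\<zeta> x = undefined" using that by (auto simp: cyl_def space_config PiE_iff extensional_def)
    qed
    then have "\<forall>\<zeta>\<in>cyl V ?B \<eta>. \<bar>f \<zeta> - f \<eta>\<bar> < e / 2"
      using sub by (force simp: S_def dist_real_def abs_minus_commute)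
    then show ?thesis using fin by blast
  qed
  then obtain B where B: "\<And>\<eta>. \<eta> \<in> ?\<Omega> \<Longrightarrow> finite (B \<eta>)" "\<And>\<eta>. \<eta> \<in> ?\<Omega> \<Longrightarrow> B \<eta> \<subseteq> V"
    "\<And>\<eta> \<zeta>. \<eta> \<in> ?\<Omega> \<Longrightarrow> \<zeta> \<in> cyl V (B \<eta>) \<eta> \<Longrightarrow> \<bar>f \<zeta> - f \<eta>\<bar> < e / 2" by metis
  have "\<exists>\<F>. finite \<F> \<and> \<F> \<subseteq> (\<lambda>\<eta>. cyl V (B \<eta>) \<eta>) ` ?\<Omega> \<and> ?\<Omega> \<subseteq> \<Union>\<F>"
    using compact_config[of V] unfolding compact_space_alt topspace_config
  proof (elim allE impE)
    show "(\<forall>U\<in>(\<lambda>\<eta>. cyl V (B \<eta>) \<eta>) ` ?\<Omega>. openin (config_topology V) U) \<and> ?\<Omega> \<subseteq> \<Union>((\<lambda>\<eta>. cyl V (B \<eta>) \<eta>) ` ?\<Omega>)"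
      using B by (auto simp: cyl_def intro: cyl_openin[unfolded cyl_def])
  qed
  then obtain \<F> where \<F>: "finite \<F>" "\<F> \<subseteq> (\<lambda>\<eta>. cyl V (B \<eta>) \<eta>) ` ?\<Omega>" "?\<Omega> \<subseteq> \<Union>\<F>" by blast
  obtain F where "F \<subseteq> ?\<Omega>" "finite F" "\<F> = (\<lambda>\<eta>. cyl V (B \<eta>) \<eta>) ` F"
    using finite_subset_image[OF \<F>(1,2)] by blast
  then have F: "finite F" "F \<subseteq> ?\<Omega>" "?\<Omega> \<subseteq> (\<Union>\<eta>\<in>F. cyl V (B \<eta>) \<eta>)"
    using \<F>(3) by simp_all
  show ?thesis
  proof (intro exI[of _ "\<Union>\<eta>\<in>F. B \<eta>"] conjI ballI impI)
    fix \<eta> \<zeta> assume \<eta>: "\<eta> \<in> ?\<Omega>" and \<zeta>: "\<zeta> \<in> ?\<Omega>" and eq: "\<forall>x\<in>\<Union>\<eta>\<in>F. B \<eta>. \<eta> x = \<zeta> x"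
    obtain \<xi> where \<xi>: "\<xi> \<in> F" "\<eta> \<in> cyl V (B \<xi>) \<xi>" using F(3) \<eta> by blast
    then have "\<zeta> \<in> cyl V (B \<xi>) \<xi>" using eq \<zeta> by (auto simp: cyl_def)
    then have "\<bar>f \<eta> - f \<xi>\<bar> < e / 2" "\<bar>f \<zeta> - f \<xi>\<bar> < e / 2" using B(3) \<xi> F(2) by blast+
    then show "\<bar>f \<eta> - f \<zeta>\<bar> < e" by linarith
  next
    show "finite (\<Union>\<eta>\<in>F. B \<eta>)" using F(1,2) B(1) by blast
    show "(\<Union>\<eta>\<in>F. B \<eta>) \<subseteq> V" using F(2) B(2) by blast
  qed
qed

text \<open>
  Keeps the spins on \<open>A\<close> and sets all others to 1, so that composition with \<open>pad V A\<close> turns any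
  observable into one that depends on \<open>A\<close> only.
\<close>

definition pad :: "'v set \<Rightarrow> 'v set \<Rightarrow> ('v \<Rightarrow> int) \<Rightarrow> 'v \<Rightarrow> int" where
  "pad V A \<xi> = (\<lambda>x\<in>V. if x \<in> A then \<xi> x else 1)"

lemma pad_config: "\<forall>x\<in>A. \<xi> x \<in> {-1, 1} \<Longrightarrow> pad V A \<xi> \<in> space (config_space V)"
  by (auto simp: pad_def space_config)

lemma pad_eq: "x \<in> A \<Longrightarrow> A \<subseteq> V \<Longrightarrow> pad V A \<xi> x = \<xi> x"
  by (auto simp: pad_def)

lemma config_values: "\<eta> \<in> space (config_space V) \<Longrightarrow> A \<subseteq> V \<Longrightarrow> \<forall>x\<in>A. \<eta> x \<in> {-1, 1}"
  unfolding space_config by (blast dest: PiE_mem)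

text \<open>
  Walsh expansion on the cube \<open>{-1, 1}\<close> to the power \<open>A\<close>: the indicator of agreement with \<open>\<xi>\<close> on
  \<open>A\<close> is the product of the factors \<open>(1 + \<xi> x * \<eta> x) / 2\<close>, and multiplying out gives spin products.
\<close>

lemma cylinder_expansion:
  assumes A: "finite A" "A \<subseteq> V"
    and dep: "\<And>\<eta> \<zeta>. \<eta> \<in> space (config_space V) \<Longrightarrow> \<zeta> \<in> space (config_space V) \<Longrightarrow> \<forall>x\<in>A. \<eta> x = \<zeta> x \<Longrightarrow> f \<eta> = (f \<zeta> :: real)"
  shows "\<exists>c. \<forall>\<eta>\<in>space (config_space V). f \<eta> = (\<Sum>B\<in>Pow A. c B * spin_product B \<eta>)"
proof -
  let ?\<Xi> = "PiE A (\<lambda>_. {-1, 1 :: int})"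
  have fin: "finite ?\<Xi>" using A by (intro finite_PiE) auto
  have "f \<eta> = (\<Sum>B\<in>Pow A. (\<Sum>\<xi>\<in>?\<Xi>. f (pad V A \<xi>) * spin_product B \<xi> / 2 ^ card A) * spin_product B \<eta>)"
    if \<eta>: "\<eta> \<in> space (config_space V)" for \<eta>
  proof -
    have vals: "\<forall>x\<in>A. \<eta> x \<in> {-1, 1}" using config_values[OF \<eta> A(2)] .
    have r: "restrict \<eta> A \<in> ?\<Xi>" using vals by auto
    have ind: "(\<Prod>x\<in>A. (1 + real_of_int (\<xi> x * \<eta> x)) / 2) = of_bool (\<xi> = restrict \<eta> A)" if \<xi>: "\<xi> \<in> ?\<Xi>" for \<xi>
    proof (cases "\<xi> = restrict \<eta> A")
      case True
      then show ?thesis using vals by (auto intro!: prod.neutral)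
    next
      case False
      then obtain x where x: "x \<in> A" "\<xi> x \<noteq> \<eta> x"
        using \<xi> by (metis PiE_restrict restrict_ext)
      moreover have "\<xi> x \<in> {-1, 1}" using \<xi> x(1) by (rule PiE_mem)
      ultimately have "(1 + real_of_int (\<xi> x * \<eta> x)) / 2 = 0" using vals by auto
      then have "\<exists>x\<in>A. (1 + real_of_int (\<xi> x * \<eta> x)) / 2 = 0" using x(1) by (rule bexI)
      then have "(\<Prod>x\<in>A. (1 + real_of_int (\<xi> x * \<eta> x)) / 2) = 0" by (rule prod_zero[OF A(1)])
      then show ?thesis using False by simp
    qed
    have expand: "(\<Prod>x\<in>A. (1 + real_of_int (\<xi> x * \<eta> x)) / 2)
        = (\<Sum>B\<in>Pow A. spin_product B \<xi> * spin_product B \<eta>) / 2 ^ card A" for \<xi>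
    proof -
      have "(\<Prod>x\<in>A. real_of_int (\<xi> x * \<eta> x) + 1)
          = (\<Sum>B\<in>Pow A. (\<Prod>x\<in>B. real_of_int (\<xi> x * \<eta> x)) * (\<Prod>x\<in>A-B. 1))"
        by (rule prod_add) (rule A(1))
      then have "(\<Prod>x\<in>A. real_of_int (\<xi> x * \<eta> x) + 1) = (\<Sum>B\<in>Pow A. spin_product B \<xi> * spin_product B \<eta>)"
        by (simp add: spin_product_def prod.distrib)
      then show ?thesis by (simp add: prod_dividef add.commute)
    qed
    have "f \<eta> = f (pad V A (restrict \<eta> A))"
      using vals \<eta> A by (intro dep pad_config) (auto simp: pad_eq)
    also have "\<dots> = (\<Sum>\<xi>\<in>?\<Xi>. f (pad V A \<xi>) * of_bool (\<xi> = restrict \<eta> A))"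
      using fin r by (simp add: of_bool_def if_distrib[of "(*) _"] cong: if_cong)
    also have "\<dots> = (\<Sum>\<xi>\<in>?\<Xi>. f (pad V A \<xi>) * ((\<Sum>B\<in>Pow A. spin_product B \<xi> * spin_product B \<eta>) / 2 ^ card A))"
      by (intro sum.cong refl) (simp only: ind[symmetric] expand)
    also have "\<dots> = (\<Sum>B\<in>Pow A. (\<Sum>\<xi>\<in>?\<Xi>. f (pad V A \<xi>) * spin_product B \<xi> / 2 ^ card A) * spin_product B \<eta>)"
      unfolding sum_divide_distrib sum_distrib_left sum_distrib_right
      by (subst sum.swap) (simp add: ac_simps)
    finally show ?thesis .
  qed
  then have "\<forall>\<eta>\<in>space (config_space V). f \<eta> = (\<Sum>B\<in>Pow A. (\<Sum>\<xi>\<in>?\<Xi>. f (pad V A \<xi>) * spin_product B \<xi> / 2 ^ card A) * spin_product B \<eta>)" ..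
  then show ?thesis by (rule exI[where x = "\<lambda>B. \<Sum>\<xi>\<in>?\<Xi>. f (pad V A \<xi>) * spin_product B \<xi> / 2 ^ card A"])
qed

lemma continuous_spin_sum:
  "finite A \<Longrightarrow> A \<subseteq> V \<Longrightarrow> continuous_observable V (\<lambda>\<eta>. \<Sum>B\<in>Pow A. c B * spin_product B \<eta>)"
  unfolding continuous_observable_def
  by (intro continuous_map_sum continuous_map_real_mult_left continuous_spin_product[unfolded continuous_observable_def])
    (auto dest: finite_subset)

lemma continuous_observable_cong:
  "(\<And>\<eta>. \<eta> \<in> space (config_space V) \<Longrightarrow> f \<eta> = g \<eta>) \<Longrightarrow> continuous_observable V f \<longleftrightarrow> continuous_observable V g"
  unfolding continuous_observable_def
  by (metis continuous_map_eq topspace_config)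

lemma continuous_cylinder:
  assumes "cylinder V f"
  shows "continuous_observable V f"
proof -
  obtain A where A: "finite A" "A \<subseteq> V" "\<And>\<eta> \<zeta>. \<eta> \<in> space (config_space V) \<Longrightarrow> \<zeta> \<in> space (config_space V) \<Longrightarrow> \<forall>x\<in>A. \<eta> x = \<zeta> x \<Longrightarrow> f \<eta> = f \<zeta>"
    using assms unfolding cylinder_def by blast
  obtain c where c: "\<forall>\<eta>\<in>space (config_space V). f \<eta> = (\<Sum>B\<in>Pow A. c B * spin_product B \<eta>)"
    using cylinder_expansion[of A V f, OF A] by blast
  show ?thesis
    using continuous_spin_sum[OF A(1,2), of c] c by (subst continuous_observable_cong[of V f]) auto
qed

text \<open>
  Density of the linear span of the spin products among the continuous observables: \<open>f\<close> is close to
  \<open>f \<circ> pad V A\<close> for a suitable \<open>A\<close>, and this function has a Walsh expansion.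
\<close>

lemma spin_sum_approximation:
  assumes f: "continuous_observable V f" and e: "e > 0"
  shows "\<exists>A c. finite A \<and> A \<subseteq> V \<and>
    (\<forall>\<eta>\<in>space (config_space V). \<bar>f \<eta> - (\<Sum>B\<in>Pow A. c B * spin_product B \<eta>)\<bar> < e)"
proof -
  obtain A where A: "finite A" "A \<subseteq> V"
    and dep: "\<And>\<eta> \<zeta>. \<eta> \<in> space (config_space V) \<Longrightarrow> \<zeta> \<in> space (config_space V) \<Longrightarrow> \<forall>x\<in>A. \<eta> x = \<zeta> x \<Longrightarrow> \<bar>f \<eta> - f \<zeta>\<bar> < e"
    using finite_dependence[OF f e] by blast
  have "\<exists>c. \<forall>\<eta>\<in>space (config_space V). f (pad V A \<eta>) = (\<Sum>B\<in>Pow A. c B * spin_product B \<eta>)"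
  proof (rule cylinder_expansion[OF A])
    fix \<eta> \<zeta> :: "'a \<Rightarrow> int" assume "\<forall>x\<in>A. \<eta> x = \<zeta> x"
    then have "pad V A \<eta> = pad V A \<zeta>" by (auto simp: pad_def)
    then show "f (pad V A \<eta>) = f (pad V A \<zeta>)" by simp
  qed
  then obtain c where c: "\<And>\<eta>. \<eta> \<in> space (config_space V) \<Longrightarrow> f (pad V A \<eta>) = (\<Sum>B\<in>Pow A. c B * spin_product B \<eta>)" by blast
  have "\<bar>f \<eta> - f (pad V A \<eta>)\<bar> < e" if "\<eta> \<in> space (config_space V)" for \<eta>
    using that by (intro dep pad_config config_values[OF that A(2)]) (auto simp: pad_eq A)
  then show ?thesis using A c by (intro exI[of _ A] exI[of _ c]) auto
qed

lemma measurable_spin_product: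
  assumes "finite A" "A \<subseteq> V"
  shows "spin_product A \<in> borel_measurable (config_space V)"
proof -
  have "(\<lambda>\<eta>. real_of_int (\<eta> x)) \<in> borel_measurable (config_space V)" if "x \<in> A" for x
  proof -
    have "(\<lambda>\<eta>. \<eta> x) \<in> config_space V \<rightarrow>\<^sub>M count_space {-1, 1}"
      unfolding config_space_def using that assms by (intro measurable_component_singleton) auto
    then show ?thesis by (rule measurable_compose) simp
  qed
  then have "(\<lambda>\<eta>. \<Prod>x\<in>A. real_of_int (\<eta> x)) \<in> borel_measurable (config_space V)" by measurable
  then show ?thesis by (simp add: spin_product_def[abs_def])
qed

lemma measurable_continuous_observable:
  assumes f: "continuous_observable V f"
  shows "f \<in> borel_measurable (config_space V)"
proof -
  have "\<exists>g. g \<in> borel_measurable (config_space V) \<and> (\<forall>\<eta>\<in>space (config_space V). \<bar>f \<eta> - g \<eta>\<bar> < 1 / real (Suc n))" for n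
  proof -
    obtain A c where "finite A" "A \<subseteq> V"
      "\<forall>\<eta>\<in>space (config_space V). \<bar>f \<eta> - (\<Sum>B\<in>Pow A. c B * spin_product B \<eta>)\<bar> < 1 / real (Suc n)"
      using spin_sum_approximation[OF f, of "1 / real (Suc n)"] by auto
    moreover from this have "(\<lambda>\<eta>. \<Sum>B\<in>Pow A. c B * spin_product B \<eta>) \<in> borel_measurable (config_space V)"
      by (intro borel_measurable_sum borel_measurable_times measurable_spin_product) (auto dest: finite_subset)
    ultimately show ?thesis by blast
  qed
  then obtain g where g: "\<And>n. g n \<in> borel_measurable (config_space V)"
    "\<And>n \<eta>. \<eta> \<in> space (config_space V) \<Longrightarrow> \<bar>f \<eta> - g n \<eta>\<bar> < 1 / real (Suc n)" by metis
  show ?thesis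
  proof (rule borel_measurable_LIMSEQ_real[OF _ g(1)])
    fix \<eta> assume \<eta>: "\<eta> \<in> space (config_space V)"
    have "(\<lambda>n. g n \<eta> - f \<eta>) \<longlonglongrightarrow> 0"
    proof (rule Lim_null_comparison)
      show "\<forall>\<^sub>F n in sequentially. norm (g n \<eta> - f \<eta>) \<le> 1 / real (Suc n)"
        using g(2)[OF \<eta>] by (intro always_eventually) (auto simp: abs_minus_commute intro: less_imp_le)
      show "(\<lambda>n. 1 / real (Suc n)) \<longlonglongrightarrow> 0" by real_asymp
    qed
    then show "(\<lambda>n. g n \<eta>) \<longlonglongrightarrow> f \<eta>" by (simp add: LIM_zero_iff)
  qed
qed

lemma bounded_continuous_observable:
  assumes f: "continuous_observable V f"
  obtains C where "\<And>\<eta>. \<eta> \<in> space (config_space V) \<Longrightarrow> \<bar>f \<eta>\<bar> \<le> C"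
proof -
  obtain A c where A: "finite A" "A \<subseteq> V"
    and c: "\<And>\<eta>. \<eta> \<in> space (config_space V) \<Longrightarrow> \<bar>f \<eta> - (\<Sum>B\<in>Pow A. c B * spin_product B \<eta>)\<bar> < 1"
    using spin_sum_approximation[OF f, of 1] by auto
  have "\<bar>f \<eta>\<bar> \<le> 1 + (\<Sum>B\<in>Pow A. \<bar>c B\<bar>)" if \<eta>: "\<eta> \<in> space (config_space V)" for \<eta>
  proof -
    have "\<bar>\<Sum>B\<in>Pow A. c B * spin_product B \<eta>\<bar> \<le> (\<Sum>B\<in>Pow A. \<bar>c B * spin_product B \<eta>\<bar>)" by (rule sum_abs)
    also have "\<dots> = (\<Sum>B\<in>Pow A. \<bar>c B\<bar>)"
      using A abs_spin_product[OF \<eta>] by (intro sum.cong) (auto simp: abs_mult)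
    finally show ?thesis using c[OF \<eta>] by linarith
  qed
  then show ?thesis using that by blast
qed

definition law :: "'v set \<Rightarrow> ('v \<Rightarrow> int) measure \<Rightarrow> bool" where
  "law V N \<longleftrightarrow> N \<in> space (prob_algebra (config_space V))"

lemma lawD:
  assumes "law V N"
  shows "prob_space N" "sets N = sets (config_space V)" "space N = space (config_space V)"
  using assms by (auto simp: law_def space_prob_algebra dest: sets_eq_imp_space_eq)

lemma integrable_observable:
  assumes "law V N" "continuous_observable V f"
  shows "integrable N f"
proof -
  interpret prob_space N using lawD[OF assms(1)] by simp
  obtain C where C: "\<And>\<eta>. \<eta> \<in> space (config_space V) \<Longrightarrow> \<bar>f \<eta>\<bar> \<le> C"
    using bounded_continuous_observable[OF assms(2)] by blast
  show ?thesis
  proof (rule integrable_const_bound)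
    show "AE \<eta> in N. norm (f \<eta>) \<le> C" using C lawD(3)[OF assms(1)] by (intro AE_I2) auto
    show "f \<in> borel_measurable N"
      using measurable_continuous_observable[OF assms(2)] lawD(2)[OF assms(1)] measurable_cong_sets by blast
  qed
qed

lemma integral_bound:
  assumes N: "law V N" and f: "continuous_observable V f"
    and C: "\<And>\<eta>. \<eta> \<in> space (config_space V) \<Longrightarrow> \<bar>f \<eta>\<bar> \<le> C"
  shows "\<bar>\<integral>\<eta>. f \<eta> \<partial>N\<bar> \<le> C"
proof -
  interpret prob_space N using lawD[OF N] by simp
  have "\<bar>\<integral>\<eta>. f \<eta> \<partial>N\<bar> \<le> (\<integral>\<eta>. \<bar>f \<eta>\<bar> \<partial>N)" by (rule integral_abs_bound)
  also have "\<dots> \<le> (\<integral>\<eta>. C \<partial>N)"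
    using integrable_observable[OF N f] C lawD(3)[OF N] by (intro integral_mono) auto
  also have "\<dots> = C" by (simp add: prob_space)
  finally show ?thesis .
qed

lemma continuous_observable_diff:
  "continuous_observable V f \<Longrightarrow> continuous_observable V g \<Longrightarrow> continuous_observable V (\<lambda>\<eta>. f \<eta> - g \<eta>)"
  unfolding continuous_observable_def by (rule continuous_map_diff)

lemma integral_close:
  assumes N: "law V N" and f: "continuous_observable V f" and g: "continuous_observable V g"
    and e: "\<And>\<eta>. \<eta> \<in> space (config_space V) \<Longrightarrow> \<bar>f \<eta> - g \<eta>\<bar> \<le> e"
  shows "\<bar>(\<integral>\<eta>. f \<eta> \<partial>N) - (\<integral>\<eta>. g \<eta> \<partial>N)\<bar> \<le> e"
  using integral_bound[OF N continuous_observable_diff[OF f g] e] integrable_observable[OF N f]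
    integrable_observable[OF N g] by simp

lemma cylinder_emb:
  assumes "finite J" "J \<subseteq> V"
  shows "cylinder V (indicator (prod_emb V (\<lambda>_. count_space {-1, 1}) J X))"
  unfolding cylinder_def
proof (intro exI[of _ J] conjI ballI impI assms)
  fix \<eta> \<zeta> :: "'a \<Rightarrow> int" assume "\<eta> \<in> space (config_space V)" "\<zeta> \<in> space (config_space V)" "\<forall>x\<in>J. \<eta> x = \<zeta> x"
  moreover from this have "restrict \<eta> J = restrict \<zeta> J" by (auto simp: restrict_def)
  ultimately show "(indicator (prod_emb V (\<lambda>_. count_space {-1, 1}) J X) \<eta> :: real)
      = indicator (prod_emb V (\<lambda>_. count_space {-1, 1}) J X) \<zeta>"
    by (simp add: indicator_def prod_emb_def space_config)
qed

lemma emb_measurable: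
  assumes "finite J" "J \<subseteq> V" "X \<subseteq> PiE J (\<lambda>_. {-1, 1})"
  shows "prod_emb V (\<lambda>_. count_space {-1, 1 :: int}) J X \<in> sets (config_space V)"
  unfolding config_space_def using assms
  by (intro measurable_prod_emb) (auto simp: count_space_PiM_finite)

text \<open>
  Indicators of cylinders are continuous observables, and cylinders generate the measurable sets.
\<close>

lemma law_eqI:
  assumes N: "law V N" and N': "law V N'"
    and eq: "\<And>f. continuous_observable V f \<Longrightarrow> (\<integral>\<eta>. f \<eta> \<partial>N) = (\<integral>\<eta>. f \<eta> \<partial>N')"
  shows "N = N'"
proof (rule measure_eqI_PiM_infinite[where I = V and M = "\<lambda>_. count_space {-1, 1}"])
  interpret N: prob_space N using lawD[OF N] by simp
  interpret N': prob_space N' using lawD[OF N'] by simp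
  show "sets N = sets (PiM V (\<lambda>_. count_space {-1, 1}))" "sets N' = sets (PiM V (\<lambda>_. count_space {-1, 1}))"
    using lawD(2)[OF N] lawD(2)[OF N'] by (simp_all add: config_space_def)
  show "finite_measure N" by (rule N.finite_measure_axioms)
  fix A J assume J: "finite J" "J \<subseteq> V" and A: "\<And>i. i \<in> J \<Longrightarrow> A i \<in> sets (count_space {-1, 1 :: int})"
  let ?X = "prod_emb V (\<lambda>_. count_space {-1, 1}) J (PiE J A)"
  have X: "?X \<in> sets (config_space V)" using A J by (intro emb_measurable) (auto simp: PiE_iff)
  have "(\<integral>\<eta>. indicator ?X \<eta> \<partial>N) = (\<integral>\<eta>. indicator ?X \<eta> \<partial>N' :: real)"
    by (intro eq continuous_cylinder cylinder_emb J)
  then have "measure N ?X = measure N' ?X" using X lawD[OF N] lawD[OF N'] by simp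
  then show "emeasure N ?X = emeasure N' ?X" by (simp add: N.emeasure_eq_measure N'.emeasure_eq_measure)
qed

lemma integral_spin_sum:
  assumes "law V N" "finite A" "A \<subseteq> V"
  shows "(\<integral>\<eta>. (\<Sum>B\<in>Pow A. c B * spin_product B \<eta>) \<partial>N) = (\<Sum>B\<in>Pow A. c B * (\<integral>\<eta>. spin_product B \<eta> \<partial>N))"
proof -
  have "integrable N (spin_product B)" if "B \<in> Pow A" for B
    using that assms by (intro integrable_observable[OF assms(1)] continuous_spin_product) (auto dest: finite_subset)
  then show ?thesis by (subst Bochner_Integration.integral_sum) auto
qed

section \<open>Limits of laws on the configuration space\<close>

lemma prob_emb_eq_sum:
  assumes N: "law V N" and J: "finite J" "J \<subseteq> V" and X: "X \<subseteq> PiE J (\<lambda>_. {-1, 1})"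
  shows "measure N (prod_emb V (\<lambda>_. count_space {-1, 1}) J X)
    = (\<Sum>\<xi>\<in>X. measure N (prod_emb V (\<lambda>_. count_space {-1, 1}) J {\<xi>}))"
proof -
  interpret prob_space N using lawD[OF N] by simp
  let ?e = "prod_emb V (\<lambda>_. count_space {-1, 1 :: int}) J"
  have fin: "finite X" using J by (intro finite_subset[OF X] finite_PiE) auto
  have "?e X = (\<Union>\<xi>\<in>X. ?e {\<xi>})" by (auto simp: prod_emb_def)
  moreover have "disjoint_family_on (\<lambda>\<xi>. ?e {\<xi>}) X" by (auto simp: disjoint_family_on_def prod_emb_def)
  moreover have "(\<lambda>\<xi>. ?e {\<xi>}) ` X \<subseteq> sets N"
    using X emb_measurable[OF J, of "{_}"] lawD(2)[OF N] by auto
  ultimately show ?thesis using finite_measure_finite_Union[OF fin] by metis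
qed

lemma integral_cylinder:
  assumes N: "law V N" and A: "finite A" "A \<subseteq> V"
    and dep: "\<And>\<eta> \<zeta>. \<eta> \<in> space (config_space V) \<Longrightarrow> \<zeta> \<in> space (config_space V) \<Longrightarrow>
      \<forall>x\<in>A. \<eta> x = \<zeta> x \<Longrightarrow> f \<eta> = (f \<zeta> :: real)"
  shows "(\<integral>\<eta>. f \<eta> \<partial>N) = (\<Sum>\<xi>\<in>PiE A (\<lambda>_. {-1, 1}).
      f (pad V A \<xi>) * measure N (prod_emb V (\<lambda>_. count_space {-1, 1}) A {\<xi>}))"
proof -
  interpret prob_space N using lawD[OF N] by simp
  let ?\<Xi> = "PiE A (\<lambda>_. {-1, 1 :: int})" and ?e = "prod_emb V (\<lambda>_. count_space {-1, 1 :: int}) A"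
  have fin: "finite ?\<Xi>" using A by (intro finite_PiE) auto
  have meas: "?e {\<xi>} \<in> sets N" if "\<xi> \<in> ?\<Xi>" for \<xi>
    using that emb_measurable[OF A, of "{\<xi>}"] lawD(2)[OF N] by auto
  have "(\<integral>\<eta>. f \<eta> \<partial>N) = (\<integral>\<eta>. (\<Sum>\<xi>\<in>?\<Xi>. f (pad V A \<xi>) * indicator (?e {\<xi>}) \<eta>) \<partial>N)"
  proof (rule Bochner_Integration.integral_cong[OF refl])
    fix \<eta> assume "\<eta> \<in> space N"
    then have \<eta>: "\<eta> \<in> space (config_space V)" using lawD(3)[OF N] by simp
    have vals: "\<forall>x\<in>A. \<eta> x \<in> {-1, 1}" using config_values[OF \<eta> A(2)] .
    have r: "restrict \<eta> A \<in> ?\<Xi>" using vals by auto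
    have "indicator (?e {\<xi>}) \<eta> = (of_bool (\<xi> = restrict \<eta> A) :: real)" for \<xi>
      using \<eta> by (auto simp: indicator_def prod_emb_def space_config)
    then have "(\<Sum>\<xi>\<in>?\<Xi>. f (pad V A \<xi>) * indicator (?e {\<xi>}) \<eta>) = f (pad V A (restrict \<eta> A))"
      using fin r by (simp add: of_bool_def if_distrib[of "(*) _"] cong: if_cong)
    also have "\<dots> = f \<eta>"
      using vals \<eta> A by (intro dep pad_config) (auto simp: pad_eq)
    finally show "f \<eta> = (\<Sum>\<xi>\<in>?\<Xi>. f (pad V A \<xi>) * indicator (?e {\<xi>}) \<eta>)" by simp
  qed
  also have "\<dots> = (\<Sum>\<xi>\<in>?\<Xi>. f (pad V A \<xi>) * measure N (?e {\<xi>}))"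
    using meas by (subst Bochner_Integration.integral_sum) (auto simp: emeasure_eq_measure)
  finally show ?thesis .
qed

text \<open>
  Compactness of the space of laws, in the form in which the limits of all expectations are known
  to exist.  The limits of the probabilities of cylinders form a consistent family of finite
  dimensional laws.  Their extension is countably additive, because a decreasing sequence of
  nonempty cylinders in a compact space has a common point.
\<close>

lemma limit_law_exists:
  fixes N :: "nat \<Rightarrow> ('v \<Rightarrow> int) measure"
  assumes N: "\<And>n. law V (N n)"
    and conv: "\<And>f. continuous_observable V f \<Longrightarrow> convergent (\<lambda>n. \<integral>\<eta>. f \<eta> \<partial>N n)"
  shows "\<exists>\<mu>. law V \<mu> \<and> (\<forall>f. continuous_observable V f \<longrightarrow> (\<lambda>n. \<integral>\<eta>. f \<eta> \<partial>N n) \<longlonglongrightarrow> (\<integral>\<eta>. f \<eta> \<partial>\<mu>))"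
proof -
  let ?M = "\<lambda>_::'v. count_space {-1, 1 :: int}"
  let ?C = "\<lambda>J. PiE J (\<lambda>_::'v. {-1, 1 :: int})"
  \<comment> \<open>The prospective probability that the restriction of a configuration to \<open>J\<close> lies in \<open>X\<close>.\<close>
  define l where "l J X = lim (\<lambda>n. measure (N n) (prod_emb V ?M J X))" for J X
  have finC: "finite (?C J)" if "finite J" for J using that by (intro finite_PiE) auto
  have PiM: "PiM J ?M = count_space (?C J)" if "finite J" for J
    using that by (intro count_space_PiM_finite) auto
  have meas: "prod_emb V ?M J X \<in> sets (N n)" if "finite J" "J \<subseteq> V" "X \<subseteq> ?C J" for J X n
    using emb_measurable[OF that] lawD(2)[OF N] by simp
  have lim: "(\<lambda>n. measure (N n) (prod_emb V ?M J X)) \<longlonglongrightarrow> l J X"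
    if J: "finite J" "J \<subseteq> V" "X \<subseteq> ?C J" for J X
  proof -
    have "convergent (\<lambda>n. \<integral>\<eta>. indicator (prod_emb V ?M J X) \<eta> \<partial>N n :: real)"
      by (intro conv continuous_cylinder cylinder_emb J)
    also have "(\<lambda>n. \<integral>\<eta>. indicator (prod_emb V ?M J X) \<eta> \<partial>N n :: real)
        = (\<lambda>n. measure (N n) (prod_emb V ?M J X))"
    proof
      fix n
      interpret prob_space "N n" using lawD[OF N] by simp
      show "(\<integral>\<eta>. indicator (prod_emb V ?M J X) \<eta> \<partial>N n :: real) = measure (N n) (prod_emb V ?M J X)"
        using meas[OF J] by simp
    qed
    finally show ?thesis by (simp add: l_def convergent_LIMSEQ_iff)
  qed
  have l_nonneg: "l J X \<ge> 0" if "finite J" "J \<subseteq> V" "X \<subseteq> ?C J" for J X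
    using lim[OF that] by (rule LIMSEQ_le_const) auto
  have l_sum: "l J X = (\<Sum>\<xi>\<in>X. l J {\<xi>})" if J: "finite J" "J \<subseteq> V" "X \<subseteq> ?C J" for J X
  proof (rule LIMSEQ_unique[OF lim[OF J]])
    have "(\<lambda>n. \<Sum>\<xi>\<in>X. measure (N n) (prod_emb V ?M J {\<xi>})) \<longlonglongrightarrow> (\<Sum>\<xi>\<in>X. l J {\<xi>})"
      using J by (intro tendsto_sum lim) auto
    then show "(\<lambda>n. measure (N n) (prod_emb V ?M J X)) \<longlonglongrightarrow> (\<Sum>\<xi>\<in>X. l J {\<xi>})"
      by (simp only: prob_emb_eq_sum[OF N J])
  qed
  define P where "P J = point_measure (?C J) (\<lambda>\<xi>. ennreal (l J {\<xi>}))" for J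
  have space_marginal: "space (P J) = ?C J" and sets_marginal: "sets (P J) = Pow (?C J)" for J
    by (simp_all add: P_def space_point_measure sets_point_measure)
  have emeasure_marginal: "emeasure (P J) X = ennreal (l J X)" if J: "finite J" "J \<subseteq> V" "X \<subseteq> ?C J" for J X
  proof -
    have "emeasure (P J) X = (\<Sum>\<xi>\<in>X. ennreal (l J {\<xi>}))"
      unfolding P_def using J finC by (intro emeasure_point_measure_finite) auto
    also have "\<dots> = ennreal (\<Sum>\<xi>\<in>X. l J {\<xi>})" using J l_nonneg by (intro sum_ennreal) auto
    finally show ?thesis using l_sum[OF J] by simp
  qed
  interpret projective_family V P ?M
  proof (rule projective_family.intro)
    fix J H assume H: "J \<subseteq> H" "finite H" "H \<subseteq> V"
    then have J: "finite J" "J \<subseteq> V" by (auto intro: finite_subset)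
    have restr: "(\<lambda>f. restrict f J) \<in> P H \<rightarrow>\<^sub>M PiM J ?M"
      using H by (auto simp: PiM[OF J(1)] measurable_def space_marginal sets_marginal)
    show "P J = distr (P H) (PiM J ?M) (\<lambda>f. restrict f J)"
    proof (rule measure_eqI)
      show "sets (P J) = sets (distr (P H) (PiM J ?M) (\<lambda>f. restrict f J))"
        by (simp add: sets_marginal PiM[OF J(1)])
      fix X assume "X \<in> sets (P J)"
      then have X: "X \<subseteq> ?C J" by (simp add: sets_marginal)
      have "emeasure (distr (P H) (PiM J ?M) (\<lambda>f. restrict f J)) X
          = emeasure (P H) ((\<lambda>f. restrict f J) -` X \<inter> space (P H))"
        using X by (intro emeasure_distr[OF restr]) (simp add: PiM[OF J(1)])
      also have "(\<lambda>f. restrict f J) -` X \<inter> space (P H) = prod_emb H ?M J X"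
        by (simp add: prod_emb_def space_marginal)
      also have "emeasure (P H) (prod_emb H ?M J X) = ennreal (l H (prod_emb H ?M J X))"
        using H by (intro emeasure_marginal) (auto simp: prod_emb_def)
      also have "l H (prod_emb H ?M J X) = l J X" using H by (simp add: l_def)
      also have "ennreal (l J X) = emeasure (P J) X" using emeasure_marginal[OF J X] by simp
      finally show "emeasure (P J) X = emeasure (distr (P H) (PiM J ?M) (\<lambda>f. restrict f J)) X" ..
    qed
  next
    fix J assume J: "finite J" "J \<subseteq> V"
    show "prob_space (P J)"
    proof
      have "prod_emb V ?M J (?C J) = space (config_space V)"
        using config_values[OF _ J(2)] by (fastforce simp: prod_emb_def space_config)
      moreover have "measure (N n) (space (config_space V)) = 1" for n
        using lawD(1,3)[OF N[of n]] prob_space.prob_space by metis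
      ultimately have "l J (?C J) = 1" unfolding l_def by simp
      then show "emeasure (P J) (space (P J)) = 1" using emeasure_marginal[OF J, of "?C J"] by (simp add: space_marginal)
    qed
  qed
  have lim_emb: "emeasure lim (prod_emb V ?M J X) = ennreal (l J X)"
    if J: "finite J" "J \<subseteq> V" "X \<subseteq> ?C J" for J X
  proof -
    have "emeasure lim (prod_emb V ?M J X) = emeasure (P J) X"
    proof (rule emeasure_lim[OF J(1,2)])
      show "X \<in> sets (PiM J ?M)" using J by (simp add: PiM)
      fix J :: "nat \<Rightarrow> 'v set" and X :: "nat \<Rightarrow> ('v \<Rightarrow> int) set"
      assume J: "\<And>i. J i \<subseteq> V" "\<And>i. finite (J i)" and X: "\<And>i. X i \<in> sets (PiM (J i) ?M)"
        and dec: "decseq (\<lambda>i. prod_emb V ?M (J i) (X i))" and pos: "0 < (INF i. emeasure (P (J i)) (X i))"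
      have X': "X i \<subseteq> ?C (J i)" for i using X[of i] PiM[OF J(2)] by simp
      show "(\<Inter>i. prod_emb V ?M (J i) (X i)) \<noteq> {}"
      proof (rule compact_space_imp_nest[OF compact_config _ _ dec])
        fix i
        have emb: "prod_emb V ?M (J i) Y = (\<Union>\<xi>\<in>Y. cyl V (J i) \<xi>)" if "Y \<subseteq> ?C (J i)" for Y
        proof -
          have eq: "restrict \<eta> (J i) = \<xi> \<longleftrightarrow> (\<forall>x\<in>J i. \<eta> x = \<xi> x)" if "\<xi> \<in> ?C (J i)" for \<eta> \<xi>
            using that by (auto simp: fun_eq_iff PiE_iff extensional_def)
          show ?thesis
          proof (intro set_eqI iffI)
            fix \<eta> assume "\<eta> \<in> prod_emb V ?M (J i) Y"
            then have "\<eta> \<in> space (config_space V)" "restrict \<eta> (J i) \<in> Y"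
              by (simp_all add: prod_emb_def space_config)
            then show "\<eta> \<in> (\<Union>\<xi>\<in>Y. cyl V (J i) \<xi>)"
              by (intro UN_I[of "restrict \<eta> (J i)"]) (auto simp: cyl_def)
          next
            fix \<eta> assume "\<eta> \<in> (\<Union>\<xi>\<in>Y. cyl V (J i) \<xi>)"
            then obtain \<xi> where \<xi>: "\<xi> \<in> Y" "\<eta> \<in> cyl V (J i) \<xi>" by blast
            then have "restrict \<eta> (J i) = \<xi>" using eq[of \<xi> \<eta>] that by (auto simp: cyl_def)
            then show "\<eta> \<in> prod_emb V ?M (J i) Y"
              using \<xi> by (simp add: prod_emb_def cyl_def space_config)
          qed
        qed
        have "openin (config_topology V) (prod_emb V ?M (J i) (?C (J i) - X i))"
          unfolding emb[OF Diff_subset] using J by (intro openin_clauses(3)) (auto intro: cyl_openin)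
        moreover have "prod_emb V ?M (J i) (?C (J i) - X i)
            = topspace (config_topology V) - prod_emb V ?M (J i) (X i)"
        proof -
          have "restrict \<eta> (J i) \<in> ?C (J i)" if "\<eta> \<in> space (config_space V)" for \<eta>
            using config_values[OF that J(1)] by auto
          then show ?thesis by (auto simp: prod_emb_def topspace_config space_config)
        qed
        moreover have "prod_emb V ?M (J i) (X i) \<subseteq> topspace (config_topology V)"
          by (auto simp: prod_emb_def topspace_config space_config)
        ultimately show "closedin (config_topology V) (prod_emb V ?M (J i) (X i))"
          by (simp add: closedin_def)
        have "emeasure (P (J i)) (X i) > 0" using pos by (rule less_le_trans) (rule INF_lower, simp)
        then have "X i \<noteq> {}" by auto
        then obtain \<xi> where \<xi>: "\<xi> \<in> X i" by blast
        then have "\<xi> \<in> ?C (J i)" using X' by blast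
        then have "pad V (J i) \<xi> \<in> cyl V (J i) \<xi>"
          using J(1)[of i] by (auto simp: cyl_def pad_eq PiE_iff intro!: pad_config)
        then show "prod_emb V ?M (J i) (X i) \<noteq> {}" using emb[OF X'] \<xi> by blast
      qed
    qed
    then show ?thesis using emeasure_marginal[OF J] by simp
  qed
  have law: "law V lim"
    unfolding law_def space_prob_algebra
  proof (intro CollectI conjI)
    show "sets lim = sets (config_space V)" by (simp add: config_space_def)
    show "prob_space lim"
    proof
      have "l {} (?C {}) = 1"
        using prob_space_P[of "{}"] emeasure_marginal[of "{}" "?C {}"] prob_space.emeasure_space_1[of "P {}"]
        by (simp add: space_marginal)
      moreover have "prod_emb V ?M {} (?C {}) = space lim"
        by (auto simp: prod_emb_def space_PiM)
      ultimately show "emeasure lim (space lim) = 1" using lim_emb[of "{}" "?C {}"] by simp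
    qed
  qed
  have "(\<lambda>n. \<integral>\<eta>. f \<eta> \<partial>N n) \<longlonglongrightarrow> (\<integral>\<eta>. f \<eta> \<partial>lim)" if f: "continuous_observable V f" for f
  proof (rule LIMSEQ_I)
    fix e :: real assume e: "e > 0"
    obtain A where A: "finite A" "A \<subseteq> V"
      and dep: "\<And>\<eta> \<zeta>. \<eta> \<in> space (config_space V) \<Longrightarrow> \<zeta> \<in> space (config_space V) \<Longrightarrow>
        \<forall>x\<in>A. \<eta> x = \<zeta> x \<Longrightarrow> \<bar>f \<eta> - f \<zeta>\<bar> < e / 3"
      using finite_dependence[OF f, of "e / 3"] e by auto
    define g where "g \<eta> = f (pad V A \<eta>)" for \<eta>
    have g_dep: "g \<eta> = g \<zeta>" if "\<forall>x\<in>A. \<eta> x = \<zeta> x" for \<eta> \<zeta>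
      unfolding g_def using that by (intro arg_cong[where f = f]) (auto simp: pad_def)
    then have g: "continuous_observable V g"
      by (intro continuous_cylinder) (use A in \<open>auto simp: cylinder_def\<close>)
    have fg: "\<bar>f \<eta> - g \<eta>\<bar> \<le> e / 3" if "\<eta> \<in> space (config_space V)" for \<eta>
      unfolding g_def using that
      by (intro less_imp_le[OF dep] pad_config config_values[OF that A(2)]) (auto simp: pad_eq A)
    have int_g: "(\<integral>\<eta>. g \<eta> \<partial>N') = (\<Sum>\<xi>\<in>?C A. g (pad V A \<xi>) * measure N' (prod_emb V ?M A {\<xi>}))"
      if "law V N'" for N'
      by (rule integral_cylinder[OF that A]) (rule g_dep)
    have "measure lim (prod_emb V ?M A {\<xi>}) = l A {\<xi>}" if "\<xi> \<in> ?C A" for \<xi>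
      using lim_emb[OF A, of "{\<xi>}"] l_nonneg[OF A, of "{\<xi>}"] that by (simp add: measure_def)
    then have "(\<lambda>n. \<integral>\<eta>. g \<eta> \<partial>N n) \<longlonglongrightarrow> (\<integral>\<eta>. g \<eta> \<partial>lim)"
      unfolding int_g[OF N] int_g[OF law]
      by (intro tendsto_sum tendsto_mult tendsto_const) (use lim[OF A] in auto)
    then obtain n0 where n0: "\<And>n. n \<ge> n0 \<Longrightarrow> \<bar>(\<integral>\<eta>. g \<eta> \<partial>N n) - (\<integral>\<eta>. g \<eta> \<partial>lim)\<bar> < e / 3"
      using LIMSEQ_D[of _ _ "e / 3"] e by (metis (no_types, lifting) divide_pos_pos real_norm_def zero_less_numeral)
    show "\<exists>n0. \<forall>n\<ge>n0. norm ((\<integral>\<eta>. f \<eta> \<partial>N n) - (\<integral>\<eta>. f \<eta> \<partial>lim)) < e"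
    proof (intro exI[of _ n0] allI impI)
      fix n assume "n \<ge> n0"
      from n0[OF this] integral_close[OF N[of n] f g fg] integral_close[OF law f g fg]
      show "norm ((\<integral>\<eta>. f \<eta> \<partial>N n) - (\<integral>\<eta>. f \<eta> \<partial>lim)) < e"
        unfolding real_norm_def by linarith
    qed
  qed
  then show ?thesis using law by blast
qed

section \<open>Duality\<close>

context signed_graph
begin

lemma spin_product_sym_diff_singleton:
  assumes "\<eta> \<in> space (config_space V)" "finite A" "a \<in> V"
  shows "spin_product (sym_diff A {a}) \<eta> = spin_product A \<eta> * real_of_int (\<eta> a)"
proof -
  have sq: "real_of_int (\<eta> a) * real_of_int (\<eta> a) = 1"
    using config_values[OF assms(1), of "{a}"] assms(3) by auto
  show ?thesis
  proof (cases "a \<in> A")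
    case True
    then have "sym_diff A {a} = A - {a}" by auto
    moreover have "spin_product A \<eta> * real_of_int (\<eta> a)
        = spin_product (A - {a}) \<eta> * (real_of_int (\<eta> a) * real_of_int (\<eta> a))"
      using assms(2) True by (simp add: spin_product_def prod.remove[of A a] ac_simps)
    ultimately show ?thesis by (simp add: sq)
  next
    case False
    then have "sym_diff A {a} = insert a A" by auto
    then show ?thesis using False assms(2) by (simp add: spin_product_def mult.commute)
  qed
qed

text \<open>
  Flipping the spin at \<open>x\<close> changes the sign of \<open>spin_product A\<close> if \<open>x \<in> A\<close> and does nothing otherwise.
  The rest is the identity \<open>- 2 * of_bool (p \<noteq> \<sigma>) = \<sigma> * p - 1\<close> for signs \<open>p = \<eta> x * \<eta> y\<close> and
  \<open>\<sigma> = s {x, y}\<close>.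
\<close>

lemma voter_generator_spin_product:
  assumes \<eta>: "\<eta> \<in> space (config_space V)" and A: "finite A" "A \<subseteq> V"
  shows "voter_generator V E s (spin_product A) \<eta> = dual_gen (\<lambda>B. spin_product B \<eta>) A"
proof -
  have "voter_generator V E s (spin_product A) \<eta>
      = (\<Sum>\<^sub>\<infinity>x\<in>A. (spin_product A (flip \<eta> x) - spin_product A \<eta>) * flip_rate E s \<eta> x)"
    unfolding voter_generator_def
  proof (rule infsum_cong_neutral)
    fix x assume "x \<in> V - A"
    then have "spin_product A (flip \<eta> x) = spin_product A \<eta>"
      unfolding spin_product_def by (intro arg_cong[where f = real_of_int] prod.cong) (auto simp: flip_def)
    then show "(spin_product A (flip \<eta> x) - spin_product A \<eta>) * flip_rate E s \<eta> x = 0" by simp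
  qed (use A in auto)
  also have "\<dots> = (\<Sum>x\<in>A. (spin_product A (flip \<eta> x) - spin_product A \<eta>) * flip_rate E s \<eta> x)"
    using A by simp
  also have "\<dots> = dual_gen (\<lambda>B. spin_product B \<eta>) A"
    unfolding dual_gen_def
  proof (rule sum.cong[OF refl])
    fix x assume x: "x \<in> A"
    then have xV: "x \<in> V" using A by auto
    have "(\<Prod>y\<in>A. flip \<eta> x y) = - (\<Prod>y\<in>A. \<eta> y)"
    proof -
      have "(\<Prod>y\<in>A - {x}. flip \<eta> x y) = (\<Prod>y\<in>A - {x}. \<eta> y)" by (intro prod.cong) (auto simp: flip_def)
      then show ?thesis using A x by (simp add: prod.remove[of A x] flip_def)
    qed
    then have "spin_product A (flip \<eta> x) = - spin_product A \<eta>" by (simp add: spin_product_def)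
    then have "(spin_product A (flip \<eta> x) - spin_product A \<eta>) * flip_rate E s \<eta> x
        = avg (\<lambda>y. - 2 * spin_product A \<eta> * of_bool (\<eta> x * \<eta> y \<noteq> s {x, y})) x"
      by (simp add: flip_rate_def avg_def sum_distrib_left divide_inverse sum_negf ac_simps)
    also have "\<dots> = avg (\<lambda>y. real_of_int (s {x, y}) * spin_product (sym_diff A {x, y}) \<eta> - spin_product A \<eta>) x"
    proof -
      have "- 2 * spin_product A \<eta> * of_bool (\<eta> x * \<eta> y \<noteq> s {x, y})
          = real_of_int (s {x, y}) * spin_product (sym_diff A {x, y}) \<eta> - spin_product A \<eta>"
        if y: "y \<in> nbrs E x" for y
      proof -
        have "sym_diff A {x, y} = sym_diff (sym_diff A {x}) {y}" using nbrsD(3)[OF y] x by auto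
        then have "spin_product (sym_diff A {x, y}) \<eta> = spin_product A \<eta> * real_of_int (\<eta> x) * real_of_int (\<eta> y)"
          using A xV nbrsD(2)[OF y] by (simp add: spin_product_sym_diff_singleton[OF \<eta>])
        moreover have "\<eta> x = 1 \<or> \<eta> x = -1" "\<eta> y = 1 \<or> \<eta> y = -1"
          using config_values[OF \<eta>, of "{x, y}"] xV nbrsD(2)[OF y] by auto
        ultimately show ?thesis using nbrsD(4)[OF y] by auto
      qed
      then show ?thesis unfolding avg_def by (simp cong: sum.cong)
    qed
    also have "\<dots> = signed_avg (\<lambda>y. spin_product (sym_diff A {x, y}) \<eta>) x - spin_product A \<eta>"
      using avg_const[OF xV] by (simp add: avg_diff signed_avg_def)
    finally show "(spin_product A (flip \<eta> x) - spin_product A \<eta>) * flip_rate E s \<eta> x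
        = signed_avg (\<lambda>y. spin_product (sym_diff A {x, y}) \<eta>) x - spin_product A \<eta>" .
  qed
  finally show ?thesis .
qed

end

locale voter_process = signed_graph V E s for V :: "'v set" and E s +
  fixes P :: "real \<Rightarrow> ('v \<Rightarrow> int) \<Rightarrow> ('v \<Rightarrow> int) measure"
  assumes svm: "signed_voter_model V E s P"
begin

abbreviation \<Omega> where "\<Omega> \<equiv> space (config_space V)"
abbreviation T where "T \<equiv> semigroup_op P"

lemma kernel: "t \<ge> 0 \<Longrightarrow> P t \<in> config_space V \<rightarrow>\<^sub>M prob_algebra (config_space V)"
  using svm by (simp add: signed_voter_model_def feller_process_def)

lemma law_P: "t \<ge> 0 \<Longrightarrow> \<eta> \<in> \<Omega> \<Longrightarrow> law V (P t \<eta>)"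
  unfolding law_def by (rule measurable_space[OF kernel])

lemma continuous_T: "continuous_observable V f \<Longrightarrow> t \<ge> 0 \<Longrightarrow> continuous_observable V (T t f)"
  and T_at_0: "continuous_observable V f \<Longrightarrow> uniform_limit \<Omega> (\<lambda>t. T t f) f (at_right 0)"
  and generator: "cylinder V f \<Longrightarrow>
      uniform_limit \<Omega> (\<lambda>t \<eta>. (T t f \<eta> - f \<eta>) / t) (voter_generator V E s f) (at_right 0)"
  using svm by (auto simp: signed_voter_model_def feller_process_def)

text \<open>
  If \<open>\<nu>\<close> is the law at time 0, then both sides are the expectation of \<open>f\<close> at time \<open>t\<close>.  The lemma
  yields the semigroup property of \<open>T\<close> and the invariance of integrals under an equilibrium.
\<close>

lemma integral_bind_P:
  assumes \<nu>: "law V \<nu>" and t: "t \<ge> 0" and f: "continuous_observable V f"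
  shows "(\<integral>\<eta>. f \<eta> \<partial>(\<nu> \<bind> P t)) = (\<integral>\<eta>. T t f \<eta> \<partial>\<nu>)"
proof -
  interpret \<nu>: prob_space \<nu> using lawD[OF \<nu>] by simp
  obtain C where C: "\<And>\<eta>. \<eta> \<in> \<Omega> \<Longrightarrow> \<bar>f \<eta>\<bar> \<le> C" using bounded_continuous_observable[OF f] by blast
  have kernel': "P t \<in> \<nu> \<rightarrow>\<^sub>M subprob_algebra (config_space V)"
    using measurable_prob_algebraD[OF kernel[OF t]] measurable_cong_sets[OF lawD(2)[OF \<nu>] refl] by blast
  have mass: "AE \<eta> in \<nu>. emeasure (P t \<eta>) (space (P t \<eta>)) \<le> ennreal 1"
  proof (rule AE_I2)
    fix \<eta> assume "\<eta> \<in> space \<nu>"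
    then have "prob_space (P t \<eta>)" using lawD(1)[OF law_P[OF t]] lawD(3)[OF \<nu>] by simp
    then show "emeasure (P t \<eta>) (space (P t \<eta>)) \<le> ennreal 1"
      by (simp add: prob_space.emeasure_space_1)
  qed
  show ?thesis
    unfolding semigroup_op_def
    by (rule integral_bind[OF measurable_continuous_observable[OF f] C kernel' \<nu>.finite_measure_axioms mass])
qed

lemma T_add:
  assumes "r \<ge> 0" "t \<ge> 0" "\<eta> \<in> \<Omega>" "continuous_observable V f"
  shows "T (r + t) f \<eta> = T r (T t f) \<eta>"
proof -
  have "P (r + t) \<eta> = P r \<eta> \<bind> P t"
    using svm assms by (simp add: signed_voter_model_def feller_process_def)
  then show ?thesis
    using integral_bind_P[OF law_P[OF assms(1,3)] assms(2,4)] by (simp add: semigroup_op_def)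
qed

lemma T_close:
  assumes "t \<ge> 0" "\<eta> \<in> \<Omega>" "continuous_observable V f" "continuous_observable V g"
    and "\<And>\<zeta>. \<zeta> \<in> \<Omega> \<Longrightarrow> \<bar>f \<zeta> - g \<zeta>\<bar> \<le> e"
  shows "\<bar>T t f \<eta> - T t g \<eta>\<bar> \<le> e"
  unfolding semigroup_op_def by (rule integral_close[OF law_P[OF assms(1,2)] assms(3-5)])

lemma cylinder_spin_product: "finite A \<Longrightarrow> A \<subseteq> V \<Longrightarrow> cylinder V (spin_product A)"
  unfolding cylinder_def spin_product_def by (intro exI[of _ A]) (auto intro!: prod.cong)

lemma continuous_diff_quotient:
  "continuous_observable V f \<Longrightarrow> continuous_observable V g \<Longrightarrow> continuous_observable V (\<lambda>\<eta>. (f \<eta> - g \<eta>) / r)"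
  unfolding continuous_observable_def divide_inverse mult.commute[of _ "inverse r"]
  by (intro continuous_map_real_mult_left continuous_map_diff)

lemma continuous_dual_gen:
  assumes A: "finite A" "A \<subseteq> V"
  shows "continuous_observable V (\<lambda>\<eta>. dual_gen (\<lambda>B. spin_product B \<eta>) A)"
proof -
  note cont = continuous_spin_product[unfolded continuous_observable_def]
  show ?thesis
    unfolding continuous_observable_def dual_gen_def signed_avg_def avg_def divide_inverse
      mult.commute[of _ "inverse _"]
    using A dual_step[OF A]
    by (intro continuous_map_sum continuous_map_diff continuous_map_real_mult_left cont finite_nbrs) auto
qed

lemma T_dual_gen:
  assumes A: "finite A" "A \<subseteq> V" and t: "t \<ge> 0" and \<eta>: "\<eta> \<in> \<Omega>"
  shows "T t (\<lambda>\<eta>. dual_gen (\<lambda>B. spin_product B \<eta>) A) \<eta> = dual_gen (\<lambda>B. T t (spin_product B) \<eta>) A"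
proof -
  have int: "integrable (P t \<eta>) (spin_product B)" if "finite B" "B \<subseteq> V" for B
    by (rule integrable_observable[OF law_P[OF t \<eta>] continuous_spin_product[OF that]])
  have int': "integrable (P t \<eta>) (spin_product (sym_diff A {x, y}))" if "x \<in> A" "y \<in> nbrs E x" for x y
    using dual_step(1,2)[OF A that] by (rule int)
  have int_avg: "integrable (P t \<eta>) (\<lambda>\<zeta>. signed_avg (\<lambda>y. spin_product (sym_diff A {x, y}) \<zeta>) x)"
    if "x \<in> A" for x
    unfolding signed_avg_def avg_def divide_inverse
    by (intro integrable_mult_left integrable_mult_right Bochner_Integration.integrable_sum int'[OF that])
  have "T t (\<lambda>\<eta>. dual_gen (\<lambda>B. spin_product B \<eta>) A) \<eta>
      = (\<Sum>x\<in>A. \<integral>\<zeta>. signed_avg (\<lambda>y. spin_product (sym_diff A {x, y}) \<zeta>) x - spin_product A \<zeta> \<partial>P t \<eta>)"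
    unfolding semigroup_op_def dual_gen_def
    by (rule Bochner_Integration.integral_sum)
      (intro Bochner_Integration.integrable_diff int_avg int[OF A])
  also have "\<dots> = (\<Sum>x\<in>A. signed_avg (\<lambda>y. T t (spin_product (sym_diff A {x, y})) \<eta>) x - T t (spin_product A) \<eta>)"
  proof (rule sum.cong[OF refl])
    fix x assume x: "x \<in> A"
    have "(\<integral>\<zeta>. signed_avg (\<lambda>y. spin_product (sym_diff A {x, y}) \<zeta>) x \<partial>P t \<eta>)
        = signed_avg (\<lambda>y. T t (spin_product (sym_diff A {x, y})) \<eta>) x"
      unfolding signed_avg_def avg_def semigroup_op_def
      using int'[OF x] by (simp add: Bochner_Integration.integral_sum del: Un_Diff_cancel)
    then show "(\<integral>\<zeta>. signed_avg (\<lambda>y. spin_product (sym_diff A {x, y}) \<zeta>) x - spin_product A \<zeta> \<partial>P t \<eta>)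
        = signed_avg (\<lambda>y. T t (spin_product (sym_diff A {x, y})) \<eta>) x - T t (spin_product A) \<eta>"
      using int[OF A] int_avg[OF x] by (simp add: semigroup_op_def)
  qed
  finally show ?thesis by (simp add: dual_gen_def)
qed

text \<open>
  The generator is given as a uniform derivative at time 0 from the right.  The semigroup property
  transports it to time \<open>t\<close> from the right, and strong continuity at 0 handles increments to the
  left of \<open>t\<close>.
\<close>

lemma duality:
  assumes \<eta>: "\<eta> \<in> \<Omega>" and t: "t > 0" and A: "finite A" "A \<subseteq> V"
  shows "((\<lambda>t. T t (spin_product A) \<eta>) has_real_derivative dual_gen (\<lambda>B. T t (spin_product B) \<eta>) A) (at t)"
proof -
  let ?f = "spin_product A" and ?g = "\<lambda>\<eta>. dual_gen (\<lambda>B. spin_product B \<eta>) A"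
  have f: "continuous_observable V ?f" by (rule continuous_spin_product[OF A])
  have g: "continuous_observable V ?g" by (rule continuous_dual_gen[OF A])
  have q: "continuous_observable V (\<lambda>\<zeta>. (T r ?f \<zeta> - ?f \<zeta>) / r)" if "r > 0" for r
    using that by (intro continuous_diff_quotient continuous_T f) auto
  have T_q: "T u (\<lambda>\<zeta>. (T r ?f \<zeta> - ?f \<zeta>) / r) \<eta> = (T (u + r) ?f \<eta> - T u ?f \<eta>) / r"
    if "r > 0" "u \<ge> 0" for r u
  proof -
    have "T u (\<lambda>\<zeta>. (T r ?f \<zeta> - ?f \<zeta>) / r) \<eta> = (T u (T r ?f) \<eta> - T u ?f \<eta>) / r"
      unfolding semigroup_op_def[of P u] using that
      by (simp add: integrable_observable[OF law_P[OF _ \<eta>]] continuous_T f)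
    then show ?thesis using T_add[OF that(2) _ \<eta> f, of r] that by simp
  qed
  have "(\<lambda>h. (T (t + h) ?f \<eta> - T t ?f \<eta>) / h) \<midarrow>0\<rightarrow> T t ?g \<eta>"
  proof (rule LIM_I)
    fix e :: real assume e: "e > 0"
    have "\<forall>\<^sub>F r in at_right 0. \<forall>\<zeta>\<in>\<Omega>. dist ((T r ?f \<zeta> - ?f \<zeta>) / r) (voter_generator V E s ?f \<zeta>) < e / 3"
      using uniform_limitD[OF generator[OF cylinder_spin_product[OF A]], of "e / 3"] e by simp
    then obtain \<delta>1 where \<delta>1: "\<delta>1 > 0" "\<And>r \<zeta>. 0 < r \<Longrightarrow> r < \<delta>1 \<Longrightarrow> \<zeta> \<in> \<Omega> \<Longrightarrow>
        \<bar>(T r ?f \<zeta> - ?f \<zeta>) / r - ?g \<zeta>\<bar> \<le> e / 3"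
      unfolding eventually_at_right_field
      by (auto simp: dist_real_def voter_generator_spin_product A intro: less_imp_le)
    have "\<forall>\<^sub>F r in at_right 0. \<forall>\<zeta>\<in>\<Omega>. dist (T r ?g \<zeta>) (?g \<zeta>) < e / 3"
      using uniform_limitD[OF T_at_0[OF g], of "e / 3"] e by simp
    then obtain \<delta>2 where \<delta>2: "\<delta>2 > 0" "\<And>r \<zeta>. 0 < r \<Longrightarrow> r < \<delta>2 \<Longrightarrow> \<zeta> \<in> \<Omega> \<Longrightarrow>
        \<bar>T r ?g \<zeta> - ?g \<zeta>\<bar> \<le> e / 3"
      unfolding eventually_at_right_field by (auto simp: dist_real_def intro: less_imp_le)
    have quot: "\<bar>(T (u + r) ?f \<eta> - T u ?f \<eta>) / r - T u ?g \<eta>\<bar> \<le> e / 3" if "0 < r" "r < \<delta>1" "u \<ge> 0" for r u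
      using T_close[OF that(3) \<eta> q[OF that(1)] g \<delta>1(2)[OF that(1,2)]] T_q[OF that(1,3)] by simp
    show "\<exists>\<delta>>0. \<forall>h. h \<noteq> 0 \<and> norm (h - 0) < \<delta> \<longrightarrow> norm ((T (t + h) ?f \<eta> - T t ?f \<eta>) / h - T t ?g \<eta>) < e"
    proof (intro exI[of _ "min t (min \<delta>1 \<delta>2)"] conjI allI impI)
      show "0 < min t (min \<delta>1 \<delta>2)" using t \<delta>1(1) \<delta>2(1) by simp
      fix h :: real assume "h \<noteq> 0 \<and> norm (h - 0) < min t (min \<delta>1 \<delta>2)"
      then have h: "h \<noteq> 0" "\<bar>h\<bar> < t" "\<bar>h\<bar> < \<delta>1" "\<bar>h\<bar> < \<delta>2" by auto
      show "norm ((T (t + h) ?f \<eta> - T t ?f \<eta>) / h - T t ?g \<eta>) < e"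
      proof (cases "h > 0")
        case True
        then show ?thesis using quot[of h t] h t e by simp
      next
        \<comment> \<open>Rewrite the increment as one from time \<open>t - r\<close> to time \<open>t\<close>.\<close>
        case False
        define r where "r = - h"
        have r: "0 < r" "r < \<delta>1" "r < \<delta>2" "r < t" using False h by (auto simp: r_def)
        have "T t ?g \<eta> = T (t - r) (T r ?g) \<eta>" using T_add[of "t - r" r \<eta> ?g] r \<eta> g by simp
        moreover have "\<bar>T (t - r) (T r ?g) \<eta> - T (t - r) ?g \<eta>\<bar> \<le> e / 3"
          using r by (intro T_close \<eta> g continuous_T \<delta>2(2)) auto
        moreover have "\<bar>(T t ?f \<eta> - T (t - r) ?f \<eta>) / r - T (t - r) ?g \<eta>\<bar> \<le> e / 3"
          using quot[of r "t - r"] r by simp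
        moreover have "(T (t + h) ?f \<eta> - T t ?f \<eta>) / h = (T t ?f \<eta> - T (t - r) ?f \<eta>) / r"
          using r(1) by (simp add: r_def field_simps)
        ultimately show ?thesis using e unfolding real_norm_def by linarith
      qed
    qed
  qed
  then show ?thesis using T_dual_gen[OF A _ \<eta>, of t] t by (simp add: DERIV_def)
qed

lemma T_spin_product_bound:
  assumes "t \<ge> 0" "\<eta> \<in> \<Omega>" "finite A" "A \<subseteq> V"
  shows "\<bar>T t (spin_product A) \<eta>\<bar> \<le> 1"
  unfolding semigroup_op_def
  by (rule integral_bound[OF law_P[OF assms(1,2)] continuous_spin_product[OF assms(3,4)]])
    (use abs_spin_product assms(4) in fastforce)

section \<open>Loss of memory and ergodicity\<close>

text \<open>
  The two times are independent, so the condition is at once a Cauchy criterion for convergence in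
  time and the independence of the limit from the starting configuration; moreover it is
  preserved by linear combinations and by uniform limits.
\<close>

definition forgets :: "(('v \<Rightarrow> int) \<Rightarrow> real) \<Rightarrow> bool" where
  "forgets f \<longleftrightarrow> (\<forall>\<eta>\<in>\<Omega>. \<forall>\<eta>'\<in>\<Omega>.
     ((\<lambda>k. T (fst k) f \<eta> - T (snd k) f \<eta>') \<longlongrightarrow> 0) (at_top \<times>\<^sub>F at_top))"

lemma eventually_times_pos: "\<forall>\<^sub>F k in at_top \<times>\<^sub>F at_top. fst k > (0::real) \<and> snd k > (0::real)"
  unfolding eventually_prod_filter
  by (intro exI[of _ "\<lambda>t. t > 0"] conjI eventually_gt_at_top) auto

text \<open>
  Along a filter on which the differences converge for all finite sets at once, the limit is
  annihilated by \<open>dual_gen\<close>, since both flows become stationary, and it is 0 at the empty set, since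
  \<open>spin_product {} = 1\<close>.
\<close>

lemma forgets_spin_product:
  assumes liouville and A: "finite A" "A \<subseteq> V"
  shows "forgets (spin_product A)"
  unfolding forgets_def
proof (intro ballI)
  fix \<eta> \<eta>' assume \<eta>: "\<eta> \<in> \<Omega>" "\<eta>' \<in> \<Omega>"
  define H where "H \<zeta> t B = T t (spin_product B) \<zeta>" for \<zeta> t B
  define F where "F = (at_top \<times>\<^sub>F at_top :: (real \<times> real) filter)"
  define D where "D k B = (if fst k > 0 \<and> snd k > 0 \<and> finite B \<and> B \<subseteq> V
      then H \<eta> (fst k) B - H \<eta>' (snd k) B else 0)" for k B
  have H_bound: "\<bar>H \<zeta> t B\<bar> \<le> 1" if "\<zeta> \<in> \<Omega>" "t > 0" "finite B" "B \<subseteq> V" for \<zeta> t B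
    unfolding H_def using that by (intro T_spin_product_bound) auto
  have stat: "((\<lambda>t. dual_gen (H \<zeta> t) B) \<longlongrightarrow> 0) at_top" if "\<zeta> \<in> \<Omega>" "finite B" "B \<subseteq> V" for \<zeta> B
  proof (rule dual_flow_stationary[OF H_bound _ that(2,3)])
    show "((\<lambda>t. H \<zeta> t B) has_real_derivative dual_gen (H \<zeta> t) B) (at t)"
      if "t > 0" "finite B" "B \<subseteq> V" for t B
      using duality[OF \<open>\<zeta> \<in> \<Omega>\<close> that] by (simp add: H_def[abs_def])
  qed (use that in auto)
  have D_bound: "\<bar>D k B\<bar> \<le> 2" for k B
    using H_bound[OF \<eta>(1), of "fst k" B] H_bound[OF \<eta>(2), of "snd k" B] by (auto simp: D_def)
  have "((\<lambda>k. D k A) \<longlongrightarrow> 0) F"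
  proof (rule tendsto_zero_if_cluster_points_vanish[where D = D and C = 2, OF D_bound])
    fix G h assume G: "G \<noteq> bot" "G \<le> F" and lim: "\<And>B. ((\<lambda>k. D k B) \<longlongrightarrow> h B) G"
    have pos: "\<forall>\<^sub>F k in G. fst k > 0 \<and> snd k > 0"
      using eventually_times_pos G(2) unfolding F_def by (rule filter_leD[rotated])
    show "h A = 0"
    proof (rule dual_harmonic_eq_zero[OF assms(1) _ _ _ A])
      show "\<bar>h B\<bar> \<le> 2" for B
        using tendsto_upperbound[OF tendsto_rabs[OF lim] _ G(1)] D_bound by simp
      have "D k {} = 0" for k
        using law_P[of "fst k" \<eta>] law_P[of "snd k" \<eta>'] \<eta>
        by (auto simp: D_def H_def semigroup_op_def spin_product_def lawD(1) prob_space.prob_space)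
      then show "h {} = 0" using tendsto_unique[OF G(1) lim[of "{}"]] by simp
      fix B assume B: "finite B" "B \<subseteq> V"
      have "((\<lambda>k. dual_gen (D k) B) \<longlongrightarrow> dual_gen h B) G"
        unfolding dual_gen_def by (intro tendsto_intros tendsto_signed_avg lim)
      moreover have "((\<lambda>k. dual_gen (D k) B) \<longlongrightarrow> 0) G"
      proof -
        have "((\<lambda>k. dual_gen (H \<eta> (fst k)) B - dual_gen (H \<eta>' (snd k)) B) \<longlongrightarrow> 0 - 0) F"
          unfolding F_def
          by (intro tendsto_diff filterlim_compose[OF stat[OF \<eta>(1) B] filterlim_fst]
              filterlim_compose[OF stat[OF \<eta>(2) B] filterlim_snd])
        then have "((\<lambda>k. dual_gen (H \<eta> (fst k)) B - dual_gen (H \<eta>' (snd k)) B) \<longlongrightarrow> 0) G"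
          using G(2) by (auto intro: tendsto_mono)
        moreover have "\<forall>\<^sub>F k in G. dual_gen (H \<eta> (fst k)) B - dual_gen (H \<eta>' (snd k)) B = dual_gen (D k) B"
          using pos
        proof eventually_elim
          case (elim k)
          have D: "D k B' = H \<eta> (fst k) B' - H \<eta>' (snd k) B'" if "finite B'" "B' \<subseteq> V" for B'
            using elim that by (simp add: D_def)
          have "signed_avg (\<lambda>y. D k (sym_diff B {x, y})) x
              = signed_avg (\<lambda>y. H \<eta> (fst k) (sym_diff B {x, y})) x - signed_avg (\<lambda>y. H \<eta>' (snd k) (sym_diff B {x, y})) x"
            if "x \<in> B" for x
            unfolding signed_avg_diff[symmetric] by (intro signed_avg_cong D dual_step[OF B that])
          then show ?case by (simp add: dual_gen_def D[OF B] sum_subtractf right_diff_distrib)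
        qed
        ultimately show ?thesis by (rule Lim_transform_eventually)
      qed
      ultimately show "dual_gen h B = 0" using tendsto_unique[OF G(1)] by blast
    qed
  qed
  then show "((\<lambda>k. T (fst k) (spin_product A) \<eta> - T (snd k) (spin_product A) \<eta>') \<longlongrightarrow> 0) (at_top \<times>\<^sub>F at_top)"
    unfolding F_def
    by (rule Lim_transform_eventually) (use eventually_times_pos in eventually_elim, simp add: D_def H_def A)
qed

lemma forgets_continuous:
  assumes liouville and f: "continuous_observable V f"
  shows "forgets f"
  unfolding forgets_def
proof (intro ballI tendstoI)
  fix \<eta> \<eta>' and e :: real assume \<eta>: "\<eta> \<in> \<Omega>" "\<eta>' \<in> \<Omega>" and e: "e > 0"
  obtain A c where A: "finite A" "A \<subseteq> V"
    and fg: "\<forall>\<eta>\<in>\<Omega>. \<bar>f \<eta> - (\<Sum>B\<in>Pow A. c B * spin_product B \<eta>)\<bar> < e / 4"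
    using spin_sum_approximation[OF f, of "e / 4"] e by auto
  define g where "g \<eta> = (\<Sum>B\<in>Pow A. c B * spin_product B \<eta>)" for \<eta>
  have g: "continuous_observable V g"
    unfolding g_def[abs_def] by (rule continuous_spin_sum[OF A])
  have T_g: "T t g \<zeta> = (\<Sum>B\<in>Pow A. c B * T t (spin_product B) \<zeta>)" if "t \<ge> 0" "\<zeta> \<in> \<Omega>" for t \<zeta>
    unfolding semigroup_op_def g_def by (rule integral_spin_sum[OF law_P[OF that] A])
  have "((\<lambda>k. \<Sum>B\<in>Pow A. c B * (T (fst k) (spin_product B) \<eta> - T (snd k) (spin_product B) \<eta>'))
      \<longlongrightarrow> (\<Sum>B\<in>Pow A. c B * 0)) (at_top \<times>\<^sub>F at_top)"
    using forgets_spin_product[OF assms(1)] A \<eta>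
    by (intro tendsto_intros) (auto simp: forgets_def dest: finite_subset)
  then have "\<forall>\<^sub>F k in at_top \<times>\<^sub>F at_top.
      dist (\<Sum>B\<in>Pow A. c B * (T (fst k) (spin_product B) \<eta> - T (snd k) (spin_product B) \<eta>')) 0 < e / 2"
    using e by (intro tendstoD) auto
  then show "\<forall>\<^sub>F k in at_top \<times>\<^sub>F at_top. dist (T (fst k) f \<eta> - T (snd k) f \<eta>') 0 < e"
    using eventually_times_pos
  proof eventually_elim
    case (elim k)
    then have k: "fst k \<ge> 0" "snd k \<ge> 0" by auto
    have "\<bar>T (fst k) g \<eta> - T (snd k) g \<eta>'\<bar> < e / 2"
      using elim(1) by (simp add: T_g k \<eta> sum_subtractf right_diff_distrib)
    moreover have "\<bar>T (fst k) f \<eta> - T (fst k) g \<eta>\<bar> \<le> e / 4"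
      using fg by (intro T_close k \<eta> f g) (auto simp: g_def intro: less_imp_le)
    moreover have "\<bar>T (snd k) f \<eta>' - T (snd k) g \<eta>'\<bar> \<le> e / 4"
      using fg by (intro T_close k \<eta> f g) (auto simp: g_def intro: less_imp_le)
    ultimately show ?case unfolding dist_real_def by linarith
  qed
qed

lemma forgets_limit:
  assumes "forgets f" and \<eta>0: "\<eta>0 \<in> \<Omega>"
  obtains L where "\<And>\<eta>. \<eta> \<in> \<Omega> \<Longrightarrow> ((\<lambda>t. T t f \<eta>) \<longlongrightarrow> L) at_top"
proof -
  have close: "\<exists>R. \<forall>t\<ge>R. \<forall>t'\<ge>R. \<bar>T t f \<eta> - T t' f \<eta>0\<bar> < e" if "\<eta> \<in> \<Omega>" "e > 0" for \<eta> e
  proof -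
    have "\<forall>\<^sub>F k in at_top \<times>\<^sub>F at_top. dist (T (fst k) f \<eta> - T (snd k) f \<eta>0) 0 < e"
      using assms that unfolding forgets_def by (intro tendstoD) auto
    then obtain Q Q' where Q: "eventually Q at_top" "eventually Q' at_top"
      "\<And>t t'. Q t \<Longrightarrow> Q' t' \<Longrightarrow> \<bar>T t f \<eta> - T t' f \<eta>0\<bar> < e"
      unfolding eventually_prod_filter by (auto simp: dist_real_def)
    from Q(1,2) obtain R R' where "\<forall>t\<ge>R. Q t" "\<forall>t\<ge>R'. Q' t"
      unfolding eventually_at_top_linorder by blast
    then show ?thesis using Q(3) by (intro exI[of _ "max R R'"]) auto
  qed
  have "Cauchy (\<lambda>n. T (real n) f \<eta>0)"
  proof (rule metric_CauchyI)
    fix e :: real assume "e > 0"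
    then obtain R where R: "\<forall>t\<ge>R. \<forall>t'\<ge>R. \<bar>T t f \<eta>0 - T t' f \<eta>0\<bar> < e" using close[OF \<eta>0] by blast
    obtain n0 where "R \<le> real n0" using real_arch_simple by blast
    then show "\<exists>n0. \<forall>m\<ge>n0. \<forall>n\<ge>n0. dist (T (real m) f \<eta>0) (T (real n) f \<eta>0) < e"
      using R by (intro exI[of _ n0]) (auto simp: dist_real_def)
  qed
  then obtain L where L: "(\<lambda>n. T (real n) f \<eta>0) \<longlonglongrightarrow> L"
    using Cauchy_convergent_iff convergent_def by blast
  show thesis
  proof (rule that)
    fix \<eta> assume \<eta>: "\<eta> \<in> \<Omega>"
    show "((\<lambda>t. T t f \<eta>) \<longlongrightarrow> L) at_top"
    proof (rule tendstoI)
      fix e :: real assume e: "e > 0"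
      obtain R where R: "\<forall>t\<ge>R. \<forall>t'\<ge>R. \<bar>T t f \<eta> - T t' f \<eta>0\<bar> < e / 2" using close[OF \<eta>, of "e / 2"] e by auto
      obtain n0 where n0: "\<forall>n\<ge>n0. dist (T (real n) f \<eta>0) L < e / 2"
        using metric_LIMSEQ_D[OF L, of "e / 2"] e by auto
      obtain n1 where "R \<le> real n1" using real_arch_simple by blast
      then have n: "R \<le> real (max n0 n1)" by simp
      have "\<bar>T t f \<eta> - L\<bar> < e" if "t \<ge> R" for t
        using R[rule_format, OF that n] n0[rule_format, OF max.cobounded1, of n1] unfolding dist_real_def
        by linarith
      then show "\<forall>\<^sub>F t in at_top. dist (T t f \<eta>) L < e"
        unfolding eventually_at_top_linorder by (auto simp: dist_real_def)
    qed
  qed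
qed

text \<open>
  The law \<open>\<mu>\<close> of the limits is invariant because the limits of \<open>T (r + t) f\<close> and \<open>T r f\<close> as \<open>r\<close> tends
  to infinity agree.  An equilibrium \<open>\<nu>\<close> gives \<open>f\<close> and \<open>T n f\<close> the same integral, and \<open>T n f\<close> tends to
  a constant, so it equals \<open>\<mu>\<close>.
\<close>

lemma ergodic_if_liouville:
  assumes liouville
  shows "ergodic V P"
proof -
  obtain \<eta>0 where \<eta>0: "\<eta>0 \<in> \<Omega>" using config_nonempty by blast
  have law_n: "law V (P (real n) \<eta>0)" for n by (intro law_P \<eta>0) simp
  have "convergent (\<lambda>n. \<integral>\<eta>. f \<eta> \<partial>P (real n) \<eta>0)" if f: "continuous_observable V f" for f
  proof -
    obtain L where "\<And>\<eta>. \<eta> \<in> \<Omega> \<Longrightarrow> ((\<lambda>t. T t f \<eta>) \<longlongrightarrow> L) at_top"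
      using forgets_limit[OF forgets_continuous[OF assms f] \<eta>0] by blast
    from filterlim_compose[OF this[OF \<eta>0] filterlim_real_sequentially]
    show ?thesis unfolding semigroup_op_def by (rule convergentI)
  qed
  from limit_law_exists[OF law_n this]
  obtain \<mu> where \<mu>: "law V \<mu>"
    and lim_n: "\<And>f. continuous_observable V f \<Longrightarrow> (\<lambda>n. T (real n) f \<eta>0) \<longlonglongrightarrow> (\<integral>\<eta>. f \<eta> \<partial>\<mu>)"
    unfolding semigroup_op_def by blast
  have lim: "((\<lambda>t. T t f \<eta>) \<longlongrightarrow> (\<integral>\<eta>. f \<eta> \<partial>\<mu>)) at_top" if f: "continuous_observable V f" and \<eta>: "\<eta> \<in> \<Omega>" for f \<eta>
  proof -
    obtain L where L: "\<And>\<eta>. \<eta> \<in> \<Omega> \<Longrightarrow> ((\<lambda>t. T t f \<eta>) \<longlongrightarrow> L) at_top"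
      using forgets_limit[OF forgets_continuous[OF assms f] \<eta>0] by blast
    have "L = (\<integral>\<eta>. f \<eta> \<partial>\<mu>)"
      using LIMSEQ_unique[OF filterlim_compose[OF L[OF \<eta>0] filterlim_real_sequentially] lim_n[OF f]] .
    then show ?thesis using L[OF \<eta>] by simp
  qed
  have law_bind: "law V (\<nu> \<bind> P t)" if "law V \<nu>" "t \<ge> 0" for \<nu> t
    using that prob_space_bind'[OF _ kernel] sets_bind'[OF _ kernel]
    unfolding law_def by (simp add: space_prob_algebra[of "config_space V"])
  have "equilibrium V P \<mu>"
    unfolding equilibrium_def law_def[symmetric]
  proof (intro conjI allI impI \<mu>)
    fix t :: real assume t: "t \<ge> 0"
    show "\<mu> \<bind> P t = \<mu>"
    proof (rule law_eqI[OF law_bind[OF \<mu> t] \<mu>])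
      fix f assume f: "continuous_observable V f"
      have "(\<lambda>n. T (real n) (T t f) \<eta>0) \<longlonglongrightarrow> (\<integral>\<eta>. T t f \<eta> \<partial>\<mu>)"
        by (rule lim_n[OF continuous_T[OF f t]])
      moreover have "T (real n) (T t f) \<eta>0 = T (real n + t) f \<eta>0" for n
        using T_add[OF _ t \<eta>0 f, of "real n"] by simp
      moreover have "filterlim (\<lambda>n. real n + t) at_top sequentially" by real_asymp
      then have "(\<lambda>n. T (real n + t) f \<eta>0) \<longlonglongrightarrow> (\<integral>\<eta>. f \<eta> \<partial>\<mu>)"
        by (rule filterlim_compose[OF lim[OF f \<eta>0]])
      ultimately show "(\<integral>\<eta>. f \<eta> \<partial>(\<mu> \<bind> P t)) = (\<integral>\<eta>. f \<eta> \<partial>\<mu>)"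
        using LIMSEQ_unique integral_bind_P[OF \<mu> t f] by simp
    qed
  qed
  moreover have "\<nu> = \<mu>" if "equilibrium V P \<nu>" for \<nu>
  proof -
    have \<nu>: "law V \<nu>" and inv: "\<And>t. t \<ge> 0 \<Longrightarrow> \<nu> \<bind> P t = \<nu>"
      using that by (auto simp: equilibrium_def law_def)
    interpret \<nu>: prob_space \<nu> using lawD[OF \<nu>] by simp
    show ?thesis
    proof (rule law_eqI[OF \<nu> \<mu>])
      fix f assume f: "continuous_observable V f"
      obtain C where C: "\<And>\<eta>. \<eta> \<in> \<Omega> \<Longrightarrow> \<bar>f \<eta>\<bar> \<le> C" using bounded_continuous_observable[OF f] by blast
      have "(\<lambda>n. \<integral>\<eta>. T (real n) f \<eta> \<partial>\<nu>) \<longlonglongrightarrow> (\<integral>\<eta>. (\<integral>\<eta>. f \<eta> \<partial>\<mu>) \<partial>\<nu>)"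
      proof (rule integral_dominated_convergence[where w = "\<lambda>_. C"])
        show "T (real n) f \<in> borel_measurable \<nu>" for n
          using integrable_observable[OF \<nu> continuous_T[OF f]] by simp
        show "AE \<eta> in \<nu>. (\<lambda>n. T (real n) f \<eta>) \<longlonglongrightarrow> (\<integral>\<eta>. f \<eta> \<partial>\<mu>)"
          using lawD(3)[OF \<nu>] by (intro AE_I2 filterlim_compose[OF lim[OF f] filterlim_real_sequentially]) simp
        show "AE \<eta> in \<nu>. norm (T (real n) f \<eta>) \<le> C" for n
          using lawD(3)[OF \<nu>] integral_bound[OF law_P f C]
          by (intro AE_I2) (simp add: semigroup_op_def)
      qed auto
      moreover have "(\<integral>\<eta>. T (real n) f \<eta> \<partial>\<nu>) = (\<integral>\<eta>. f \<eta> \<partial>\<nu>)" for n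
        using integral_bind_P[OF \<nu> _ f, of "real n"] inv[of "real n"] by simp
      ultimately have "(\<lambda>n::nat. \<integral>\<eta>. f \<eta> \<partial>\<nu>) \<longlonglongrightarrow> (\<integral>\<eta>. f \<eta> \<partial>\<mu>)" by (simp add: \<nu>.prob_space)
      then show "(\<integral>\<eta>. f \<eta> \<partial>\<nu>) = (\<integral>\<eta>. f \<eta> \<partial>\<mu>)" by (simp add: LIMSEQ_const_iff)
    qed
  qed
  moreover have "converges_in_distribution V (\<lambda>t. P t \<eta>) \<mu>" if "\<eta> \<in> \<Omega>" for \<eta>
    unfolding converges_in_distribution_def using lim[OF _ that] by (simp add: semigroup_op_def)
  ultimately show ?thesis unfolding ergodic_def by blast
qed

end

theorem proposition3:
  fixes V :: "'v set" and E :: "'v set set" and s :: "'v set \<Rightarrow> int"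
    and M :: "'v \<Rightarrow> 'w measure" and X :: "'v \<Rightarrow> real \<Rightarrow> 'w \<Rightarrow> 'v"
    and P :: "real \<Rightarrow> ('v \<Rightarrow> int) \<Rightarrow> ('v \<Rightarrow> int) measure"
  assumes "lf_graph V E"
    and "sign_function E s"
    and "\<And>x. x \<in> V \<Longrightarrow> random_walk V E (M x) (X x) x"
    and "\<And>x. x \<in> V \<Longrightarrow>
           AE \<omega> in M x. traverses_infinitely_many_unsatisfied_cycles V E s (\<lambda>t. X x t \<omega>)"
    and "signed_voter_model V E s P"
  shows "ergodic V P"
proof -
  interpret voter_process V E s P
    using assms by unfold_locales
  have liouville using assms(3,4) by (rule liouville_if_odd_cycles)
  then show ?thesis by (rule ergodic_if_liouville)
qed

end
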